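(* Each sequential $k^*$-metrizable topological group $G$ has countable $\mathrm{cs}^*$-character and hence is a stratifiable $\aleph$-space. More precisely, $G$ is either metrizable or contains an open $k_\omega$-subgroup.
   Context: All topological spaces (and groups) are Hausdorff; "map" means continuous function. A subset is precompact if its closure is compact. A map $f:M\to X$ is subproper if there is $Z\subset M$ with $f(Z)=X$ such that $Z\cap f^{-1}(K)$ is precompact in $M$ for every precompact $K\subset X$. A space is $k^*$-metrizable if it is the image of a metrizable space under a subproper map. A subset is sequentially closed if it contains the limits of all its sequences convergent in $X$; $X$ is sequential if each sequentially closed subset is closed. A family $\mathcal N$ of subsets of $X$ is a $\mathrm{cs}^*$-network at $x\in X$ if for any neighborhood $U$ of $x$ and any sequence $\{x_n\}_{n\in\omega}\subset U$ convergent to $x$ there is $N\in\mathcal N$ with $N\subset U$ and $x_n\in N$ for infinitely many $n$. The $\mathrm{cs}^*$-character of $X$ at $x$ is the smallest size of a $\mathrm{cs}^*$-network at $x$; the $\mathrm{cs}^*$-character of $X$ is the supremum of these over $x\in X$, and it is countable if it is $\le\aleph_0$. A regular space $X$ is stratifiable if there is a function $G$ assigning to each $n\in\omega$ and closed $F\subset X$ an open set $G(n,F)\supset F$ such that $F=\bigcap_n\overline{G(n,F)}$ and $F\subset K$ implies $G(n,F)\subset G(n,K)$. An $\aleph$-space is a regular space with a $\sigma$-locally-finite $k$-network, where a $k$-network is a family $\mathcal N$ of subsets such that for every open $U$ and compact $K\subset U$ there is a finite $\mathcal F\subset\mathcal N$ with $K\subset\bigcup\mathcal F\subset U$. $X$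 is a $k_\omega$-space if there is a countable collection $\mathcal C$ of compact subsets of $X$ such that $X$ carries the strongest topology inducing the original topology on each $C\in\mathcal C$. A $k_\omega$-subgroup is a subgroup whose underlying topological space is a $k_\omega$-space. *)

theory Defs
  imports "HOL-Analysis.Analysis"
begin

unbundle cardinal_syntax

text \<open>
  Throughout, all spaces are Hausdorff; this convention is made explicit in the definitions of the
  classes of spaces below.
\<close>

subsection \<open>Sequential and \<open>k\<^sup>*\<close>-metrizable spaces\<close>

definition sequentially_closedin :: "'a topology \<Rightarrow> 'a set \<Rightarrow> bool" where
  "sequentially_closedin X S \<longleftrightarrow>
     S \<subseteq> topspace X \<and>
     (\<forall>\<sigma> x. range \<sigma> \<subseteq> S \<and> limitin X \<sigma> x sequentially \<longrightarrow> x \<in> S)"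

definition sequential_space :: "'a topology \<Rightarrow> bool" where
  "sequential_space X \<longleftrightarrow>
     Hausdorff_space X \<and> (\<forall>S. sequentially_closedin X S \<longrightarrow> closedin X S)"

definition precompactin :: "'a topology \<Rightarrow> 'a set \<Rightarrow> bool" where
  "precompactin X S \<longleftrightarrow> S \<subseteq> topspace X \<and> compactin X (X closure_of S)"

definition subproper_map :: "'m topology \<Rightarrow> 'a topology \<Rightarrow> ('m \<Rightarrow> 'a) \<Rightarrow> bool" where
  "subproper_map M X f \<longleftrightarrow>
     continuous_map M X f \<and>
     (\<exists>Z \<subseteq> topspace M. f ` Z = topspace X \<and>
        (\<forall>K. precompactin X K \<longrightarrow> precompactin M (Z \<inter> f -` K)))"

text \<open>
  HOL cannot quantify existentially over the type carrying the metrizable space, so that type is a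
  parameter. A theorem that assumes \<open>k_star_metrizable TYPE('m) X\<close> for a type variable
  \<open>'m\<close> that does not occur elsewhere covers metrizable spaces \<open>M\<close> over arbitrary types.
\<close>
definition k_star_metrizable :: "'m itself \<Rightarrow> 'a topology \<Rightarrow> bool" where
  "k_star_metrizable T X \<longleftrightarrow>
     Hausdorff_space X \<and>
     (\<exists>(M :: 'm topology) f. metrizable_space M \<and> subproper_map M X f)"

subsection \<open>The \<open>cs\<^sup>*\<close>-character\<close>

definition cs_star_network_at :: "'a topology \<Rightarrow> 'a \<Rightarrow> 'a set set \<Rightarrow> bool" where
  "cs_star_network_at X x \<N> \<longleftrightarrow>
     \<N> \<subseteq> Pow (topspace X) \<and>
     (\<forall>U \<sigma>. U \<subseteq> topspace X \<and> (\<exists>V. openin X V \<and> x \<in> V \<and> V \<subseteq> U) \<and>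
            range \<sigma> \<subseteq> U \<and> limitin X \<sigma> x sequentially
        \<longrightarrow> (\<exists>N\<in>\<N>. N \<subseteq> U \<and> infinite {n::nat. \<sigma> n \<in> N}))"

text \<open>
  Cardinals are represented by well-orders as in the library; the choice operator picks one
  representative of the smallest (respectively supremal) cardinal, which is determined only up to
  \<open>=o\<close>. The relation type \<open>'a set set rel\<close> is large enough for the supremum to exist, since
  every family of subsets of \<open>X\<close> has cardinality at most that of \<open>UNIV :: 'a set set\<close>.
\<close>
definition cs_star_character_at :: "'a topology \<Rightarrow> 'a \<Rightarrow> 'a set rel" where
  "cs_star_character_at X x =
     (SOME \<kappa>. (\<exists>\<N>. cs_star_network_at X x \<N> \<and> \<kappa> = |\<N>| ) \<and>
              (\<forall>\<N>. cs_star_network_at X x \<N> \<longrightarrow> \<kappa> \<le>o |\<N>| ))"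

definition cs_star_character_bound :: "'a topology \<Rightarrow> 'a set rel \<Rightarrow> bool" where
  "cs_star_character_bound X \<kappa> \<longleftrightarrow>
     Card_order \<kappa> \<and> (\<forall>x\<in>topspace X. cs_star_character_at X x \<le>o \<kappa>)"

definition cs_star_character :: "'a topology \<Rightarrow> 'a set rel" where
  "cs_star_character X =
     (SOME \<kappa>. cs_star_character_bound X \<kappa> \<and>
              (\<forall>\<mu>. cs_star_character_bound X \<mu> \<longrightarrow> \<kappa> \<le>o \<mu>))"

definition countable_cs_star_character :: "'a topology \<Rightarrow> bool" where
  "countable_cs_star_character X \<longleftrightarrow> cs_star_character X \<le>o natLeq"

lemma cs_star_network_at_Pow:
  assumes "x \<in> topspace X"
  shows "cs_star_network_at X x (Pow (topspace X))"
  unfolding cs_star_network_at_def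
proof (intro conjI allI impI)
  fix U and \<sigma> :: "nat \<Rightarrow> 'a"
  assume *: "U \<subseteq> topspace X \<and> (\<exists>V. openin X V \<and> x \<in> V \<and> V \<subseteq> U) \<and>
            range \<sigma> \<subseteq> U \<and> limitin X \<sigma> x sequentially"
  then have "{n. \<sigma> n \<in> U} = UNIV" by auto
  then show "\<exists>N\<in>Pow (topspace X). N \<subseteq> U \<and> infinite {n. \<sigma> n \<in> N}"
    using * by (intro bexI[of _ U]) auto
qed auto

lemma cs_star_character_at:
  assumes "x \<in> topspace X"
  shows "\<exists>\<N>. cs_star_network_at X x \<N> \<and> cs_star_character_at X x = |\<N>|"
    and "cs_star_network_at X x \<N> \<Longrightarrow> cs_star_character_at X x \<le>o |\<N>|"
proof -
  let ?R = "{|\<N>| | \<N>. cs_star_network_at X x \<N>}"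
  have "\<exists>r\<in>?R. \<forall>r'\<in>?R. r \<le>o r'"
    using cs_star_network_at_Pow[OF assms] by (intro exists_minim_Card_order) (auto intro: card_of_Card_order)
  then have "\<exists>\<kappa>. (\<exists>\<N>. cs_star_network_at X x \<N> \<and> \<kappa> = |\<N>| ) \<and>
              (\<forall>\<N>. cs_star_network_at X x \<N> \<longrightarrow> \<kappa> \<le>o |\<N>| )"
    by blast
  from someI_ex[OF this]
  show "\<exists>\<N>. cs_star_network_at X x \<N> \<and> cs_star_character_at X x = |\<N>|"
    and "cs_star_network_at X x \<N> \<Longrightarrow> cs_star_character_at X x \<le>o |\<N>|"
    unfolding cs_star_character_at_def by auto
qed

lemma cs_star_character:
  shows "cs_star_character_bound X (cs_star_character X)"
    and "cs_star_character_bound X \<mu> \<Longrightarrow> cs_star_character X \<le>o \<mu>"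
proof -
  have "cs_star_character_at X x \<le>o |UNIV :: 'a set set|" if "x \<in> topspace X" for x
    using cs_star_character_at(1)[OF that] card_of_mono1[OF subset_UNIV] by metis
  then have "cs_star_character_bound X |UNIV :: 'a set set|"
    by (simp add: cs_star_character_bound_def card_of_Card_order)
  then have "\<exists>r\<in>Collect (cs_star_character_bound X). \<forall>r'\<in>Collect (cs_star_character_bound X). r \<le>o r'"
    by (intro exists_minim_Card_order) (auto simp: cs_star_character_bound_def)
  then have "\<exists>\<kappa>. cs_star_character_bound X \<kappa> \<and>
              (\<forall>\<mu>. cs_star_character_bound X \<mu> \<longrightarrow> \<kappa> \<le>o \<mu>)"
    by blast
  from someI_ex[OF this]
  show "cs_star_character_bound X (cs_star_character X)"
    and "cs_star_character_bound X \<mu> \<Longrightarrow> cs_star_character X \<le>o \<mu>"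
    unfolding cs_star_character_def by auto
qed

lemma countable_iff_card_le_natLeq: "countable A \<longleftrightarrow> |A| \<le>o natLeq"
proof -
  have "countable A \<longleftrightarrow> |A| \<le>o |UNIV :: nat set|"
    unfolding countable_def card_of_ordLeq[symmetric] by auto
  then show ?thesis
    using card_of_nat ordLeq_ordIso_trans ordIso_symmetric by blast
qed

lemma countable_cs_star_character_iff:
  "countable_cs_star_character X \<longleftrightarrow>
     (\<forall>x\<in>topspace X. \<exists>\<N>. countable \<N> \<and> cs_star_network_at X x \<N>)"
proof
  assume L: "countable_cs_star_character X"
  show "\<forall>x\<in>topspace X. \<exists>\<N>. countable \<N> \<and> cs_star_network_at X x \<N>"
  proof
    fix x assume x: "x \<in> topspace X"
    obtain \<N> where \<N>: "cs_star_network_at X x \<N>" "cs_star_character_at X x = |\<N>|"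
      using cs_star_character_at(1)[OF x] by blast
    have "cs_star_character_at X x \<le>o cs_star_character X"
      using cs_star_character(1)[of X] x by (auto simp: cs_star_character_bound_def)
    then have "|\<N>| \<le>o natLeq"
      using L \<N>(2) ordLeq_transitive unfolding countable_cs_star_character_def by metis
    then show "\<exists>\<N>. countable \<N> \<and> cs_star_network_at X x \<N>"
      using \<N>(1) countable_iff_card_le_natLeq by blast
  qed
next
  assume R: "\<forall>x\<in>topspace X. \<exists>\<N>. countable \<N> \<and> cs_star_network_at X x \<N>"
  have le: "cs_star_character_at X x \<le>o natLeq" if x: "x \<in> topspace X" for x
  proof -
    obtain \<N> where "countable \<N>" "cs_star_network_at X x \<N>" using R x by blast
    then show ?thesis
      using cs_star_character_at(2)[OF x] countable_iff_card_le_natLeq ordLeq_transitive by blast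
  qed
  show "countable_cs_star_character X"
  proof (cases "natLeq \<le>o |UNIV :: 'a set set|")
    case True
    then have "|UNIV :: nat set| \<le>o |UNIV :: 'a set set|"
      using card_of_nat ordIso_ordLeq_trans by blast
    then obtain g :: "nat \<Rightarrow> 'a set" where g: "inj g"
      unfolding card_of_ordLeq[symmetric] by blast
    have eq: "|range g| =o natLeq"
      using card_of_ordIsoI[OF inj_on_imp_bij_betw[OF g]] card_of_nat
        ordIso_symmetric ordIso_transitive by blast
    then have "cs_star_character_bound X |range g|"
      unfolding cs_star_character_bound_def
      using le ordLeq_ordIso_trans ordIso_symmetric card_of_Card_order by blast
    then show ?thesis
      unfolding countable_cs_star_character_def
      using cs_star_character(2) eq ordLeq_ordIso_trans by blast
  next
    case False
    then have U: "|UNIV :: 'a set set| \<le>o natLeq"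
      using ordLeq_total[OF natLeq_Well_order card_of_Well_order] by blast
    have "cs_star_character X \<le>o |Field (cs_star_character X)|"
      using cs_star_character(1)[of X] card_of_Field_ordIso ordIso_symmetric ordIso_iff_ordLeq
      unfolding cs_star_character_bound_def by blast
    also have "|Field (cs_star_character X)| \<le>o |UNIV :: 'a set set|"
      by (rule card_of_mono1) simp
    finally (ordLeq_transitive) show ?thesis
      unfolding countable_cs_star_character_def using U ordLeq_transitive by blast
  qed
qed

subsection \<open>Stratifiable spaces, \<open>\<aleph>\<close>-spaces and \<open>k\<^sub>\<omega>\<close>-spaces\<close>

definition stratifiable_space :: "'a topology \<Rightarrow> bool" where
  "stratifiable_space X \<longleftrightarrow>
     Hausdorff_space X \<and> regular_space X \<and>
     (\<exists>G :: nat \<Rightarrow> 'a set \<Rightarrow> 'a set.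
        (\<forall>n F. closedin X F \<longrightarrow> openin X (G n F) \<and> F \<subseteq> G n F) \<and>
        (\<forall>F. closedin X F \<longrightarrow> F = (\<Inter>n. X closure_of G n F)) \<and>
        (\<forall>n F K. closedin X F \<and> closedin X K \<and> F \<subseteq> K \<longrightarrow> G n F \<subseteq> G n K))"

definition k_network :: "'a topology \<Rightarrow> 'a set set \<Rightarrow> bool" where
  "k_network X \<N> \<longleftrightarrow>
     \<N> \<subseteq> Pow (topspace X) \<and>
     (\<forall>U K. openin X U \<and> compactin X K \<and> K \<subseteq> U
        \<longrightarrow> (\<exists>\<F>. finite \<F> \<and> \<F> \<subseteq> \<N> \<and> K \<subseteq> \<Union>\<F> \<and> \<Union>\<F> \<subseteq> U))"

definition sigma_locally_finite_in :: "'a topology \<Rightarrow> 'a set set \<Rightarrow> bool" where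
  "sigma_locally_finite_in X \<N> \<longleftrightarrow>
     (\<exists>\<A> :: nat \<Rightarrow> 'a set set. (\<forall>n. locally_finite_in X (\<A> n)) \<and> \<N> = (\<Union>n. \<A> n))"

definition aleph_space :: "'a topology \<Rightarrow> bool" where
  "aleph_space X \<longleftrightarrow>
     Hausdorff_space X \<and> regular_space X \<and>
     (\<exists>\<N>. k_network X \<N> \<and> sigma_locally_finite_in X \<N>)"

text \<open>
  The last conjunct says that \<open>X\<close> carries the strongest of all topologies on \<open>topspace X\<close> that
  induce the original topology on each member of \<open>\<C>\<close>. The collection is not required to cover
  \<open>X\<close>; points outside \<open>\<Union>\<C>\<close> are then isolated.
\<close>
definition k_omega_space :: "'a topology \<Rightarrow> bool" where
  "k_omega_space X \<longleftrightarrow>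
     Hausdorff_space X \<and>
     (\<exists>\<C>. countable \<C> \<and> (\<forall>C\<in>\<C>. compactin X C) \<and>
        (\<forall>Y. topspace Y = topspace X \<and> (\<forall>C\<in>\<C>. subtopology Y C = subtopology X C)
           \<longrightarrow> (\<forall>U. openin Y U \<longrightarrow> openin X U)))"

subsection \<open>Subgroups\<close>

text \<open>Groups are written additively, as in the class \<open>group_add\<close>, but need not be commutative.\<close>
definition add_subgroup :: "'g::group_add set \<Rightarrow> bool" where
  "add_subgroup H \<longleftrightarrow>
     0 \<in> H \<and> (\<forall>x\<in>H. \<forall>y\<in>H. x + y \<in> H) \<and> (\<forall>x\<in>H. - x \<in> H)"

definition k_omega_subgroup :: "'g::topological_group_add set \<Rightarrow> bool" where
  "k_omega_subgroup H \<longleftrightarrow> add_subgroup H \<and> k_omega_space (subtopology euclidean H)"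

end

theory Submission
  imports Defs
begin

text \<open>
  Let \<open>f : M \<rightarrow> G\<close> be a subproper map witnessing \<open>k\<^sup>*\<close>-metrizability, with \<open>M\<close> metric and the
  distinguished set \<open>Z\<close> dense in \<open>M\<close>; convergent sequences of \<open>G\<close> then lift, up to passing to
  subsequences, to convergent sequences of \<open>M\<close>. If \<open>G\<close> is not first countable at \<open>0\<close>, it contains
  a sequential fan: columns \<open>y n k \<rightarrow> 0\<close> (as \<open>k \<rightarrow> \<infinity>\<close>) such that no sequence running through
  infinitely many columns converges. If \<open>M\<close> is not locally compact at some point, \<open>G\<close> contains a
  metric fan: columns \<open>x n k\<close> that are closed and discrete but shrink to \<open>0\<close> as \<open>n \<rightarrow> \<infinity>\<close>. The two
  exclude each other, since the sums \<open>x n k + y n k\<close> form a sequentially closed set accumulating at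
  \<open>0\<close>. Hence either \<open>G\<close> is first countable, and so metrizable by Birkhoff--Kakutani, or \<open>M\<close> is
  locally compact. In the latter case a similar argument over \<open>\<omega>\<^sub>1\<close> shows that the fibre over \<open>0\<close>
  is separable, so countably many compact sets \<open>f(B)\<close> catch a subsequence of every sequence
  converging to \<open>0\<close>; they generate an open \<open>k\<^sub>\<omega>\<close>-subgroup.
\<close>

section \<open>Topological groups and the Birkhoff--Kakutani construction\<close>

text \<open>The passage from failure of first countability to a sequential fan runs through the
  fibre \<open>F\<close> of \<open>f\<close> over 0: a sequence in \<open>F\<close> without
  convergent subsequence yields a fan, while a compact \<open>F\<close> leads to a countable base at
  0 or again to a fan. Local compactness of \<open>M\<close> provides compact sets around every
  point of \<open>F\<close>, possibly uncountably many; separability of \<open>F\<close> cuts them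
  down to countably many. The obstacle in the non-metrizable case is stratifiability, as no metric
  induces the topology. A countable k-network on the open subgroup makes 0 an intersection of
  countably many open sets, and the Birkhoff--Kakutani construction then still gives a
  left-invariant metric with open balls, possibly coarser than the topology. On compact sets it
  cannot be coarser, and the topology is determined by translates of compact sets. The locale
  \<open>metric_filtration\<close> isolates exactly this situation; a metrizable group fits into it
  with a constant filtration. The \<open>\<aleph>\<close>-property is easier: the group is the
  topological sum of the cosets of the open subgroup.\<close>

lemma open_translation_group:
  fixes U :: "'g::topological_group_add set"
  assumes "open U"
  shows "open ((+) a ` U)"
proof -
  have "(+) a ` U = (\<lambda>x. - a + x) -` U"
  proof (intro set_eqI iffI)
    fix x assume "x \<in> (\<lambda>x. - a + x) -` U"
    then have "x = a + (- a + x)" "- a + x \<in> U"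
      by (simp_all add: add.assoc[symmetric])
    then show "x \<in> (+) a ` U" by blast
  qed (auto simp: add.assoc[symmetric])
  moreover have "open ((\<lambda>x. - a + x) -` U)"
    by (intro open_vimage assms continuous_intros)
  ultimately show ?thesis by simp
qed

lemma zero_nbhd_add:
  fixes U :: "'g::topological_group_add set"
  assumes "open U" "0 \<in> U"
  obtains V where "open V" "0 \<in> V" "\<And>x. x \<in> V \<Longrightarrow> - x \<in> V" "\<And>x y. x \<in> V \<Longrightarrow> y \<in> V \<Longrightarrow> x + y \<in> U"
proof -
  have "open ((\<lambda>p::'g\<times>'g. fst p + snd p) -` U)"
    by (intro open_vimage assms continuous_intros)
  moreover have "(0, 0) \<in> (\<lambda>p::'g\<times>'g. fst p + snd p) -` U" using assms by simp
  ultimately obtain A B where AB: "open A" "open B" "(0, 0) \<in> A \<times> B"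
      "A \<times> B \<subseteq> (\<lambda>p. fst p + snd p) -` U"
    by (rule open_prod_elim)
  define V where "V = (A \<inter> B) \<inter> uminus -` (A \<inter> B)"
  show ?thesis
  proof (rule that[of V])
    have "open (uminus -` (A \<inter> B))"
      by (intro open_vimage continuous_intros open_Int AB)
    then show "open V" unfolding V_def using AB by blast
    show "x + y \<in> U" if "x \<in> V" "y \<in> V" for x y
      using AB(4) that unfolding V_def by force
  qed (use AB in \<open>auto simp: V_def\<close>)
qed

lemma zero_nbhd_add3:
  fixes U :: "'g::topological_group_add set"
  assumes "open U" "0 \<in> U"
  obtains V where "open V" "0 \<in> V" "\<And>x. x \<in> V \<Longrightarrow> - x \<in> V" "V \<subseteq> U"
    "\<And>x y z. x \<in> V \<Longrightarrow> y \<in> V \<Longrightarrow> z \<in> V \<Longrightarrow> x + y + z \<in> U"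
proof -
  obtain A where A: "open A" "0 \<in> A" "\<And>x y. x \<in> A \<Longrightarrow> y \<in> A \<Longrightarrow> x + y \<in> U"
    using zero_nbhd_add[OF assms] by metis
  obtain V where V: "open V" "0 \<in> V" "\<And>x. x \<in> V \<Longrightarrow> - x \<in> V" "\<And>x y. x \<in> V \<Longrightarrow> y \<in> V \<Longrightarrow> x + y \<in> A"
    using zero_nbhd_add[OF A(1,2)] by metis
  have VA: "V \<subseteq> A" using V(2,4) by force
  show ?thesis
  proof (rule that[OF V(1-3)])
    show "V \<subseteq> U" using A(2,3) VA by force
    show "x + y + z \<in> U" if "x \<in> V" "y \<in> V" "z \<in> V" for x y z
      using A(3) V(4) VA that by blast
  qed
qed

text \<open>If \<open>y\<close> is in the closure of \<open>x + V\<close>, then \<open>y + V\<close>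
  meets \<open>x + V\<close>, so that \<open>- x + y\<close> is a difference of two elements of
  \<open>V\<close>.\<close>

lemma regular_space_group:
  "regular_space (euclidean :: 'g::topological_group_add topology)"
  unfolding neighbourhood_base_of_closedin[symmetric] neighbourhood_base_of_def neighbourhood_base_at_def
proof (intro ballI allI impI)
  fix W :: "'g set" and x assume "openin euclidean W \<and> x \<in> W"
  then have W: "open W" "x \<in> W" by auto
  then have "open ((+) (- x) ` W)" "0 \<in> (+) (- x) ` W"
    using open_translation_group by (auto simp: image_iff intro: bexI[of _ x])
  then obtain V where V: "open V" "0 \<in> V" "\<And>x. x \<in> V \<Longrightarrow> - x \<in> V"
      "\<And>a b. a \<in> V \<Longrightarrow> b \<in> V \<Longrightarrow> a + b \<in> (+) (- x) ` W"
    using zero_nbhd_add by metis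
  let ?V = "(+) x ` V"
  have "closure ?V \<subseteq> W"
  proof
    fix y assume y: "y \<in> closure ?V"
    have "open ((+) y ` V)" "y \<in> (+) y ` V" using open_translation_group V by force+
    then have "?V \<inter> (+) y ` V \<noteq> {}"
      using y unfolding closure_iff_nhds_not_empty by (metis order_refl)
    then obtain a b where ab: "a \<in> V" "b \<in> V" "y + a = x + b"
      by (fastforce simp: image_iff)
    have "- x + y = - x + (y + a) + - a" by (simp only: add.assoc add.right_inverse add.right_neutral)
    also have "\<dots> = b + - a" unfolding ab(3) by (simp add: add.assoc[symmetric])
    finally have "- x + y = b + - a" .
    then have "- x + y \<in> (+) (- x) ` W" using V(3,4) ab by metis
    then show "y \<in> W" by auto
  qed
  moreover have "open ?V" "x \<in> ?V" using open_translation_group V by force+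
  ultimately show "\<exists>U V. openin euclidean U \<and> closedin euclidean V \<and> x \<in> U \<and> U \<subseteq> V \<and> V \<subseteq> W"
    using closure_subset[of ?V]
    by (metis closed_closedin closed_closure open_openin)
qed

text \<open>\<open>x\<close> is the entry at which the partial sums reach \<open>T\<close>, or else
  the last one. With \<open>T\<close> half of a bound for the total weight, prefix and suffix each
  weigh at most half; only the single entry \<open>x\<close> may be heavy.\<close>

lemma split_list_sum:
  fixes w :: "'a \<Rightarrow> real"
  assumes "xs \<noteq> []" "\<And>x. w x \<ge> 0" "T \<ge> 0"
  shows "\<exists>ys x zs. xs = ys @ x # zs \<and> sum_list (map w ys) \<le> T \<and>
    (zs = [] \<or> sum_list (map w ys) + w x \<ge> T)"
  using assms
proof (induction xs arbitrary: T)
  case (Cons a xs)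
  show ?case
  proof (cases "xs = [] \<or> w a \<ge> T")
    case True
    then show ?thesis using Cons by (intro exI[of _ "[]"] exI[of _ a] exI[of _ xs]) auto
  next
    case False
    then obtain ys x zs where "xs = ys @ x # zs" "sum_list (map w ys) \<le> T - w a"
       "zs = [] \<or> sum_list (map w ys) + w x \<ge> T - w a"
      using Cons.IH[of "T - w a"] Cons.prems by auto
    then show ?thesis by (intro exI[of _ "a # ys"] exI[of _ x] exI[of _ zs]) auto
  qed
qed auto

text \<open>Frink's chain lemma. Splitting at half of the weight halves the bound for both outer
  parts, which pays for the factor 2 that \<open>three\<close> costs when the parts are put
  together; hence the constant does not grow with the length of the list.\<close>

lemma frink_chain:
  fixes w :: "'g::monoid_add \<Rightarrow> real"
  assumes nonneg: "\<And>x. w x \<ge> 0" and zero: "w 0 = 0"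
    and three: "\<And>t a b c. t > 0 \<Longrightarrow> w a \<le> t \<Longrightarrow> w b \<le> t \<Longrightarrow> w c \<le> t \<Longrightarrow> w (a + b + c) \<le> 2 * t"
    and "S > 0" "sum_list (map w xs) \<le> S"
  shows "w (sum_list xs) \<le> 2 * S"
  using assms(4,5)
proof (induction xs arbitrary: S rule: length_induct)
  case (1 xs)
  show ?case
  proof (cases "xs = []")
    case True
    then show ?thesis using 1 zero by simp
  next
    case False
    obtain ys x zs where xs: "xs = ys @ x # zs" and ys: "sum_list (map w ys) \<le> S / 2"
        and zs: "zs = [] \<or> sum_list (map w ys) + w x \<ge> S / 2"
      using split_list_sum[OF False, of w "S / 2"] nonneg 1(2) by auto
    have pos: "sum_list (map w us) \<ge> 0" for us
      by (intro sum_list_nonneg) (use nonneg in auto)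
    have le: "sum_list (map w ys) + w x + sum_list (map w zs) \<le> S"
      using 1(3) xs by (simp add: add.assoc)
    then have "sum_list (map w zs) \<le> S / 2" using zs 1(2) by auto
    then have "w (sum_list zs) \<le> 2 * (S / 2)" "w (sum_list ys) \<le> 2 * (S / 2)"
      using 1(1)[rule_format, of zs "S / 2"] 1(1)[rule_format, of ys "S / 2"] xs ys 1(2) by simp_all
    moreover have "w x \<le> S" using le pos[of ys] pos[of zs] by simp
    ultimately show ?thesis using three[of S "sum_list ys" x "sum_list zs"] 1(2) xs
      by (simp add: add.assoc)
  qed
qed

text \<open>\<open>w\<close> measures depth in a sequence of neighbourhoods with
  \<open>W (Suc n)\<close> tripled inside \<open>W n\<close>, and \<open>N\<close> makes it
  subadditive by an infimum over all decompositions. Frink's lemma bounds \<open>w\<close> by a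
  multiple of \<open>N\<close>, so the infimum does not collapse. \<open>N\<close> may vanish
  outside 0; separation of points is added later.\<close>

lemma group_norm_exists:
  fixes U :: "nat \<Rightarrow> 'g::topological_group_add set"
  assumes U: "\<And>n. open (U n)" "\<And>n. 0 \<in> U n"
  shows "\<exists>N :: 'g \<Rightarrow> real. N 0 = 0 \<and> (\<forall>x. N x \<ge> 0) \<and> (\<forall>x. N (- x) = N x) \<and>
    (\<forall>x y. N (x + y) \<le> N x + N y) \<and>
    (\<forall>e>0. \<exists>V. open V \<and> 0 \<in> V \<and> (\<forall>x\<in>V. N x < e)) \<and>
    (\<forall>n. \<exists>e>0. \<forall>x. N x < e \<longrightarrow> x \<in> U n)"
proof -
  \<comment> \<open>\<open>W 0\<close> is the whole group, so that every point has a weight, and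
    this is at most 1. The inclusion in \<open>U n\<close> is required of \<open>W (Suc n)\<close>,
    which matches the shift in \<open>wless\<close>.\<close>
  have "\<exists>W. \<forall>n. (open (W n) \<and> 0 \<in> W n \<and> (\<forall>x\<in>W n. - x \<in> W n) \<and> (n = 0 \<longrightarrow> W n = UNIV)) \<and>
     (W (Suc n) \<subseteq> U n \<and> W (Suc n) \<subseteq> W n \<and>
      (\<forall>x\<in>W (Suc n). \<forall>y\<in>W (Suc n). \<forall>z\<in>W (Suc n). x + y + z \<in> W n))"
  proof (rule dependent_nat_choice, goal_cases)
    case (2 V n)
    then have "open (V \<inter> U n)" "0 \<in> V \<inter> U n" using U by auto
    then obtain W where "open W" "0 \<in> W" "\<And>x. x \<in> W \<Longrightarrow> - x \<in> W" "W \<subseteq> V \<inter> U n"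
      "\<And>x y z. x \<in> W \<Longrightarrow> y \<in> W \<Longrightarrow> z \<in> W \<Longrightarrow> x + y + z \<in> V \<inter> U n"
      using zero_nbhd_add3 by metis
    then show ?case by (intro exI[of _ W]) auto
  qed auto
  then obtain W where W: "\<And>n. open (W n)" "\<And>n. 0 \<in> W n" "\<And>n x. x \<in> W n \<Longrightarrow> - x \<in> W n"
      "W 0 = UNIV" "\<And>n. W (Suc n) \<subseteq> U n" "\<And>n. W (Suc n) \<subseteq> W n"
      "\<And>n x y z. x \<in> W (Suc n) \<Longrightarrow> y \<in> W (Suc n) \<Longrightarrow> z \<in> W (Suc n) \<Longrightarrow> x + y + z \<in> W n"
    by metis
  have anti: "W n \<subseteq> W m" if "m \<le> n" for m n
    using lift_Suc_antimono_le[of W, OF W(6) that] by auto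
  define w where "w x = Inf {(1/2::real) ^ n | n. x \<in> W n}" for x
  have bdd: "bdd_below {(1/2::real) ^ n | n. x \<in> W n}" for x
    by (rule bdd_belowI[of _ 0]) auto
  have ne: "{(1/2::real) ^ n | n. x \<in> W n} \<noteq> {}" for x
    using W(4) by auto
  have w0: "w x \<ge> 0" for x
    unfolding w_def by (rule cInf_greatest[OF ne]) auto
  have wle: "w x \<le> (1/2) ^ n" if "x \<in> W n" for x n
    unfolding w_def by (rule cInf_lower[OF _ bdd]) (use that in auto)
  have wless: "x \<in> W (Suc n)" if less: "w x < (1/2) ^ n" for x n
  proof -
    obtain m where m: "x \<in> W m" "(1/2::real) ^ m < (1/2) ^ n"
      using cInf_lessD[OF ne less[unfolded w_def]] by auto
    then have "m > n" by (simp add: power_strict_decreasing_iff)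
    then show ?thesis using anti[of "Suc n" m] m by auto
  qed
  have wuminus: "w (- x) = w x" for x
    using W(3) minus_minus unfolding w_def by metis
  have wzero: "w 0 = 0"
  proof (rule ccontr)
    assume "w 0 \<noteq> 0"
    then have "w 0 > 0" using w0[of 0] by simp
    then obtain n where "(1/2::real) ^ n < w 0" using real_arch_pow_inv[of "w 0" "1/2"] by auto
    then show False using wle[OF W(2), of n] by simp
  qed
  have three: "w (a + b + c) \<le> 2 * t" if t: "t > 0" and abc: "w a \<le> t" "w b \<le> t" "w c \<le> t" for a b c t
  proof (cases "t \<ge> 1/2")
    case True
    have "w (a + b + c) \<le> (1/2) ^ 0" using W(4) by (intro wle) auto
    then show ?thesis using True by simp
  next
    case False
    obtain m where "(1/2::real) ^ m < t"
      using real_arch_pow_inv[OF t, of "1/2"] by auto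
    then have ex: "\<exists>m. (1/2::real) ^ m \<le> t" by (blast intro: less_imp_le)
    \<comment> \<open>By minimality \<open>t < (1/2) ^ (n - 1)\<close>, so weights up to
      \<open>t\<close> force the three points into \<open>W n\<close> and their sum into
      \<open>W (n - 1)\<close>, whose weights are at most
      \<open>2 * (1/2) ^ n \<le> 2 * t\<close>.\<close>
    define n where "n = (LEAST m. (1/2::real) ^ m \<le> t)"
    have n: "(1/2::real) ^ n \<le> t" unfolding n_def by (rule LeastI_ex[OF ex])
    have "n \<noteq> 0" "n \<noteq> 1" using False n by (auto intro!: gr0I)
    then obtain k where k: "n = Suc (Suc k)" using not0_implies_Suc[of n] not0_implies_Suc[of "n - 1"] by auto
    have "t < (1/2::real) ^ Suc k" using not_less_Least[of "Suc k" "\<lambda>m. (1/2::real) ^ m \<le> t"]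
      k unfolding n_def by simp
    then have "a \<in> W n" "b \<in> W n" "c \<in> W n" using abc wless[of _ "Suc k"] k by auto
    then have "a + b + c \<in> W (Suc k)" using W(7) k by auto
    then have "w (a + b + c) \<le> (1/2) ^ Suc k" by (rule wle)
    also have "\<dots> = 2 * (1/2) ^ n" using k by simp
    finally show ?thesis using n by simp
  qed
  define N where "N x = Inf {sum_list (map w xs) | xs. sum_list xs = x}" for x
  have pos: "sum_list (map w us) \<ge> 0" for us
    by (intro sum_list_nonneg) (use w0 in auto)
  have bddN: "bdd_below {sum_list (map w xs) | xs. sum_list xs = x}" for x
    by (rule bdd_belowI[of _ 0]) (use pos in auto)
  have neN: "{sum_list (map w xs) | xs. sum_list xs = x} \<noteq> {}" for x
    by (auto intro: exI[of _ "[x]"])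
  have Nle: "N (sum_list xs) \<le> sum_list (map w xs)" for xs
    unfolding N_def by (rule cInf_lower[OF _ bddN]) auto
  have N0: "N x \<ge> 0" for x
    unfolding N_def by (rule cInf_greatest[OF neN]) (use pos in auto)
  have Nw: "N x \<le> w x" for x using Nle[of "[x]"] by simp
  have Nex: "\<exists>xs. sum_list xs = x \<and> sum_list (map w xs) < t" if "N x < t" for x t
    using cInf_lessD[OF neN that[unfolded N_def]] by auto
  have Numinus_le: "N (- x) \<le> N x" for x
  proof (rule field_le_epsilon)
    fix e :: real assume "e > 0"
    then obtain xs where xs: "sum_list xs = x" "sum_list (map w xs) < N x + e" using Nex[of x "N x + e"] by auto
    have "sum_list (map uminus (rev xs)) = - sum_list xs"
      by (induction xs) (simp_all add: minus_add)
    moreover have "sum_list (map w (map uminus (rev xs))) = sum_list (map w xs)"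
      by (induction xs) (simp_all add: wuminus)
    ultimately show "N (- x) \<le> N x + e" using Nle[of "map uminus (rev xs)"] xs by simp
  qed
  have Nadd: "N (x + y) \<le> N x + N y" for x y
  proof (rule field_le_epsilon)
    fix e :: real assume "e > 0"
    then obtain xs ys where xs: "sum_list xs = x" "sum_list (map w xs) < N x + e/2"
       "sum_list ys = y" "sum_list (map w ys) < N y + e/2"
      using Nex[of x "N x + e/2"] Nex[of y "N y + e/2"] by auto
    then show "N (x + y) \<le> N x + N y + e" using Nle[of "xs @ ys"] by simp
  qed
  have wN: "w x \<le> 2 * t" if "N x < t" for x t
  proof -
    have "t > 0" using N0[of x] that by simp
    then show ?thesis using Nex[OF that] frink_chain[of w t, OF w0 wzero three] by fastforce
  qed
  show ?thesis
  proof (intro exI[of _ N] conjI allI impI)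
    show "N 0 = 0" using Nw[of 0] N0[of 0] wzero by simp
    show "N (- x) = N x" for x using Numinus_le[of x] Numinus_le[of "- x"] by simp
    show "\<exists>V. open V \<and> 0 \<in> V \<and> (\<forall>x\<in>V. N x < e)" if e: "e > 0" for e
    proof -
      obtain n where n: "(1/2::real) ^ n < e" using real_arch_pow_inv[of e "1/2"] e by auto
      then show ?thesis using W(1,2) Nw wle[of _ n]
        by (intro exI[of _ "W n"]) (meson order.strict_trans1)
    qed
    show "\<exists>e>0. \<forall>x. N x < e \<longrightarrow> x \<in> U n" for n
    \<comment> \<open>The factor 2 of Frink's lemma leaves \<open>w x \<le> (1/2) ^ n / 2\<close>,
      strictly below the threshold that \<open>wless\<close> asks for.\<close>
    proof (rule exI[of _ "(1/2)^n / 4"], intro conjI allI impI)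
      fix x assume "N x < (1/2)^n / 4"
      then have "w x \<le> 2 * ((1/2)^n / 4)" by (rule wN)
      also have "\<dots> < (1/2) ^ n" by simp
      finally show "x \<in> U n" using wless W(5) by blast
    qed simp
  qed (use N0 Nadd in auto)
qed

text \<open>The metric is \<open>N (- x + y)\<close>; it is only left invariant because
  \<open>N\<close> need not be invariant under conjugation. Its topology may be strictly coarser
  than the given one, since the \<open>U n\<close> only have to meet in 0. The last clause recovers
  from the metric as much of the topology as the \<open>U n\<close> contain.\<close>

lemma group_metric_exists:
  fixes U :: "nat \<Rightarrow> 'g::topological_group_add set"
  assumes U: "\<And>n. open (U n)" "\<And>n. 0 \<in> U n" "(\<Inter>n. U n) = {0}"
  shows "\<exists>\<rho> :: 'g \<Rightarrow> 'g \<Rightarrow> real. Metric_space UNIV \<rho> \<and>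
    (\<forall>a x y. \<rho> (a + x) (a + y) = \<rho> x y) \<and> (\<forall>x e. open {y. \<rho> x y < e}) \<and>
    (\<forall>n. \<exists>e>0. \<forall>x y. \<rho> x y < e \<longrightarrow> - x + y \<in> U n)"
proof -
  obtain N :: "'g \<Rightarrow> real" where N': "N 0 = 0" "\<forall>x. N x \<ge> 0" "\<forall>x. N (- x) = N x"
    "\<forall>x y. N (x + y) \<le> N x + N y"
    "\<forall>e>0. \<exists>V. open V \<and> 0 \<in> V \<and> (\<forall>x\<in>V. N x < e)"
    "\<forall>n. \<exists>e>0. \<forall>x. N x < e \<longrightarrow> x \<in> U n"
    using group_norm_exists[of U, OF U(1,2)] by (elim exE conjE)
  note N = N'(1) N'(2-)[rule_format]
  define \<rho> where "\<rho> x y = N (- x + y)" for x y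
  have zero: "x = 0" if "N x = 0" for x
  proof -
    have "x \<in> U n" for n using N(6)[of n] that by auto
    then show ?thesis using U(3) by auto
  qed
  have sym: "\<rho> x y = \<rho> y x" for x y
    using N(3)[of "- x + y"] by (simp add: \<rho>_def minus_add)
  have tri: "\<rho> x z \<le> \<rho> x y + \<rho> y z" for x y z
    using N(4)[of "- x + y" "- y + z"] by (simp add: \<rho>_def add.assoc)
  show ?thesis
  proof (intro exI[of _ \<rho>] conjI allI)
    show "Metric_space UNIV \<rho>"
    proof
      show "\<rho> x y = 0 \<longleftrightarrow> x = y" for x y
        using zero[of "- x + y"] N(1) by (auto simp: \<rho>_def add_eq_0_iff)
    qed (rule tri sym | simp add: \<rho>_def N(2))+
    show "\<rho> (a + x) (a + y) = \<rho> x y" for a x y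
      by (simp only: \<rho>_def minus_add add.assoc minus_add_cancel)
    show "open {y. \<rho> x y < e}" for x e
    proof (rule topological_space_class.openI)
      fix y assume "y \<in> {y. \<rho> x y < e}"
      then have "e - \<rho> x y > 0" by simp
      then obtain V where V: "open V" "0 \<in> V" "\<forall>v\<in>V. N v < e - \<rho> x y" using N(5) by blast
      have "(+) y ` V \<subseteq> {y. \<rho> x y < e}"
      proof clarify
        fix v assume "v \<in> V"
        then have "\<rho> y (y + v) < e - \<rho> x y" using V by (simp add: \<rho>_def add.assoc[symmetric])
        then show "\<rho> x (y + v) < e" using tri[of x "y + v" y] by simp
      qed
      then show "\<exists>T. open T \<and> y \<in> T \<and> T \<subseteq> {y. \<rho> x y < e}"
        using open_translation_group[OF V(1)] V(2) by (intro exI[of _ "(+) y ` V"]) force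
    qed
    show "\<exists>e>0. \<forall>x y. \<rho> x y < e \<longrightarrow> - x + y \<in> U n" for n
      using N(6)[of n] by (auto simp: \<rho>_def)
  qed
qed

text \<open>Birkhoff--Kakutani: if the \<open>U n\<close> form a base at 0, the last clause of
  \<open>group_metric_exists\<close> makes the metric topology as fine as the given one, and
  openness of the balls makes it as coarse.\<close>

lemma first_countable_group_metric:
  fixes U :: "nat \<Rightarrow> 'g::{topological_group_add, t2_space} set"
  assumes U: "\<And>n. open (U n)" "\<And>n. 0 \<in> U n"
    and base: "\<And>V. open V \<Longrightarrow> 0 \<in> V \<Longrightarrow> \<exists>n. U n \<subseteq> V"
  shows "\<exists>\<rho> :: 'g \<Rightarrow> 'g \<Rightarrow> real. Metric_space UNIV \<rho> \<and>
    (\<forall>S. open S \<longleftrightarrow> (\<forall>x\<in>S. \<exists>e>0. \<forall>y. \<rho> x y < e \<longrightarrow> y \<in> S))"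
proof -
  have Int: "(\<Inter>n. U n) = {0}"
  proof -
    have "x = 0" if x: "\<forall>n. x \<in> U n" for x
    proof (rule ccontr)
      assume "x \<noteq> 0"
      then obtain n where "U n \<subseteq> - {x}" using base[of "- {x}"] by auto
      then show False using x by auto
    qed
    then show ?thesis using U(2) by auto
  qed
  obtain \<rho> :: "'g \<Rightarrow> 'g \<Rightarrow> real" where \<rho>: "Metric_space UNIV \<rho>"
    "\<forall>a x y. \<rho> (a + x) (a + y) = \<rho> x y"
    "\<forall>x e. open {y. \<rho> x y < e}" "\<forall>n. \<exists>e>0. \<forall>x y. \<rho> x y < e \<longrightarrow> - x + y \<in> U n"
    using group_metric_exists[of U, OF U Int] by (elim exE conjE)
  interpret Metric_space UNIV \<rho> by fact
  show ?thesis
  proof (intro exI[of _ \<rho>] conjI allI \<rho>(1))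
    fix S :: "'g set"
    show "open S \<longleftrightarrow> (\<forall>x\<in>S. \<exists>e>0. \<forall>y. \<rho> x y < e \<longrightarrow> y \<in> S)"
    proof
      assume S: "open S"
      show "\<forall>x\<in>S. \<exists>e>0. \<forall>y. \<rho> x y < e \<longrightarrow> y \<in> S"
      proof
        fix x assume x: "x \<in> S"
        then have "open ((+) (- x) ` S)" "0 \<in> (+) (- x) ` S"
          using open_translation_group[OF S] by (blast, metis image_eqI left_minus)
        then obtain n where n: "U n \<subseteq> (+) (- x) ` S" using base by blast
        obtain e where "e > 0" "\<forall>x y. \<rho> x y < e \<longrightarrow> - x + y \<in> U n" using \<rho>(4) by blast
        then show "\<exists>e>0. \<forall>y. \<rho> x y < e \<longrightarrow> y \<in> S"
          using n by (intro exI[of _ e]) force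
      qed
    next
      assume R: "\<forall>x\<in>S. \<exists>e>0. \<forall>y. \<rho> x y < e \<longrightarrow> y \<in> S"
      show "open S"
      proof (rule topological_space_class.openI)
        fix x assume "x \<in> S"
        then obtain e where "e > 0" "\<forall>y. \<rho> x y < e \<longrightarrow> y \<in> S" using R by blast
        then show "\<exists>T. open T \<and> x \<in> T \<and> T \<subseteq> S"
          using \<rho>(3) by (intro exI[of _ "{y. \<rho> x y < e}"]) auto
      qed
    qed
  qed
qed

section \<open>Stratifications from a metric that is correct on each level of a filtration\<close>

text \<open>\<open>open_ball\<close> and \<open>open_if\<close> together say that
  \<open>\<rho>\<close> induces the right topology on each \<open>K n\<close> and that these traces
  determine the topology of the whole space, although \<open>\<rho>\<close> may be too coarse
  globally.\<close>

locale metric_filtration = Metric_space UNIV \<rho>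
    for \<rho> :: "'a::topological_space \<Rightarrow> 'a \<Rightarrow> real" +
  fixes K :: "nat \<Rightarrow> 'a set"
  assumes K_mono: "\<And>n. K n \<subseteq> K (Suc n)" and K_cover: "(\<Union>n. K n) = UNIV" and K_closed: "\<And>n. closed (K n)"
    and open_if: "\<And>S. (\<And>n x. x \<in> S \<inter> K n \<Longrightarrow> \<exists>e>0. \<forall>y\<in>K n. \<rho> x y < e \<longrightarrow> y \<in> S) \<Longrightarrow> open S"
    and open_ball: "\<And>U n x. open U \<Longrightarrow> x \<in> U \<Longrightarrow> x \<in> K n \<Longrightarrow> \<exists>e>0. \<forall>y\<in>K n. \<rho> x y < e \<longrightarrow> y \<in> U"
begin

text \<open>The points of \<open>K n\<close> whose distance to \<open>P\<close> is strictly smaller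
  than their distance to \<open>Q\<close>, written without infima so that empty sets need no
  convention. The uniform gap \<open>e\<close> makes the set relatively open.\<close>

definition near :: "nat \<Rightarrow> 'a set \<Rightarrow> 'a set \<Rightarrow> 'a set" where
  "near n P Q = {x \<in> K n. \<exists>a\<in>P. \<exists>e>0. \<forall>b\<in>Q. \<rho> x a + e \<le> \<rho> x b}"

text \<open>The index \<open>k\<close> of the stratification enters the construction only through
  this threshold.\<close>

definition away :: "nat \<Rightarrow> nat \<Rightarrow> 'a set \<Rightarrow> 'a set" where
  "away k n F = {x \<in> K n. \<forall>y\<in>F \<inter> K n. \<rho> x y \<ge> 1 / Suc k}"

text \<open>Disjoint relatively open approximations, on each level of the filtration, of \<open>F\<close> and of its complement.\<close>

primrec sep :: "nat \<Rightarrow> 'a set \<Rightarrow> nat \<Rightarrow> 'a set \<times> 'a set" where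
  "sep k F 0 = ({}, {})"
| "sep k F (Suc n) = (near n (fst (sep k F n) \<union> F \<inter> K n) (snd (sep k F n) \<union> away k n F),
                      near n (snd (sep k F n) \<union> away k n F) (fst (sep k F n) \<union> F \<inter> K n))"

abbreviation "near_part k F n \<equiv> fst (sep k F n)"
abbreviation "far_part k F n \<equiv> snd (sep k F n)"

lemma near_mono: "P \<subseteq> P' \<Longrightarrow> Q' \<subseteq> Q \<Longrightarrow> near n P Q \<subseteq> near n P' Q'"
  unfolding near_def by blast

lemma near_nbhd:
  assumes "x \<in> near n P Q"
  shows "\<exists>e>0. \<forall>y\<in>K n. \<rho> x y < e \<longrightarrow> y \<in> near n P Q"
proof -
  obtain a e where a: "a \<in> P" "e > 0" "\<And>b. b \<in> Q \<Longrightarrow> \<rho> x a + e \<le> \<rho> x b"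
    using assms unfolding near_def by blast
  \<comment> \<open>A move by less than \<open>e / 4\<close> changes each of the two distances by
    less than \<open>e / 4\<close>, so a gap of \<open>e / 2\<close> survives.\<close>
  have "y \<in> near n P Q" if y: "y \<in> K n" "\<rho> x y < e / 4" for y
  proof -
    have "\<rho> y a + e / 2 \<le> \<rho> y b" if b: "b \<in> Q" for b
      using a(3)[OF b] y triangle[of y x a] triangle[of x y b] commute[of x y] by simp
    then show ?thesis unfolding near_def using y a(1,2) by (auto intro!: bexI[of _ a] exI[of _ "e / 2"])
  qed
  then show ?thesis using a(2) by (intro exI[of _ "e / 4"]) auto
qed

lemma near_disjoint: "near n P Q \<inter> near n Q P = {}"
  unfolding near_def by fastforce

lemma near_subset: "near n P Q \<subseteq> K n"
  unfolding near_def by blast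

lemma positive_distance:
  assumes "closed F" "x \<notin> F" "x \<in> K n"
  shows "\<exists>e>0. \<forall>y\<in>F \<inter> K n. \<rho> x y \<ge> e"
  using open_ball[of "- F" x n] assms by (force simp: not_less[symmetric] open_Compl)

text \<open>The induction carries exactly what lets both parts grow. Separation is pointwise in each
  direction, not uniform. The strict bound \<open>1 / Suc k\<close> keeps the near part at a
  positive distance from \<open>away\<close>, and the last clause lets the new points of
  \<open>F\<close> join the near part at the next step.\<close>

lemma sep_invariant:
  assumes F: "closed F"
  shows "near_part k F n \<subseteq> K n \<and> far_part k F n \<subseteq> K n \<and>
    (\<forall>x\<in>near_part k F n. \<exists>e>0. \<forall>b\<in>far_part k F n. \<rho> x b \<ge> e) \<and>
    (\<forall>x\<in>far_part k F n. \<exists>e>0. \<forall>a\<in>near_part k F n. \<rho> x a \<ge> e) \<and>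
    (\<forall>x\<in>near_part k F n. \<exists>y\<in>F \<inter> K n. \<rho> x y < 1 / Suc k) \<and>
    (\<forall>x\<in>F \<inter> K n. \<exists>e>0. \<forall>b\<in>far_part k F n. \<rho> x b \<ge> e)"
    (is "?P n")
  and "near_part k F n \<union> F \<inter> K n \<subseteq> near_part k F (Suc n)" and "far_part k F n \<subseteq> far_part k F (Suc n)"
proof -
  have inner_step: "near_part k F n \<union> F \<inter> K n \<subseteq> near_part k F (Suc n)" if P: "?P n" for n
  proof
    fix x assume x: "x \<in> near_part k F n \<union> F \<inter> K n"
    then obtain y where y: "y \<in> F \<inter> K n" "\<rho> x y < 1 / Suc k" using P by fastforce
    have "\<exists>e>0. \<forall>b\<in>far_part k F n. \<rho> x b \<ge> e" using x P by blast
    then obtain e where e: "e > 0" "\<forall>b\<in>far_part k F n. \<rho> x b \<ge> e" by blast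
    \<comment> \<open>\<open>y\<close> is a point of \<open>F\<close> closer to \<open>x\<close>
      than \<open>1 / Suc k\<close>, and \<open>b\<close> is at least that far from
      \<open>y\<close>; the difference is a positive gap for all such \<open>b\<close>.\<close>
    have "\<rho> x b \<ge> 1 / Suc k - \<rho> x y" if "b \<in> away k n F" for b
    proof -
      have "\<rho> b y \<ge> 1 / Suc k" using that y unfolding away_def by blast
      then show ?thesis using triangle[of b x y] commute[of x b] by simp
    qed
    then have "\<forall>b\<in>far_part k F n \<union> away k n F. \<rho> x x + min e (1 / Suc k - \<rho> x y) \<le> \<rho> x b"
      using e by (auto simp: min_le_iff_disj)
    moreover have "min e (1 / Suc k - \<rho> x y) > 0" using e y by simp
    moreover have "x \<in> K n" using x P by blast
    ultimately show "x \<in> near_part k F (Suc n)"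
      using x unfolding sep.simps fst_conv near_def by blast
  qed
  have outer_step: "far_part k F n \<subseteq> far_part k F (Suc n)" if P: "?P n" for n
  proof
    fix x assume x: "x \<in> far_part k F n"
    then obtain e where e: "e > 0" "\<forall>b\<in>near_part k F n. \<rho> x b \<ge> e" using P by blast
    have "x \<in> K n" using x P by blast
    moreover have "x \<notin> F"
    proof
      assume "x \<in> F"
      then obtain e' where "e' > 0" "\<forall>b\<in>far_part k F n. \<rho> x b \<ge> e'" using P \<open>x \<in> K n\<close> by blast
      then show False using x by fastforce
    qed
    ultimately obtain e' where e': "e' > 0" "\<forall>y\<in>F \<inter> K n. \<rho> x y \<ge> e'"
      using positive_distance[OF F] by blast
    have "\<forall>b\<in>near_part k F n \<union> F \<inter> K n. \<rho> x x + min e e' \<le> \<rho> x b"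
      using e e' by (auto simp: min_le_iff_disj)
    moreover have "min e e' > 0" using e e' by simp
    ultimately show "x \<in> far_part k F (Suc n)"
      using x \<open>x \<in> K n\<close> unfolding sep.simps snd_conv near_def by blast
  qed
  have inv: "?P n" for n
  proof (induction n)
    case 0
    show ?case by (auto intro: exI[of _ 1])
  next
    case (Suc n)
    let ?A = "near_part k F (Suc n)" and ?B = "far_part k F (Suc n)"
    have sub: "?A \<subseteq> K n" "?B \<subseteq> K n" using near_subset by auto
    have disj: "?A \<inter> ?B = {}" using near_disjoint by auto
    have Asep: "\<exists>e>0. \<forall>b\<in>?B. \<rho> x b \<ge> e" if "x \<in> ?A" for x
    proof -
      obtain e where "e > 0" "\<forall>y\<in>K n. \<rho> x y < e \<longrightarrow> y \<in> ?A" using near_nbhd \<open>x \<in> ?A\<close> by (metis fst_conv sep.simps(2))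
      then show ?thesis using sub disj by (intro exI[of _ e]) (auto simp: not_less[symmetric] simp del: sep.simps)
    qed
    have Bsep: "\<exists>e>0. \<forall>b\<in>?A. \<rho> x b \<ge> e" if "x \<in> ?B" for x
    proof -
      obtain e where "e > 0" "\<forall>y\<in>K n. \<rho> x y < e \<longrightarrow> y \<in> ?B" using near_nbhd \<open>x \<in> ?B\<close> by (metis snd_conv sep.simps(2))
      then show ?thesis using sub disj by (intro exI[of _ e]) (auto simp: not_less[symmetric] simp del: sep.simps)
    qed
    have "\<exists>y\<in>F \<inter> K (Suc n). \<rho> x y < 1 / Suc k" if x: "x \<in> ?A" for x
    proof -
      have "x \<notin> away k n F"
      proof
        assume "x \<in> away k n F"
        then obtain a e where "e > 0" "\<rho> x a + e \<le> \<rho> x x"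
          using x unfolding sep.simps fst_conv near_def by blast
        then show False using nonneg[of x a] by simp
      qed
      then have "\<exists>y\<in>F \<inter> K n. \<rho> x y < 1 / Suc k" using x sub(1) unfolding away_def by (force simp del: sep.simps)
      then show ?thesis using K_mono by blast
    qed
    moreover have "\<exists>e>0. \<forall>b\<in>?B. \<rho> x b \<ge> e" if x: "x \<in> F \<inter> K (Suc n)" for x
    \<comment> \<open>On \<open>K n\<close> the point already belongs to the new near part. A point
      of \<open>F\<close> that appears only in \<open>K (Suc n)\<close> lies off the closed set
      \<open>K n\<close>, which contains the new far part.\<close>
    proof (cases "x \<in> K n")
      case True
      then show ?thesis using x inner_step[OF Suc] Asep by blast
    next
      case False
      then obtain e where "e > 0" "\<forall>y\<in>K n \<inter> K (Suc n). \<rho> x y \<ge> e"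
        using positive_distance[OF K_closed, of x n "Suc n"] x by blast
      then show ?thesis using sub K_mono by blast
    qed
    ultimately show ?case using Asep Bsep sub K_mono by (simp del: sep.simps) blast
  qed
  show "?P n" by (rule inv)
  show "near_part k F n \<union> F \<inter> K n \<subseteq> near_part k F (Suc n)" "far_part k F n \<subseteq> far_part k F (Suc n)"
    using inner_step[OF inv] outer_step[OF inv] by auto
qed

text \<open>\<open>sep\<close> involves no choices: \<open>near\<close> is monotone in its first and
  antitone in its second set, and \<open>away\<close> is antitone in \<open>F\<close>. This is the
  monotonicity required of a stratification.\<close>

lemma sep_mono:
  assumes "F \<subseteq> F'"
  shows "near_part k F n \<subseteq> near_part k F' n \<and> far_part k F' n \<subseteq> far_part k F n"
proof (induction n)
  case (Suc n)
  have "away k n F' \<subseteq> away k n F" unfolding away_def using assms by blast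
  then have "near_part k F n \<union> F \<inter> K n \<subseteq> near_part k F' n \<union> F' \<inter> K n"
    "far_part k F' n \<union> away k n F' \<subseteq> far_part k F n \<union> away k n F"
    using Suc assms by blast+
  then show ?case by (simp add: near_mono)
qed auto

lemma K_le: "m \<le> n \<Longrightarrow> K m \<subseteq> K n"
  by (rule lift_Suc_mono_le[of K, OF K_mono])

text \<open>\<open>S (Suc n)\<close> is open only relative to \<open>K n\<close>. As each point
  stays in all later stages, the union is relatively open in every level, and \<open>open_if\<close>
  applies.\<close>

lemma sep_open:
  assumes S: "\<And>n. S n \<subseteq> S (Suc n)" and P: "\<And>n. \<exists>P Q. S (Suc n) = near n P Q"
  shows "open (\<Union>n. S n)"
proof (rule open_if)
  fix n x assume "x \<in> (\<Union>n. S n) \<inter> K n"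
  then obtain m where m: "x \<in> S m" by blast
  define N where "N = max m n"
  have "m \<le> Suc N" by (simp add: N_def)
  then have "x \<in> S (Suc N)" using m lift_Suc_mono_le[of S, OF S] by blast
  then obtain e where "e > 0" "\<forall>y\<in>K N. \<rho> x y < e \<longrightarrow> y \<in> S (Suc N)" using P[of N] near_nbhd by metis
  moreover have "K n \<subseteq> K N" by (rule K_le) (simp add: N_def)
  ultimately show "\<exists>e>0. \<forall>y\<in>K n. \<rho> x y < e \<longrightarrow> y \<in> (\<Union>n. S n)" by blast
qed

text \<open>\<open>G k F\<close> is the union of the near parts. For \<open>x\<close> outside
  \<open>F\<close>, let \<open>e > 0\<close> bound its distance to \<open>F\<close> from below on a
  level containing \<open>x\<close>. Once \<open>1 / Suc k < e / 2\<close>, near points on that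
  level stay \<open>e / 2\<close> away from \<open>x\<close>, so \<open>x\<close> enters the far
  part; the union of the far parts is an open set missing \<open>G k F\<close>.\<close>

lemma stratifiable:
  assumes "Hausdorff_space (euclidean :: 'a topology)" "regular_space (euclidean :: 'a topology)"
  shows "stratifiable_space (euclidean :: 'a topology)"
proof -
  define G where "G k F = (\<Union>n. near_part k F n)" for k F
  have Gopen: "open (G k F)" if "closed F" for k F
    unfolding G_def using sep_invariant(2)[OF that, of k] by (intro sep_open) auto
  have FG: "F \<subseteq> G k F" if "closed F" for k F
  proof
    fix x assume "x \<in> F"
    moreover obtain n where "x \<in> K n" using K_cover by blast
    ultimately have "x \<in> near_part k F (Suc n)" using sep_invariant(2)[OF that, of k n] by (simp only: subset_iff) blast
    then show "x \<in> G k F" unfolding G_def by blast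
  qed
  have "F = (\<Inter>k. closure (G k F))" if F: "closed F" for F
  proof (intro equalityI subsetI)
    fix x assume "x \<in> F" then show "x \<in> (\<Inter>k. closure (G k F))" using FG[OF F] closure_subset by blast
  next
    fix x assume x: "x \<in> (\<Inter>k. closure (G k F))"
    show "x \<in> F"
    proof (rule ccontr)
      assume "x \<notin> F"
      obtain n where n: "x \<in> K n" using K_cover by blast
      obtain e where e: "e > 0" "\<forall>y\<in>F \<inter> K n. \<rho> x y \<ge> e"
        using positive_distance[OF F \<open>x \<notin> F\<close> n] by blast
      obtain k where k: "1 / real (Suc k) < e / 2" using nat_approx_posE[of "e / 2"] e(1) by auto
      have "x \<in> away k n F" unfolding away_def using n e k by force
      moreover have "\<rho> x x + e / 2 \<le> \<rho> x a" if a: "a \<in> near_part k F n \<union> F \<inter> K n" for a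
      proof -
        obtain y where y: "y \<in> F \<inter> K n" "\<rho> a y < 1 / Suc k"
          using a sep_invariant(1)[OF F, of k n] by fastforce
        then have "e \<le> \<rho> x y" using e by blast
        also have "\<dots> \<le> \<rho> x a + \<rho> a y" using triangle by blast
        finally show ?thesis using y(2) k by simp
      qed
      ultimately have x_outer: "x \<in> far_part k F (Suc n)" using n e(1) unfolding sep.simps near_def
        by (auto intro!: bexI[of _ x] exI[of _ "e / 2"])
      define V where "V = (\<Union>n. far_part k F n)"
      have "open V" unfolding V_def using sep_invariant(3)[OF F, of k] by (intro sep_open) auto
      moreover have "V \<inter> G k F = {}"
      proof -
        have False if "z \<in> near_part k F i" "z \<in> far_part k F j" for z i j
        proof -
          define m where "m = max i j"
          have "near_part k F i \<subseteq> near_part k F m" "far_part k F j \<subseteq> far_part k F m"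
            using lift_Suc_mono_le[of "near_part k F" i m] lift_Suc_mono_le[of "far_part k F" j m]
              sep_invariant(2,3)[OF F, of k] by (auto simp: m_def simp del: sep.simps)
          then have "z \<in> near_part k F m" "z \<in> far_part k F m" using that by auto
          then obtain e where "e > 0" "\<rho> z z \<ge> e" using sep_invariant(1)[OF F, of k m] by blast
          then show False by simp
        qed
        then show ?thesis unfolding V_def G_def by blast
      qed
      moreover have "x \<in> V" using x_outer unfolding V_def by blast
      moreover have "x \<in> closure (G k F)" using x by blast
      ultimately show False unfolding closure_iff_nhds_not_empty by (metis Int_commute order_refl)
    qed
  qed
  moreover have "G k F \<subseteq> G k F'" if "F \<subseteq> F'" for k F F'
    unfolding G_def using sep_mono[OF that] by blast
  ultimately show ?thesis unfolding stratifiable_space_def using assms Gopen FG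
    by (intro conjI exI[of _ G]) (simp_all add: closed_closedin[symmetric] flip: closed_closedin open_openin)
qed

end

section \<open>Metric spaces have a \<open>\<sigma>\<close>-locally-finite base\<close>

context Metric_space
begin

text \<open>Stone's \<open>\<sigma>\<close>-discrete refinement of the cover by balls of radius \<open>1 / Suc m\<close>.\<close>

lemma sigma_locally_finite_base:
  obtains \<A> :: "nat \<Rightarrow> 'a set set" where "\<And>n. locally_finite_in mtopology (\<A> n)"
    "\<And>U x. openin mtopology U \<Longrightarrow> x \<in> U \<Longrightarrow> \<exists>n. \<exists>V\<in>\<A> n. openin mtopology V \<and> x \<in> V \<and> V \<subseteq> U"
proof -
  obtain r where r: "well_order_on M r" using well_order_on by blast
  have tot: "(a, b) \<in> r \<or> (b, a) \<in> r" if "a \<in> M" "b \<in> M" "a \<noteq> b" for a b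
    using r that unfolding well_order_on_def linear_order_on_def total_on_def by blast
  have wf: "wf (r - Id)" using r unfolding well_order_on_def by blast
  \<comment> \<open>Points at depth \<open>1 / Suc n\<close> in the ball about \<open>a\<close> and
    in no ball about an earlier centre; for different centres they are \<open>1 / Suc n\<close>
    apart. Fattening by a third of this still leaves a gap of a third, which no ball of radius
    \<open>1 / (6 * Suc n)\<close> bridges.\<close>
  define E where "E m n a = {x \<in> M. mball x (1 / Suc n) \<subseteq> mball a (1 / Suc m) \<and>
      (\<forall>b. (b, a) \<in> r - Id \<longrightarrow> x \<notin> mball b (1 / Suc m))}" for m n a
  define D where "D m n a = (\<Union>x\<in>E m n a. mball x (1 / (3 * Suc n)))" for m n a
  define \<A> where "\<A> i = (case prod_decode i of (m, n) \<Rightarrow> D m n ` M)" for i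
  have Dsub: "D m n a \<subseteq> mball a (1 / Suc m)" for m n a
  proof -
    have "mball x (1 / (3 * Suc n)) \<subseteq> mball x (1 / Suc n)" for x
      by (rule mball_subset_concentric) (simp add: field_simps)
    then show ?thesis unfolding D_def E_def by blast
  qed
  have Dopen: "openin mtopology (D m n a)" for m n a unfolding D_def by blast
  have uniq: "a = b" if ab: "a \<in> M" "b \<in> M" and z: "z \<in> M"
     and u: "u \<in> D m n a" "d z u < 1 / (6 * Suc n)" and v: "v \<in> D m n b" "d z v < 1 / (6 * Suc n)" for a b z u v m n
  proof (rule ccontr)
    have sep: "1 / Suc n \<le> d x y" if "(a, b) \<in> r - Id" "x \<in> E m n a" "y \<in> E m n b" for a b x y
    proof (rule ccontr)
      assume "\<not> 1 / Suc n \<le> d x y"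
      then have "y \<in> mball x (1 / Suc n)" using that unfolding E_def by auto
      then show False using that unfolding E_def by blast
    qed
    assume "a \<noteq> b"
    then have r2: "(a, b) \<in> r - Id \<or> (b, a) \<in> r - Id" using tot ab by blast
    obtain x y where x: "x \<in> E m n a" "u \<in> mball x (1 / (3 * Suc n))" and y: "y \<in> E m n b" "v \<in> mball y (1 / (3 * Suc n))"
      using u v unfolding D_def by blast
    have M: "x \<in> M" "y \<in> M" "u \<in> M" "v \<in> M" using x y by auto
    have "1 / Suc n \<le> d x y" using r2 sep[OF _ x(1) y(1)] sep[OF _ y(1) x(1)] commute[of x y] by auto
    also have "d x y \<le> d x u + d u z + d z v + d v y"
      using triangle[of x u y] triangle[of u z y] triangle[of z v y] M z by force
    also have "\<dots> < 1 / (3 * Suc n) + 1 / (6 * Suc n) + 1 / (6 * Suc n) + 1 / (3 * Suc n)"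
      using x(2) y(2) u(2) v(2) commute by (auto intro!: add_strict_mono)
    also have "\<dots> = (1 / Suc n) * (1 / 3 + 1 / 6 + 1 / 6 + 1 / 3)"
      unfolding distrib_left by (simp add: mult.commute)
    finally show False by simp
  qed
  show ?thesis
  proof (rule that[of \<A>])
    fix i
    obtain m n where i: "\<A> i = D m n ` M" by (metis \<A>_def case_prod_conv prod.exhaust)
    show "locally_finite_in mtopology (\<A> i)" unfolding locally_finite_in_def
    proof (intro conjI ballI)
      show "\<Union> (\<A> i) \<subseteq> topspace mtopology" unfolding i D_def by auto
      fix z assume "z \<in> topspace mtopology"
      then have z: "z \<in> M" by simp
      let ?V = "mball z (1 / (6 * Suc n))"
      have "finite {S \<in> \<A> i. S \<inter> ?V \<noteq> {}}"
      proof (cases "{S \<in> \<A> i. S \<inter> ?V \<noteq> {}} = {}")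
        case False
        then obtain a where a: "a \<in> M" "D m n a \<inter> ?V \<noteq> {}" unfolding i by blast
        have "S = D m n a" if S: "S \<in> \<A> i" "S \<inter> ?V \<noteq> {}" for S
        proof -
          obtain b where b: "b \<in> M" "S = D m n b" using S unfolding i by blast
          obtain u v where "u \<in> D m n a" "u \<in> ?V" "v \<in> D m n b" "v \<in> ?V"
            using a(2) S(2) b(2) by blast
          then have "a = b" using uniq[OF a(1) b(1) z, of u m n v] by simp
          then show ?thesis using b by simp
        qed
        then have "{S \<in> \<A> i. S \<inter> ?V \<noteq> {}} \<subseteq> {D m n a}" by blast
        then show ?thesis using finite_subset by blast
      qed (simp only: finite.emptyI)
      then show "\<exists>V. openin mtopology V \<and> z \<in> V \<and> finite {U \<in> \<A> i. U \<inter> V \<noteq> {}}"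
        using z by (intro exI[of _ ?V]) auto
    qed
  next
    fix U x assume U: "openin mtopology U" "x \<in> U"
    then obtain e where e: "e > 0" "mball x e \<subseteq> U" and x: "x \<in> M" unfolding openin_mtopology by blast
    obtain m where m: "1 / Suc m < e / 2" using nat_approx_posE[of "e / 2"] e(1) by auto
    have "x \<in> mball x (1 / Suc m)" using x by simp
    \<comment> \<open>The first centre in the well-order whose ball contains \<open>x\<close>; by
      the choice of \<open>m\<close> that whole ball lies within \<open>e\<close> of
      \<open>x\<close>.\<close>
    then obtain a where a: "x \<in> mball a (1 / Suc m)" "\<And>b. (b, a) \<in> r - Id \<Longrightarrow> x \<notin> mball b (1 / Suc m)"
      using wfE_min[OF wf, of x "{a. x \<in> mball a (1 / Suc m)}"] by (auto simp del: in_mball)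
    obtain e' where e': "e' > 0" "mball x e' \<subseteq> mball a (1 / Suc m)"
      using a(1) openin_mball[of a "1 / Suc m"] unfolding openin_mtopology by blast
    obtain n where n: "1 / Suc n < e'" using nat_approx_posE[OF e'(1)] by auto
    have "mball x (1 / Suc n) \<subseteq> mball x e'" using n by (intro mball_subset_concentric) simp
    then have "x \<in> E m n a" unfolding E_def using x a e' by blast
    then have "x \<in> D m n a" unfolding D_def using x by auto
    moreover have "D m n a \<subseteq> U"
    proof -
      have "mball a (1 / Suc m) \<subseteq> mball x e"
        using a(1) m commute[of a x] by (intro mball_subset) auto
      then show ?thesis using Dsub e(2) by blast
    qed
    moreover have "D m n a \<in> \<A> (prod_encode (m, n))" unfolding \<A>_def using a(1) by auto
    ultimately show "\<exists>n. \<exists>V\<in>\<A> n. openin mtopology V \<and> x \<in> V \<and> V \<subseteq> U" using Dopen by blast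
  qed
qed

lemma aleph_space_mtopology: "aleph_space mtopology"
proof -
  obtain \<A> :: "nat \<Rightarrow> 'a set set" where \<A>: "\<And>n. locally_finite_in mtopology (\<A> n)"
    "\<And>U x. openin mtopology U \<Longrightarrow> x \<in> U \<Longrightarrow> \<exists>n. \<exists>V\<in>\<A> n. openin mtopology V \<and> x \<in> V \<and> V \<subseteq> U"
    using sigma_locally_finite_base by blast
  have "k_network mtopology (\<Union>n. \<A> n)"
    unfolding k_network_def
  proof (intro conjI allI impI)
    show "(\<Union>n. \<A> n) \<subseteq> Pow (topspace mtopology)"
      using \<A>(1) unfolding locally_finite_in_def by blast
    fix U K assume UK: "openin mtopology U \<and> compactin mtopology K \<and> K \<subseteq> U"
    let ?\<U> = "{V \<in> \<Union>n. \<A> n. openin mtopology V \<and> V \<subseteq> U}"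
    have "K \<subseteq> \<Union>?\<U>"
    proof
      fix x assume "x \<in> K"
      then show "x \<in> \<Union>?\<U>" using \<A>(2)[of U x] UK by blast
    qed
    then obtain \<F> where "finite \<F>" "\<F> \<subseteq> ?\<U>" "K \<subseteq> \<Union>\<F>"
      using UK compactinD[of mtopology K ?\<U>] by blast
    then show "\<exists>\<F>. finite \<F> \<and> \<F> \<subseteq> (\<Union>n. \<A> n) \<and> K \<subseteq> \<Union>\<F> \<and> \<Union>\<F> \<subseteq> U" by blast
  qed
  then show ?thesis unfolding aleph_space_def sigma_locally_finite_in_def
    using \<A>(1) Hausdorff_space_mtopology regular_space_mtopology by blast
qed

end

section \<open>Metric and sequential fans in \<open>k\<^sup>*\<close>-metrizable groups\<close>

text \<open>Applied to the column and row indices of a sequence of sums taken from fans.\<close>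

lemma nat_subseq_const_or_strict_mono:
  fixes u :: "nat \<Rightarrow> nat"
  obtains r c where "strict_mono (r :: nat \<Rightarrow> nat)" "\<And>m. u (r m) = c" | r where "strict_mono (r :: nat \<Rightarrow> nat)" "strict_mono (u \<circ> r)"
proof (cases "finite (range u)")
  case True
  then obtain c where "infinite {m. u m = c}"
    using pigeonhole_infinite[of "UNIV :: nat set" u] by auto
  then show ?thesis using that(1)[OF strict_mono_enumerate[of "{m. u m = c}"]] enumerate_in_set by blast
next
  case False
  have "\<exists>m>n. u m > b" for n b
  proof (rule ccontr)
    assume "\<not> ?thesis"
    then have "range u \<subseteq> u ` {..n} \<union> {..b}" by (force simp: not_less)
    then show False using False finite_subset by blast
  qed
  then obtain r where r: "\<And>m. r m < r (Suc m) \<and> u (r m) < u (r (Suc m))"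
    using dependent_nat_choice[of "\<lambda>_ _. True" "\<lambda>_ n m. n < m \<and> u n < u m"] by metis
  then show ?thesis using that(2)[of r] by (auto simp: strict_mono_Suc_iff)
qed

text \<open>Since the row function \<open>k\<close> is arbitrary, the second clause says that every
  neighbourhood of 0 contains all but finitely many entire columns. The first clause also excludes a
  value occurring infinitely often in one column.\<close>

definition metric_fan :: "(nat \<Rightarrow> nat \<Rightarrow> 'g::{topological_space, zero}) \<Rightarrow> bool" where
  "metric_fan x \<longleftrightarrow> (\<forall>n r g. strict_mono r \<longrightarrow> \<not> (\<lambda>m. x n (r m)) \<longlonglongrightarrow> g) \<and>
     (\<forall>n k. strict_mono n \<longrightarrow> (\<lambda>m. x (n m) (k m)) \<longlonglongrightarrow> 0)"

definition sequential_fan :: "(nat \<Rightarrow> nat \<Rightarrow> 'g::{topological_space, zero}) \<Rightarrow> bool" where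
  "sequential_fan y \<longleftrightarrow> (\<forall>n. y n \<longlonglongrightarrow> 0) \<and>
     (\<forall>n k g. strict_mono n \<longrightarrow> \<not> (\<lambda>m. y (n m) (k m)) \<longlonglongrightarrow> g)"

text \<open>The sums \<open>x n k + y n k\<close> accumulate at \<open>0\<close> although no sequence among them converges nontrivially.\<close>

lemma no_metric_and_sequential_fan:
  fixes x y :: "nat \<Rightarrow> nat \<Rightarrow> 'g::{topological_group_add, t2_space}"
  assumes seq: "\<And>S :: 'g set. (\<And>\<sigma> l. range \<sigma> \<subseteq> S \<Longrightarrow> \<sigma> \<longlonglongrightarrow> l \<Longrightarrow> l \<in> S) \<Longrightarrow> closed S"
    and x: "metric_fan x" and y: "sequential_fan y"
  shows False
proof -
  have x1: "\<not> (\<lambda>m. x n (r m)) \<longlonglongrightarrow> g" if "strict_mono r" for n r g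
    using x that unfolding metric_fan_def by blast
  have x2: "(\<lambda>m. x (n m) (k m)) \<longlonglongrightarrow> 0" if "strict_mono n" for n k
    using x that unfolding metric_fan_def by blast
  have y1: "y n \<longlonglongrightarrow> 0" for n using y unfolding sequential_fan_def by blast
  have y2: "\<not> (\<lambda>m. y (n m) (k m)) \<longlonglongrightarrow> g" if "strict_mono n" for n k g
    using y that unfolding sequential_fan_def by blast
  \<comment> \<open>Zero sums are left out, so that \<open>0 \<notin> A\<close> by construction and
    closedness of \<open>A\<close> contradicts accumulation at 0.\<close>
  define A where "A = {x n k + y n k | n k. x n k + y n k \<noteq> 0}"
  have "closed A"
  proof (rule seq)
    fix \<sigma> l assume \<sigma>: "range \<sigma> \<subseteq> A" "\<sigma> \<longlonglongrightarrow> l"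
    have "\<forall>m. \<exists>n k. \<sigma> m = x n k + y n k" using \<sigma>(1) unfolding A_def by blast
    then obtain n k where nk: "\<And>m. \<sigma> m = x (n m) (k m) + y (n m) (k m)" by metis
    have sub: "(\<lambda>m. \<sigma> (r m)) \<longlonglongrightarrow> l" if "strict_mono r" for r :: "nat \<Rightarrow> nat"
      using LIMSEQ_subseq_LIMSEQ[OF \<sigma>(2) that] by (simp add: o_def)
    \<comment> \<open>Increasing columns would make the \<open>y\<close> terms converge, a constant
      column with increasing rows the \<open>x\<close> terms; both are excluded. So column and row
      are constant along a subsequence, and \<open>l\<close> is one of the sums.\<close>
    show "l \<in> A"
    proof (rule nat_subseq_const_or_strict_mono[of n])
      fix r :: "nat \<Rightarrow> nat" assume r: "strict_mono r" "strict_mono (n \<circ> r)"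
      have "(\<lambda>m. x (n (r m)) (k (r m))) \<longlonglongrightarrow> 0" using x2[OF r(2), of "k \<circ> r"] by simp
      then have "(\<lambda>m. - x (n (r m)) (k (r m)) + \<sigma> (r m)) \<longlonglongrightarrow> - 0 + l"
        by (intro tendsto_intros sub r(1))
      then have "(\<lambda>m. y ((n \<circ> r) m) ((k \<circ> r) m)) \<longlonglongrightarrow> l" by (simp add: nk add.assoc[symmetric])
      then show ?thesis using y2 r(2) by blast
    next
      fix r :: "nat \<Rightarrow> nat" and c assume r: "strict_mono r" "\<And>m. n (r m) = c"
      show ?thesis
      proof (rule nat_subseq_const_or_strict_mono[of "k \<circ> r"])
        fix s :: "nat \<Rightarrow> nat" assume s: "strict_mono s" "strict_mono (k \<circ> r \<circ> s)"
        have "(\<lambda>m. y c ((k \<circ> r \<circ> s) m)) \<longlonglongrightarrow> 0"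
          using LIMSEQ_subseq_LIMSEQ[OF y1[of c] s(2)] by (simp add: o_def)
        then have "(\<lambda>m. \<sigma> (r (s m)) + - y c ((k \<circ> r \<circ> s) m)) \<longlonglongrightarrow> l + - 0"
          using sub[OF strict_mono_o[OF r(1) s(1)]] by (intro tendsto_intros) (simp_all add: o_def)
        then have "(\<lambda>m. x c ((k \<circ> r \<circ> s) m)) \<longlonglongrightarrow> l" by (simp add: nk r(2))
        then show ?thesis using x1 s(2) by blast
      next
        fix s :: "nat \<Rightarrow> nat" and d assume s: "strict_mono s" "\<And>m. (k \<circ> r) (s m) = d"
        have "(\<lambda>m. \<sigma> (r (s m))) \<longlonglongrightarrow> l"
          using sub[OF strict_mono_o[OF r(1) s(1)]] by simp
        moreover have "(\<lambda>m. \<sigma> (r (s m))) = (\<lambda>m. \<sigma> (r (s 0)))"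
          using nk r(2) s(2) by (intro ext) simp
        ultimately have "l = \<sigma> (r (s 0))" by (simp add: LIMSEQ_const_iff)
        then show ?thesis using \<sigma>(1) by auto
      qed
    qed
  qed
  moreover have "0 \<in> closure A"
    unfolding closure_iff_nhds_not_empty
  proof (intro allI impI)
    fix S V :: "'g set" assume "V \<subseteq> S" "open V" "0 \<in> V"
    then obtain W where W: "open W" "0 \<in> W" "\<And>a b. a \<in> W \<Longrightarrow> b \<in> W \<Longrightarrow> a + b \<in> V"
      using zero_nbhd_add by metis
    have "\<exists>n. \<forall>k. x n k \<in> W"
    proof (rule ccontr)
      assume "\<nexists>n. \<forall>k. x n k \<in> W"
      then obtain k where k: "\<And>n. x n (k n) \<notin> W" by metis
      have "(\<lambda>m. x m (k m)) \<longlonglongrightarrow> 0" using x2[OF strict_mono_id] by simp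
      then have "\<forall>\<^sub>F m in sequentially. x m (k m) \<in> W" using W topological_tendstoD by blast
      then show False using k by simp
    qed
    then obtain n where n: "\<And>k. x n k \<in> W" by blast
    obtain K where K: "\<And>k. k \<ge> K \<Longrightarrow> y n k \<in> W"
      using topological_tendstoD[OF y1 W(1,2), of n] unfolding eventually_sequentially by blast
    \<comment> \<open>Otherwise the tail of column \<open>n\<close> of the metric fan would be
      \<open>- y n k\<close> and converge to 0.\<close>
    have "\<exists>k\<ge>K. x n k + y n k \<noteq> 0"
    proof (rule ccontr)
      assume "\<not> ?thesis"
      then have "x n (k + K) = - y n (k + K)" for k by (simp add: eq_neg_iff_add_eq_0)
      moreover have "(\<lambda>k. - y n (k + K)) \<longlonglongrightarrow> - 0"
        by (intro tendsto_intros LIMSEQ_ignore_initial_segment y1)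
      ultimately have "(\<lambda>k. x n (k + K)) \<longlonglongrightarrow> 0" by simp
      then show False using x1[of "\<lambda>k. k + K"] by (simp add: strict_mono_def)
    qed
    then obtain k where "k \<ge> K" "x n k + y n k \<noteq> 0" by blast
    then have "x n k + y n k \<in> A \<inter> V" unfolding A_def using W(3) n K by blast
    then show "A \<inter> S \<noteq> {}" using \<open>V \<subseteq> S\<close> by blast
  qed
  ultimately show False unfolding A_def by auto
qed

section \<open>Lifting sequences through a subproper map\<close>

lemma inverse_Suc_limit: "(\<lambda>k. 1 / real (Suc k)) \<longlonglongrightarrow> 0"
  using LIMSEQ_inverse_real_of_nat by (simp add: inverse_eq_divide)

text \<open>Density of \<open>Z\<close> lets points of \<open>M\<close> be moved into
  \<open>Z\<close>, where subproperness controls them. Subproperness is stated for compact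
  \<open>K\<close> only, these being the closed precompact sets.\<close>

locale sequential_k_star_group = Metric_space M d
  for M :: "'m set" and d +
  fixes f :: "'m \<Rightarrow> 'g::{topological_group_add, t2_space}" and Z :: "'m set"
  assumes seq: "\<And>S :: 'g set. (\<And>\<sigma> l. range \<sigma> \<subseteq> S \<Longrightarrow> \<sigma> \<longlonglongrightarrow> l \<Longrightarrow> l \<in> S) \<Longrightarrow> closed S"
    and Z_sub: "Z \<subseteq> M" and dense: "mtopology closure_of Z = M" and surj: "f ` Z = UNIV"
    and cont: "continuous_map mtopology euclidean f"
    and subproper: "\<And>K. compact K \<Longrightarrow> compactin mtopology (mtopology closure_of (Z \<inter> f -` K))"
begin

definition sec :: "'g \<Rightarrow> 'm" where "sec = inv_into Z f"

lemma f_sec [simp]: "f (sec x) = x"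
  unfolding sec_def by (rule f_inv_into_f) (simp add: surj)

lemma sec_Z [simp]: "sec x \<in> Z"
  unfolding sec_def by (rule inv_into_into) (simp add: surj)

lemma sec_M [simp]: "sec x \<in> M" using Z_sub sec_Z by blast

lemma limit_f:
  assumes "limitin mtopology z q sequentially"
  shows "(\<lambda>n. f (z n)) \<longlonglongrightarrow> f q"
  using continuous_map_limit[OF cont assms] by (simp add: o_def limitin_canonical_iff)

lemma limitin_dist:
  "limitin mtopology z q sequentially \<longleftrightarrow>
     q \<in> M \<and> (\<forall>e>0. \<forall>\<^sub>F n in sequentially. z n \<in> M \<and> d (z n) q < e)"
  by (rule limitin_metric)

text \<open>A convergent sequence with its limit is compact, so the points of \<open>Z\<close> above
  it have compact closure, and compactness in a metric space is sequential. Any prescribed lift into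
  \<open>Z\<close> works, which the fan constructions need.\<close>

lemma convergent_subsequence:
  assumes z: "\<And>n. z n \<in> Z" and x: "(\<lambda>n. f (z n)) \<longlonglongrightarrow> x"
  obtains r q where "strict_mono r" "limitin mtopology (z \<circ> r) q sequentially" "q \<in> M" "f q = x"
proof -
  define K where "K = insert x (range (\<lambda>n. f (z n)))"
  have "compact K" unfolding K_def
    using compactin_sequence_with_limit[of euclidean "\<lambda>n. f (z n)" x] x
    by (simp add: limitin_canonical_iff)
  then have "compactin mtopology (mtopology closure_of (Z \<inter> f -` K))" by (rule subproper)
  moreover have "range z \<subseteq> mtopology closure_of (Z \<inter> f -` K)"
    using closure_of_subset[of "Z \<inter> f -` K" mtopology] z Z_sub by (auto simp: K_def)
  ultimately obtain q r where q: "strict_mono r" "limitin mtopology (z \<circ> r) q sequentially"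
    unfolding compactin_sequentially by metis
  moreover have "f q = x"
    using limit_f[OF q(2)] LIMSEQ_subseq_LIMSEQ[OF x q(1)] LIMSEQ_unique unfolding o_def by blast
  ultimately show ?thesis using that limitin_mspace by blast
qed

lemma dense_approximation:
  assumes "q \<in> M" "e > 0"
  obtains z where "z \<in> Z" "d z q < e"
proof -
  have "q \<in> mtopology closure_of Z" using assms dense by simp
  then obtain z where "z \<in> Z" "z \<in> mball q e" unfolding metric_closure_of using assms(2) by blast
  then show ?thesis using that commute by auto
qed

lemma close_limit:
  assumes "limitin mtopology z q sequentially" and z': "\<And>n. z' n \<in> M" "\<And>n. d (z' n) (z n) < \<epsilon> n" and "\<epsilon> \<longlonglongrightarrow> 0"
  shows "limitin mtopology z' q sequentially"
  unfolding limitin_dist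
proof (intro conjI allI impI)
  show q: "q \<in> M" using assms limitin_mspace by blast
  fix e :: real assume "e > 0"
  then have "\<forall>\<^sub>F n in sequentially. z n \<in> M \<and> d (z n) q < e / 2" "\<forall>\<^sub>F n in sequentially. \<epsilon> n < e / 2"
    using assms(1) order_tendstoD(2)[OF assms(4), of "e/2"] unfolding limitin_dist by (meson half_gt_zero)+
  then show "\<forall>\<^sub>F n in sequentially. z' n \<in> M \<and> d (z' n) q < e"
  proof eventually_elim
    case (elim n)
    then show ?case using triangle[of "z' n" "z n" q] z'(2)[of n] z'(1)[of n] q by force
  qed
qed

text \<open>Taken in \<open>M\<close> rather than in \<open>Z\<close>: lifts of a null sequence
  accumulate at points over 0 that may lie outside \<open>Z\<close>.\<close>

definition F :: "'m set" where "F = {p \<in> M. f p = 0}"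

text \<open>Each noncompact ball of radius \<open>1 / Suc n\<close> contains a sequence without
  convergent subsequence; its image, translated by \<open>- f p\<close>, is column \<open>n\<close>.
  A convergent subsequence of the column would lift to one in \<open>M\<close>, while shrinking
  radii and continuity of \<open>f\<close> at \<open>p\<close> make the columns shrink.\<close>

lemma metric_fan_if_not_locally_compact:
  assumes p: "p \<in> M" and nlc: "\<And>e. e > 0 \<Longrightarrow> \<not> compactin mtopology (mcball p e)"
  obtains x :: "nat \<Rightarrow> nat \<Rightarrow> 'g" where "metric_fan x"
proof -
  have "\<exists>\<sigma> :: nat \<Rightarrow> 'm. range \<sigma> \<subseteq> mcball p (1 / Suc n) \<and> (\<forall>r l. strict_mono r \<longrightarrow> \<not> limitin mtopology (\<sigma> \<circ> r) l sequentially)" for n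
  proof -
    have "\<not> compactin mtopology (mcball p (1 / Suc n))" by (rule nlc) simp
    then obtain \<sigma> :: "nat \<Rightarrow> 'm" where \<sigma>: "range \<sigma> \<subseteq> mcball p (1 / Suc n)"
        "\<not> (\<exists>l r. l \<in> mcball p (1 / Suc n) \<and> strict_mono r \<and> limitin mtopology (\<sigma> \<circ> r) l sequentially)"
      using mcball_subset_mspace[of p "1 / Suc n"] unfolding compactin_sequentially by (elim conjE | blast)+
    have "l \<in> mcball p (1 / Suc n)" if "limitin mtopology (\<sigma> \<circ> r) l sequentially" for r l
      by (rule limitin_closedin[OF that closedin_mcball])
        (use \<sigma>(1) in \<open>auto simp del: in_mcball intro!: always_eventually\<close>)
    then show ?thesis using \<sigma> by (intro exI[of _ \<sigma>]) blast
  qed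
  then have "\<exists>\<sigma> :: nat \<Rightarrow> nat \<Rightarrow> 'm. \<forall>n. range (\<sigma> n) \<subseteq> mcball p (1 / Suc n) \<and>
      (\<forall>r l. strict_mono r \<longrightarrow> \<not> limitin mtopology (\<sigma> n \<circ> r) l sequentially)"
    by (intro choice allI)
  then obtain \<sigma> :: "nat \<Rightarrow> nat \<Rightarrow> 'm" where \<sigma>': "\<forall>n. range (\<sigma> n) \<subseteq> mcball p (1 / Suc n) \<and>
      (\<forall>r l. strict_mono r \<longrightarrow> \<not> limitin mtopology (\<sigma> n \<circ> r) l sequentially)"
    by (rule exE)
  have \<sigma>: "\<sigma> n k \<in> mcball p (1 / Suc n)"
      "strict_mono r \<Longrightarrow> \<not> limitin mtopology (\<sigma> n \<circ> r) l sequentially" for n k r l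
    using \<sigma>' by blast+
  \<comment> \<open>The error tends to 0 both down each column and across increasing columns, so
    moving the points into \<open>Z\<close> preserves both properties of the fan.\<close>
  have "\<exists>z\<in>Z. d z (\<sigma> n k) < 1 / (Suc n + Suc k)" for n k
    using dense_approximation[of "\<sigma> n k" "1 / (Suc n + Suc k)"] \<sigma>(1)[of n k] by auto
  then have "\<exists>z. \<forall>n k. z n k \<in> Z \<and> d (z n k) (\<sigma> n k) < 1 / (Suc n + Suc k)"
    by (intro choice allI) blast
  then obtain z where z: "\<And>n k. z n k \<in> Z" "\<And>n k. d (z n k) (\<sigma> n k) < 1 / (Suc n + Suc k)" by blast
  have zM: "z n k \<in> M" for n k using z(1) Z_sub by blast
  have \<sigma>M: "\<sigma> n k \<in> M" "d p (\<sigma> n k) \<le> 1 / Suc n" for n k using \<sigma>(1)[of n k] by auto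
  have zlim: "\<not> limitin mtopology (z n \<circ> r) l sequentially" if r: "strict_mono r" for n r l
  proof
    assume l: "limitin mtopology (z n \<circ> r) l sequentially"
    have "d ((\<sigma> n \<circ> r) k) ((z n \<circ> r) k) < 1 / Suc k" for k
    proof -
      have "d ((\<sigma> n \<circ> r) k) ((z n \<circ> r) k) < 1 / (Suc n + Suc (r k))" using z(2)[of n "r k"] by (simp add: commute)
      also have "\<dots> \<le> 1 / Suc k" using seq_suble[OF r, of k] by (intro divide_left_mono) auto
      finally show ?thesis .
    qed
    then have "limitin mtopology (\<sigma> n \<circ> r) l sequentially"
      using \<sigma>M inverse_Suc_limit
      by (intro close_limit[OF l, of "\<sigma> n \<circ> r" "\<lambda>k. 1 / Suc k"]) auto
    then show False using \<sigma>(2) r by blast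
  qed
  define x where "x n k = f (z n k) - f p" for n k
  have "metric_fan x" unfolding metric_fan_def
  proof (intro conjI allI impI notI)
    fix n and r :: "nat \<Rightarrow> nat" and g assume r: "strict_mono r" and "(\<lambda>m. x n (r m)) \<longlonglongrightarrow> g"
    then have "(\<lambda>m. x n (r m) + f p) \<longlonglongrightarrow> g + f p" by (intro tendsto_intros)
    then have lim: "(\<lambda>m. f (z n (r m))) \<longlonglongrightarrow> g + f p" by (simp add: x_def)
    obtain s q where s: "strict_mono s" "limitin mtopology ((\<lambda>m. z n (r m)) \<circ> s) q sequentially"
      using convergent_subsequence[OF z(1) lim] by blast
    then have "limitin mtopology (z n \<circ> (r \<circ> s)) q sequentially" by (simp add: o_def)
    then show False using zlim strict_mono_o[OF r s(1)] by blast
  next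
    fix n k :: "nat \<Rightarrow> nat" assume n: "strict_mono n"
    have "limitin mtopology (\<lambda>m. p) p sequentially" using p by simp
    moreover have "d (z (n m) (k m)) p < 2 / Suc m" for m
    proof -
      have "d (z (n m) (k m)) p < 1 / (Suc (n m) + Suc (k m)) + 1 / Suc (n m)"
        using triangle[OF zM \<sigma>M(1) p, of "n m" "k m" "n m" "k m"] z(2)[of "n m" "k m"] \<sigma>M(2)[of "n m" "k m"] commute
        by (simp add: commute)
      also have "\<dots> \<le> 1 / Suc m + 1 / Suc m"
        using seq_suble[OF n, of m] by (intro add_mono divide_left_mono) auto
      finally show ?thesis by simp
    qed
    ultimately have "limitin mtopology (\<lambda>m. z (n m) (k m)) p sequentially"
      using zM tendsto_mult_left[OF inverse_Suc_limit, of 2]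
      by (intro close_limit[of "\<lambda>m. p" p "\<lambda>m. z (n m) (k m)" "\<lambda>m. 2 / Suc m"]) auto
    then have "(\<lambda>m. f (z (n m) (k m)) + - f p) \<longlonglongrightarrow> f p + - f p"
      by (intro tendsto_intros limit_f)
    then show "(\<lambda>m. x (n m) (k m)) \<longlonglongrightarrow> 0" by (simp add: x_def)
  qed
  then show ?thesis by (rule that)
qed

text \<open>Column \<open>i\<close> is the image of a sequence in \<open>Z\<close> converging to
  \<open>p i\<close>, hence null. A convergent sequence across increasing columns would lift to a
  convergent subsequence in \<open>Z\<close>, and the nearby points \<open>p i\<close> would
  converge with it.\<close>

lemma sequential_fan_if_not_compact_fibre:
  assumes p: "\<And>i :: nat. p i \<in> F" and np: "\<And>r l. strict_mono r \<Longrightarrow> \<not> limitin mtopology (p \<circ> r) l sequentially"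
  obtains y :: "nat \<Rightarrow> nat \<Rightarrow> 'g" where "sequential_fan y"
proof -
  have pM: "p i \<in> M" "f (p i) = 0" for i using p unfolding F_def by auto
  have "\<exists>z\<in>Z. d z (p i) < 1 / (Suc i + Suc j)" for i j
    using dense_approximation[OF pM(1), of "1 / (Suc i + Suc j)" i] by auto
  then have "\<exists>z. \<forall>i j. z i j \<in> Z \<and> d (z i j) (p i) < 1 / (Suc i + Suc j)"
    by (intro choice allI) blast
  then obtain z where z: "\<And>i j. z i j \<in> Z" "\<And>i j. d (z i j) (p i) < 1 / (Suc i + Suc j)" by blast
  have zM: "z n k \<in> M" for n k using z(1) Z_sub by blast
  define y where "y i j = f (z i j)" for i j
  have "sequential_fan y" unfolding sequential_fan_def
  proof (intro conjI allI impI notI)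
    fix i
    have "d (z i j) (p i) < 1 / Suc j" for j
    proof -
      have "1 / real (Suc i + Suc j) \<le> 1 / Suc j" by (intro divide_left_mono) auto
      then show ?thesis using z(2)[of i j] by simp
    qed
    then have "limitin mtopology (z i) (p i) sequentially"
      using pM zM inverse_Suc_limit
      by (intro close_limit[of "\<lambda>j. p i" "p i" "z i" "\<lambda>k. 1 / Suc k"]) auto
    then show "y i \<longlonglongrightarrow> 0" using limit_f[of "z i" "p i"] pM(2) by (simp add: y_def[abs_def])
  next
    fix n k :: "nat \<Rightarrow> nat" and g assume n: "strict_mono n" and lim: "(\<lambda>m. y (n m) (k m)) \<longlonglongrightarrow> g"
    obtain s q where s: "strict_mono s" "limitin mtopology ((\<lambda>m. z (n m) (k m)) \<circ> s) q sequentially"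
      using convergent_subsequence[OF z(1) lim[unfolded y_def]] by blast
    have "d ((p \<circ> (n \<circ> s)) m) (((\<lambda>m. z (n m) (k m)) \<circ> s) m) < 1 / Suc m" for m
    proof -
      have "d ((p \<circ> (n \<circ> s)) m) (((\<lambda>m. z (n m) (k m)) \<circ> s) m) < 1 / (Suc (n (s m)) + Suc (k (s m)))"
        using z(2)[of "n (s m)" "k (s m)"] by (simp add: commute)
      also have "\<dots> \<le> 1 / Suc m" using seq_suble[OF strict_mono_o[OF n s(1)], of m] by (intro divide_left_mono) auto
      finally show ?thesis .
    qed
    then have "limitin mtopology (p \<circ> (n \<circ> s)) q sequentially"
      using pM inverse_Suc_limit
      by (intro close_limit[OF s(2), of "p \<circ> (n \<circ> s)" "\<lambda>k. 1 / Suc k"]) auto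
    then show False using np strict_mono_o[OF n s(1)] by blast
  qed
  then show ?thesis by (rule that)
qed

end

section \<open>A countable base at 0 from a compact fibre\<close>

lemma subseq_avoiding:
  fixes x :: "nat \<Rightarrow> 'a"
  assumes "\<not> eventually (\<lambda>n. P (x n)) sequentially"
  obtains r where "strict_mono (r :: nat \<Rightarrow> nat)" "\<And>n. \<not> P (x (r n))"
proof -
  have inf: "infinite {n. \<not> P (x n)}"
    using assms unfolding frequently_cofinite[symmetric] frequently_def cofinite_eq_sequentially by simp
  show ?thesis
  proof (rule that[OF strict_mono_enumerate[OF inf]])
    fix n show "\<not> P (x (enumerate {n. \<not> P (x n)} n))" using enumerate_in_set[OF inf, of n] by simp
  qed
qed

context sequential_k_star_group
begin

text \<open>If the fibre \<open>F\<close> is compact, the images of its neighbourhoods form a countable base of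
  sequential neighbourhoods of \<open>0\<close>. Either their sequential interiors are neighbourhoods of \<open>0\<close>, or
  one finds points \<open>a m \<rightarrow> 0\<close> and \<open>a m + y m r \<rightarrow> a m\<close> outside one of them.\<close>

lemma countable_base_or_sequential_fan_compact:
  assumes comp: "\<And>p. (\<And>i :: nat. p i \<in> F) \<Longrightarrow> \<exists>r l. strict_mono (r :: nat \<Rightarrow> nat) \<and> limitin mtopology (p \<circ> r) l sequentially"
  shows "(\<exists>y :: nat \<Rightarrow> nat \<Rightarrow> 'g. sequential_fan y) \<or>
    (\<exists>U :: nat \<Rightarrow> 'g set. (\<forall>n. open (U n) \<and> 0 \<in> U n) \<and> (\<forall>V. open V \<and> 0 \<in> V \<longrightarrow> (\<exists>n. U n \<subseteq> V)))"
proof -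
  define B where "B n = {f z | z. z \<in> Z \<and> (\<exists>p\<in>F. d z p < 1 / Suc n)}" for n
  have B_seq_nbhd: "\<forall>\<^sub>F k in sequentially. x k \<in> B n" if x: "x \<longlonglongrightarrow> 0" for x n
  proof (rule ccontr)
    assume "\<not> ?thesis"
    then obtain r :: "nat \<Rightarrow> nat" where r: "strict_mono r" "\<And>k. x (r k) \<notin> B n"
      using subseq_avoiding[of "\<lambda>g. g \<in> B n" x] by blast
    have "(\<lambda>k. f (sec (x (r k)))) \<longlonglongrightarrow> 0" using LIMSEQ_subseq_LIMSEQ[OF x r(1)] by (simp add: o_def)
    then obtain s :: "nat \<Rightarrow> nat" and q where s: "strict_mono s" "limitin mtopology ((\<lambda>k. sec (x (r k))) \<circ> s) q sequentially" "q \<in> M" "f q = 0"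
      by (rule convergent_subsequence[OF sec_Z])
    have "\<forall>\<^sub>F k in sequentially. sec (x (r (s k))) \<in> M \<and> d (sec (x (r (s k)))) q < 1 / Suc n"
      using s(2) unfolding limitin_dist by simp
    then obtain k where "d (sec (x (r (s k)))) q < 1 / Suc n" by (auto simp: eventually_sequentially)
    then have "f (sec (x (r (s k)))) \<in> B n" unfolding B_def using s(3,4) F_def sec_Z by blast
    then show False using r(2) by simp
  qed
  \<comment> \<open>Here compactness of the fibre enters: nearby points of \<open>F\<close> have a
    convergent subsequence, which the lifts of \<open>b\<close> follow.\<close>
  have B_lim: "b \<longlonglongrightarrow> 0" if b: "\<And>m. b m \<in> B (k m)" and k: "\<And>m. m \<le> k m" for b k
  proof (rule ccontr)
    assume "\<not> b \<longlonglongrightarrow> 0"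
    then obtain V where V: "open V" "0 \<in> V" "\<not> (\<forall>\<^sub>F m in sequentially. b m \<in> V)"
      unfolding tendsto_def by blast
    then obtain r :: "nat \<Rightarrow> nat" where r: "strict_mono r" "\<And>m. b (r m) \<notin> V"
      using subseq_avoiding[of "\<lambda>g. g \<in> V" b] by blast
    have "\<forall>m. \<exists>z p. b m = f z \<and> z \<in> Z \<and> p \<in> F \<and> d z p < 1 / Suc (k m)" using b unfolding B_def by blast
    then obtain z p where z: "\<And>m. b m = f (z m)" "\<And>m. z m \<in> Z" "\<And>m. p m \<in> F" "\<And>m. d (z m) (p m) < 1 / Suc (k m)"
      by metis
    obtain s :: "nat \<Rightarrow> nat" and l where s: "strict_mono s" "limitin mtopology ((p \<circ> r) \<circ> s) l sequentially" using comp[of "p \<circ> r"] z(3) by auto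
    have "d ((z \<circ> r \<circ> s) m) ((p \<circ> r \<circ> s) m) < 1 / Suc m" for m
    proof -
      have "m \<le> k (r (s m))" using seq_suble[OF s(1), of m] seq_suble[OF r(1), of "s m"] k[of "r (s m)"] by simp
      then have "1 / real (Suc (k (r (s m)))) \<le> 1 / Suc m" by (intro divide_left_mono) auto
      then show ?thesis using z(4)[of "r (s m)"] by simp
    qed
    then have lim: "limitin mtopology (z \<circ> r \<circ> s) l sequentially"
      using inverse_Suc_limit z(2) Z_sub by (intro close_limit[OF s(2)]) auto
    have "(\<lambda>m. f (p (r (s m)))) \<longlonglongrightarrow> f l" using limit_f[OF s(2)] by (simp add: o_def)
    then have "f l = 0" using z(3) LIMSEQ_unique[OF _ tendsto_const[of 0]] unfolding F_def by simp
    then have "(\<lambda>m. b (r (s m))) \<longlonglongrightarrow> 0" using limit_f[OF lim] z(1) by (simp add: o_def)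
    then have "\<forall>\<^sub>F m in sequentially. b (r (s m)) \<in> V" using V by (auto dest: topological_tendstoD)
    then show False using r(2) by simp
  qed
  have B_anti: "B n \<subseteq> B m" if "m \<le> n" for m n
  proof -
    have "1 / real (Suc n) \<le> 1 / Suc m" using that by (intro divide_left_mono) auto
    then have "t < 1 / Suc n \<Longrightarrow> t < 1 / Suc m" for t by simp
    then show ?thesis unfolding B_def by blast
  qed
  have B0: "0 \<in> B n" for n
    using B_seq_nbhd[of "\<lambda>_. 0"] by simp
  \<comment> \<open>An interior of \<open>B n\<close>, formed as if the \<open>B m\<close> were
    neighbourhoods of 0. It is open once every \<open>I m\<close> contains some \<open>B k\<close>:
    near \<open>l \<in> I n\<close> one moves within \<open>l + B k\<close> and still has room
    left.\<close>
  define I where "I n = {g. \<exists>m. \<forall>b\<in>B m. g + b \<in> B n}" for n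
  have I_B: "I n \<subseteq> B n" for n unfolding I_def using B0 by force
  show ?thesis
  proof (cases "\<forall>n. \<exists>m. B m \<subseteq> I n")
    case True
    have "open (I n)" for n
    proof -
      have "closed (- I n)"
      proof (rule seq)
        fix \<sigma> l assume \<sigma>: "range \<sigma> \<subseteq> - I n" "\<sigma> \<longlonglongrightarrow> l"
        show "l \<in> - I n"
        proof
          assume "l \<in> I n"
          then obtain m where m: "\<And>b. b \<in> B m \<Longrightarrow> l + b \<in> B n" unfolding I_def by blast
          obtain k where k: "B k \<subseteq> I m" using True by blast
          have "(\<lambda>i. - l + \<sigma> i) \<longlonglongrightarrow> - l + l" by (intro tendsto_intros \<sigma>)
          then have "\<forall>\<^sub>F i in sequentially. - l + \<sigma> i \<in> B k" using B_seq_nbhd by simp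
          then obtain i where "- l + \<sigma> i \<in> B k" by (auto simp: eventually_sequentially)
          then obtain j where j: "\<And>b. b \<in> B j \<Longrightarrow> - l + \<sigma> i + b \<in> B m" using k unfolding I_def by blast
          have "\<sigma> i + b \<in> B n" if "b \<in> B j" for b
            using m[OF j[OF that]] by (simp add: add.assoc[symmetric])
          then have "\<sigma> i \<in> I n" unfolding I_def by blast
          then show False using \<sigma>(1) by auto
        qed
      qed
      then show ?thesis by (simp add: closed_def)
    qed
    moreover have "0 \<in> I n" for n unfolding I_def by (auto intro: exI[of _ n])
    moreover have "\<exists>n. I n \<subseteq> V" if V: "open V" "0 \<in> V" for V
    proof (rule ccontr)
      assume "\<not> ?thesis"
      then have "\<forall>n. \<exists>b. b \<in> B n \<and> b \<notin> V" using I_B by blast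
      then obtain b where b: "\<And>n. b n \<in> B n" "\<And>n. b n \<notin> V" by metis
      have "b \<longlonglongrightarrow> 0" by (rule B_lim[of b "\<lambda>n. n"]) (use b in auto)
      then have "\<forall>\<^sub>F n in sequentially. b n \<in> V" using V by (auto dest: topological_tendstoD)
      then show False using b(2) by simp
    qed
    ultimately show ?thesis by blast
  next
    case False
    then obtain n where n: "\<And>m. \<not> B m \<subseteq> I n" by blast
    then have "\<forall>m. \<exists>a. a \<in> B m \<and> (\<forall>r. \<exists>y\<in>B r. a + y \<notin> B n)" unfolding I_def by blast
    then obtain a where a': "\<forall>m. a m \<in> B m \<and> (\<forall>r. \<exists>y\<in>B r. a m + y \<notin> B n)" by (rule choice[THEN exE])
    then have a: "\<And>m. a m \<in> B m" "\<And>m r. \<exists>y\<in>B r. a m + y \<notin> B n" by blast+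
    \<comment> \<open>The index \<open>m + r\<close> makes \<open>y\<close> null both along each
      column and across columns.\<close>
    then have "\<exists>y. \<forall>m r. y m r \<in> B (m + r) \<and> a m + y m r \<notin> B n" by (intro choice allI) blast
    then obtain y where y: "\<And>m r. y m r \<in> B (m + r)" "\<And>m r. a m + y m r \<notin> B n" by blast
    have a0: "a \<longlonglongrightarrow> 0" by (rule B_lim[of a "\<lambda>n. n"]) (use a in auto)
    have "sequential_fan y" unfolding sequential_fan_def
    proof (intro conjI allI impI notI)
      fix m show "y m \<longlonglongrightarrow> 0" by (rule B_lim[of "y m" "\<lambda>r. m + r"]) (use y in auto)
    next
      fix m k :: "nat \<Rightarrow> nat" and g assume m: "strict_mono m" "(\<lambda>i. y (m i) (k i)) \<longlonglongrightarrow> g"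
      \<comment> \<open>Both summands are null across increasing columns, so the sums form a null
        sequence outside \<open>B n\<close>, against \<open>B_seq_nbhd\<close>.\<close>
      have "(\<lambda>i. y (m i) (k i)) \<longlonglongrightarrow> 0"
        by (rule B_lim[of _ "\<lambda>i. m i + k i"]) (use y seq_suble[OF m(1)] in \<open>auto intro: trans_le_add1\<close>)
      moreover have "(\<lambda>i. a (m i)) \<longlonglongrightarrow> 0" using LIMSEQ_subseq_LIMSEQ[OF a0 m(1)] by (simp add: o_def)
      ultimately have "(\<lambda>i. a (m i) + y (m i) (k i)) \<longlonglongrightarrow> 0 + 0" by (intro tendsto_intros)
      then have "\<forall>\<^sub>F i in sequentially. a (m i) + y (m i) (k i) \<in> B n" using B_seq_nbhd by simp
      then show False using y(2) by simp
    qed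
    then show ?thesis by blast
  qed
qed

text \<open>A sequential fan excludes metric fans, so every point of \<open>M\<close> has a compact
  ball. Without sequential fans the fibre is sequentially compact.\<close>

lemma countable_base_or_locally_compact:
  "(\<exists>U :: nat \<Rightarrow> 'g set. (\<forall>n. open (U n) \<and> 0 \<in> U n) \<and> (\<forall>V. open V \<and> 0 \<in> V \<longrightarrow> (\<exists>n. U n \<subseteq> V))) \<or>
   (\<forall>p\<in>M. \<exists>e>0. compactin mtopology (mcball p e))"
proof (cases "\<exists>y :: nat \<Rightarrow> nat \<Rightarrow> 'g. sequential_fan y")
  case True
  then obtain y :: "nat \<Rightarrow> nat \<Rightarrow> 'g" where y: "sequential_fan y" by blast
  have "\<exists>e>0. compactin mtopology (mcball p e)" if p: "p \<in> M" for p
  proof (rule ccontr)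
    assume "\<not> ?thesis"
    then obtain x :: "nat \<Rightarrow> nat \<Rightarrow> 'g" where "metric_fan x"
      using metric_fan_if_not_locally_compact[OF p] by blast
    then show False using no_metric_and_sequential_fan[OF seq _ y] by blast
  qed
  then show ?thesis by (intro disjI2 ballI)
next
  case False
  have "\<exists>r l. strict_mono (r :: nat \<Rightarrow> nat) \<and> limitin mtopology (p \<circ> r) l sequentially" if "\<And>i :: nat. p i \<in> F" for p
    using sequential_fan_if_not_compact_fibre[of p] that False by metis
  then show ?thesis using countable_base_or_sequential_fan_compact False by blast
qed

end

section \<open>Separability of the fibre\<close>

text \<open>A strict well-order of type \<open>\<omega>\<^sub>1\<close> on a subset of
  \<open>P\<close>: a well-order of \<open>P\<close> itself if its initial segments are countable,
  otherwise its restriction below the least element with uncountably many predecessors.\<close>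

lemma omega1_order_exists:
  fixes P :: "'a set"
  assumes "uncountable P"
  obtains W R where "uncountable (W :: 'a set)" "wf R" "trans R" "R \<subseteq> W \<times> W"
    "\<And>a b. a \<in> W \<Longrightarrow> b \<in> W \<Longrightarrow> a \<noteq> b \<Longrightarrow> (a, b) \<in> R \<or> (b, a) \<in> R"
    "\<And>a. countable {b. (b, a) \<in> R}"
proof -
  obtain r where r: "well_order_on P r" using well_order_on by blast
  have wf: "wf (r - Id)" and antisym: "antisym r" and tr: "trans r" and rP: "r \<subseteq> P \<times> P" and tot: "total_on P r"
    using r by (auto simp: well_order_on_def linear_order_on_def partial_order_on_def preorder_on_def refl_on_def)
  have trans: "trans (r - Id)"
    using tr antisym unfolding trans_def antisym_def by blast
  show ?thesis
  proof (cases "\<forall>a. countable {b. (b, a) \<in> r - Id}")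
    case True
    show ?thesis by (rule that[of P "r - Id"]) (use assms wf trans rP tot True in \<open>auto simp: total_on_def\<close>)
  next
    case False
    define Q where "Q = {a. uncountable {b. (b, a) \<in> r - Id}}"
    obtain a where "a \<in> Q" using False unfolding Q_def by blast
    then have "\<exists>a0\<in>Q. \<forall>c. (c, a0) \<in> r - Id \<longrightarrow> c \<notin> Q"
      using wf[unfolded wf_eq_minimal] by blast
    then obtain a0 where "a0 \<in> Q" and min: "\<forall>c. (c, a0) \<in> r - Id \<longrightarrow> c \<notin> Q" by (elim bexE)
    have a0: "uncountable {b. (b, a0) \<in> r - Id}" using \<open>a0 \<in> Q\<close> unfolding Q_def by (rule CollectD)
    have below: "countable {b. (b, c) \<in> r - Id}" if "(c, a0) \<in> r - Id" for c
      using min that unfolding Q_def by blast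
    define W where "W = {b. (b, a0) \<in> r - Id}"
    define R where "R = (r - Id) \<inter> W \<times> W"
    show ?thesis
    proof (rule that[of W R])
      show "uncountable W" using a0 unfolding W_def .
      show "wf R" unfolding R_def using wf by (rule wf_subset) blast
      show "trans R" unfolding R_def using trans unfolding trans_def by blast
      show "R \<subseteq> W \<times> W" unfolding R_def by blast
      show "(a, b) \<in> R \<or> (b, a) \<in> R" if "a \<in> W" "b \<in> W" "a \<noteq> b" for a b
      proof -
        have "a \<in> P" "b \<in> P" using that rP unfolding W_def by auto
        then have "(a, b) \<in> r \<or> (b, a) \<in> r" using tot that(3) unfolding total_on_def by blast
        then show ?thesis using that unfolding R_def by blast
      qed
      show "countable {b. (b, a) \<in> R}" for a
      proof (cases "a \<in> W")
        case True
        then have "countable {b. (b, a) \<in> r - Id}" using below[of a] unfolding W_def by (simp only: mem_Collect_eq)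
        then show ?thesis by (rule countable_subset[rotated]) (auto simp: R_def)
      next
        case False
        then have "{b. (b, a) \<in> R} = {}" unfolding R_def by blast
        then show ?thesis by simp
      qed
    qed
  qed
qed

text \<open>Transfinite recursion: at each stage only countably many values have been chosen, so
  their \<open>Bad\<close> set is countable and cannot exhaust \<open>P\<close>.\<close>

lemma omega1_sequence_avoiding:
  fixes P :: "'a set"
  assumes "uncountable P" and Bad: "\<And>A. A \<subseteq> P \<Longrightarrow> countable A \<Longrightarrow> countable (Bad A)"
  obtains W R and q :: "'a \<Rightarrow> 'a" where "uncountable W" "wf R" "trans R" "R \<subseteq> W \<times> W"
    "\<And>a b. a \<in> W \<Longrightarrow> b \<in> W \<Longrightarrow> a \<noteq> b \<Longrightarrow> (a, b) \<in> R \<or> (b, a) \<in> R"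
    "\<And>a. countable {b. (b, a) \<in> R}"
    "\<And>a. q a \<in> P" "\<And>a. q a \<notin> Bad (q ` {b. (b, a) \<in> R})"
proof -
  obtain W R where WR: "uncountable (W :: 'a set)" "wf R" "trans R" "R \<subseteq> W \<times> W"
    "\<And>a b. a \<in> W \<Longrightarrow> b \<in> W \<Longrightarrow> a \<noteq> b \<Longrightarrow> (a, b) \<in> R \<or> (b, a) \<in> R"
    "\<And>a. countable {b. (b, a) \<in> R}"
    using omega1_order_exists[OF assms(1)] by blast
  have "\<exists>q. \<forall>a. q a \<in> P \<and> q a \<notin> Bad (q ` {b. (b, a) \<in> R})"
  proof (rule dependent_wf_choice[OF WR(2), of "\<lambda>q a s. s \<in> P \<and> s \<notin> Bad (q ` {b. (b, a) \<in> R})"], goal_cases)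
    case (1 f g x r)
    then have "f ` {b. (b, x) \<in> R} = g ` {b. (b, x) \<in> R}" by (intro image_cong) auto
    then show ?case by simp
  next
    case (2 x f)
    then have "countable (Bad (f ` {b. (b, x) \<in> R}))" using WR(6) by (intro Bad) auto
    then have "\<not> P \<subseteq> Bad (f ` {b. (b, x) \<in> R})" using assms(1) countable_subset by blast
    then show ?case by blast
  qed
  then obtain q where "\<And>a. q a \<in> P" "\<And>a. q a \<notin> Bad (q ` {b. (b, a) \<in> R})" by blast
  then show ?thesis using that[OF WR] by blast
qed

text \<open>If every element of \<open>W'\<close> had finitely many predecessors in
  \<open>W'\<close>, counting them would inject \<open>W'\<close> into the naturals.\<close>

lemma omega1_infinite_segment:
  assumes "uncountable W'" "W' \<subseteq> W" "wf R" "trans R"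
    and tot: "\<And>a b. a \<in> W \<Longrightarrow> b \<in> W \<Longrightarrow> a \<noteq> b \<Longrightarrow> (a, b) \<in> R \<or> (b, a) \<in> R"
  obtains a where "a \<in> W'" "infinite {b \<in> W'. (b, a) \<in> R}"
proof (rule ccontr)
  assume contra: "\<not> thesis"
  have fin: "finite {b \<in> W'. (b, a) \<in> R}" if a: "a \<in> W'" for a
    using contra \<open>\<And>a. a \<in> W' \<Longrightarrow> infinite {b \<in> W'. (b, a) \<in> R} \<Longrightarrow> thesis\<close> a by blast
  have less: "card {b \<in> W'. (b, a) \<in> R} < card {b \<in> W'. (b, a') \<in> R}" if "a \<in> W'" "a' \<in> W'" "(a, a') \<in> R" for a a'
  proof (rule psubset_card_mono[OF fin[OF that(2)]])
    have "(a, a) \<notin> R" using assms(3) by simp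
    then show "{b \<in> W'. (b, a) \<in> R} \<subset> {b \<in> W'. (b, a') \<in> R}" using that transD[OF assms(4)] by blast
  qed
  have "inj_on (\<lambda>a. card {b \<in> W'. (b, a) \<in> R}) W'"
  proof (rule inj_onI, rule ccontr)
    fix a a' assume "a \<in> W'" "a' \<in> W'" "card {b \<in> W'. (b, a) \<in> R} = card {b \<in> W'. (b, a') \<in> R}" "a \<noteq> a'"
    then show False using less[of a a'] less[of a' a] tot[of a a'] assms(2) by auto
  qed
  then show False using assms(1) countableI' by blast
qed

lemma compact_range_limit:
  fixes x :: "nat \<Rightarrow> 'a::topological_space"
  assumes "x \<longlonglongrightarrow> l"
  shows "compact (insert l (range x))"
  using compactin_sequence_with_limit[of euclidean x l "range x"] assms by simp

section \<open>Compact sets meet few separated columns\<close>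

context sequential_k_star_group
begin

lemma compact_image: "compactin mtopology S \<Longrightarrow> compact (f ` S)"
  using image_compactin[OF _ cont] by simp

lemma separated_columns_finite:
  assumes K: "compact K" and "\<epsilon> > 0" and P: "P \<subseteq> M" "\<And>p p'. p \<in> P \<Longrightarrow> p' \<in> P \<Longrightarrow> p \<noteq> p' \<Longrightarrow> \<epsilon> \<le> d p p'"
    and z: "\<And>p j. p \<in> P \<Longrightarrow> z p j \<in> Z" "\<And>p j. p \<in> P \<Longrightarrow> d (z p j) p < \<epsilon> / 4"
  shows "finite {p \<in> P. \<exists>j. f (z p j) \<in> K}"
proof -
  let ?C = "mtopology closure_of (Z \<inter> f -` K)"
  have "mtotally_bounded ?C" by (rule compactin_imp_mtotally_bounded[OF subproper[OF K]])
  then obtain N where N: "finite N" "N \<subseteq> ?C" "?C \<subseteq> (\<Union>c\<in>N. mball c (\<epsilon> / 4))"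
    unfolding mtotally_bounded_def by (metis \<open>\<epsilon> > 0\<close> zero_less_divide_iff zero_less_numeral)
  have "\<exists>c\<in>N. d c p < \<epsilon> / 2 \<and> c \<in> M" if p: "p \<in> {p \<in> P. \<exists>j. f (z p j) \<in> K}" for p
  proof -
    obtain j where j: "f (z p j) \<in> K" "p \<in> P" using p by blast
    then have "z p j \<in> ?C" using closure_of_subset[of "Z \<inter> f -` K" mtopology] Z_sub z(1) by auto
    then obtain c where c: "c \<in> N" "c \<in> M" "z p j \<in> M" "d c (z p j) < \<epsilon> / 4" using N(3) by auto
    then have "d c p < \<epsilon> / 2" using triangle[of c "z p j" p] z(2)[OF j(2), of j] P(1) j(2) by fastforce
    then show ?thesis using c by blast
  qed
  then have "\<exists>c. \<forall>p\<in>{p \<in> P. \<exists>j. f (z p j) \<in> K}. c p \<in> N \<and> d (c p) p < \<epsilon> / 2 \<and> c p \<in> M"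
    by (intro bchoice ballI) blast
  then obtain c where c: "\<And>p. p \<in> {p \<in> P. \<exists>j. f (z p j) \<in> K} \<Longrightarrow> c p \<in> N \<and> d (c p) p < \<epsilon> / 2 \<and> c p \<in> M"
    by blast
  have "inj_on c {p \<in> P. \<exists>j. f (z p j) \<in> K}"
  proof (rule inj_onI, rule ccontr)
    fix p p' assume p: "p \<in> {p \<in> P. \<exists>j. f (z p j) \<in> K}" "p' \<in> {p \<in> P. \<exists>j. f (z p j) \<in> K}" "c p = c p'" "p \<noteq> p'"
    have "p \<in> M" "p' \<in> M" "p \<in> P" "p' \<in> P" using p P by auto
    then have "d p p' < \<epsilon>" using triangle''[of p "c p" p'] c[OF p(1)] c[OF p(2)] p(3) by simp
    then show False using P(2)[OF \<open>p \<in> P\<close> \<open>p' \<in> P\<close> p(4)] by simp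
  qed
  moreover have "c ` {p \<in> P. \<exists>j. f (z p j) \<in> K} \<subseteq> N" using c by blast
  ultimately show ?thesis using N(1) finite_imageD finite_subset by blast
qed

end

section \<open>Locally compact \<open>M\<close>: compact pieces and the
  \<open>\<omega>\<^sub>1\<close>-fan\<close>

locale locally_compact_k_star_group = sequential_k_star_group M d f Z
  for M :: "'m set" and d and f :: "'m \<Rightarrow> 'g::{topological_group_add, t2_space}" and Z +
  assumes lc: "\<And>p. p \<in> M \<Longrightarrow> \<exists>e>0. compactin mtopology (mcball p e)"
begin

text \<open>Taking the least admissible exponent, instead of an arbitrary compact ball, keeps the
  radius bounded below near every point.\<close>

definition rad :: "'m \<Rightarrow> real" where
  "rad p = (1/2) ^ (LEAST n. compactin mtopology (mcball p ((1/2) ^ n)))"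

definition piece :: "'m \<Rightarrow> 'g set" where
  "piece p = f ` mcball p (rad p)"

lemma compactin_mcball_le:
  assumes "compactin mtopology (mcball q e)" "mcball p e' \<subseteq> mcball q e"
  shows "compactin mtopology (mcball p e')"
  using closed_compactin[OF assms closedin_mcball] .

lemma compactin_mcball_rad:
  assumes "p \<in> M"
  shows "compactin mtopology (mcball p (rad p))"
proof -
  obtain e where e: "e > 0" "compactin mtopology (mcball p e)" using lc assms by blast
  obtain n where "(1/2::real) ^ n < e" using real_arch_pow_inv[OF e(1), of "1/2"] by auto
  then have "compactin mtopology (mcball p ((1/2) ^ n))"
    by (intro compactin_mcball_le[OF e(2)] mcball_subset_concentric) simp
  then show ?thesis unfolding rad_def by (rule LeastI)
qed

text \<open>Half of the radius at \<open>q\<close> is spent on moving the centre. Consequently,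
  points of a sequence converging to \<open>q\<close> eventually lie in each other's balls.\<close>

lemma rad_near:
  assumes q: "q \<in> M"
  obtains \<delta> where "\<delta> > 0" "\<And>c. c \<in> M \<Longrightarrow> d c q < \<delta> \<Longrightarrow> \<delta> \<le> rad c"
proof -
  define n where "n = (LEAST n. compactin mtopology (mcball q ((1/2) ^ n)))"
  have n: "compactin mtopology (mcball q ((1/2) ^ n))"
    using compactin_mcball_rad[OF q] unfolding rad_def n_def .
  show ?thesis
  proof (rule that[of "(1/2) ^ Suc n"])
    fix c assume c: "c \<in> M" "d c q < (1/2) ^ Suc n"
    have "compactin mtopology (mcball c ((1/2) ^ Suc n))"
      by (rule compactin_mcball_le[OF n], rule mcball_subset) (use c q in auto)
    then have "(LEAST n. compactin mtopology (mcball c ((1/2) ^ n))) \<le> Suc n" by (rule Least_le)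
    then show "(1/2) ^ Suc n \<le> rad c" unfolding rad_def by (intro power_decreasing) auto
  qed simp
qed

lemma compact_piece: "p \<in> M \<Longrightarrow> compact (piece p)"
  unfolding piece_def by (intro compact_image compactin_mcball_rad)

text \<open>An uncountable separated part of the fibre would yield an \<open>\<omega>\<^sub>1\<close>-fan. Choosing its columns
  \<open>Y a\<close> along \<open>\<omega>\<^sub>1\<close> independently enough, the set of all \<open>Y a n + Y b n\<close> with \<open>b < a\<close> and
  \<open>n = e\<^sub>a b\<close>, for injections \<open>e\<^sub>a\<close> of initial segments into the naturals, is closed but
  accumulates at \<open>0\<close>.\<close>

lemma separated_fibre_countable:
  assumes P: "P \<subseteq> F" "\<And>p p'. p \<in> P \<Longrightarrow> p' \<in> P \<Longrightarrow> p \<noteq> p' \<Longrightarrow> \<epsilon> \<le> d p p'" and "\<epsilon> > 0"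
  shows "countable P"
proof (rule ccontr)
  assume unc: "uncountable P"
  have PM: "P \<subseteq> M" using P(1) unfolding F_def by blast
  \<comment> \<open>The bound \<open>\<epsilon> / 4\<close> serves
    \<open>separated_columns_finite\<close>, the bound \<open>1 / Suc j\<close> makes the column
    converge to \<open>p\<close>; outside \<open>P\<close> the value is arbitrary.\<close>
  have "\<exists>z\<in>Z. p \<in> P \<longrightarrow> d z p < min (\<epsilon> / 4) (1 / Suc j)" for p and j :: nat
  proof (cases "p \<in> P")
    case True
    then show ?thesis using dense_approximation[of p "min (\<epsilon> / 4) (1 / Suc j)"] \<open>\<epsilon> > 0\<close> PM by (auto simp: subset_iff)
  qed (use sec_Z in blast)
  then have "\<exists>z. \<forall>p j. z p j \<in> Z \<and> (p \<in> P \<longrightarrow> d (z p j) p < min (\<epsilon> / 4) (1 / Suc j))"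
    by (intro choice allI) blast
  then obtain z :: "'m \<Rightarrow> nat \<Rightarrow> 'm" where z: "\<And>p j. z p j \<in> Z" "\<And>p j. p \<in> P \<Longrightarrow> d (z p j) p < \<epsilon> / 4"
      "\<And>p j. p \<in> P \<Longrightarrow> d (z p j) p < 1 / Suc j" by fastforce
  have zM: "z p j \<in> M" for p j using z(1) Z_sub by blast
  define y where "y p j = f (z p j)" for p j
  have y0: "y p \<longlonglongrightarrow> 0" if "p \<in> P" for p
  proof -
    have "p \<in> M" "f p = 0" using that P(1) unfolding F_def by auto
    have "limitin mtopology (\<lambda>j. p) p sequentially" using \<open>p \<in> M\<close> by simp
    then have "limitin mtopology (z p) p sequentially"
      by (rule close_limit) (use zM z(3)[OF that] inverse_Suc_limit in auto)
    then show ?thesis using limit_f[of "z p" p] \<open>f p = 0\<close> by (simp add: y_def[abs_def])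
  qed
  have columns_finite: "finite {p \<in> P. \<exists>j. y p j \<in> K}" if "compact K" for K
    unfolding y_def by (rule separated_columns_finite[OF that \<open>\<epsilon> > 0\<close> PM]) (use P(2) z in auto)
  \<comment> \<open>Compact sets that a later column must miss: the points \<open>- y c l\<close>,
    so that no sum is 0, and pieces about sums of two earlier columns, shifted by
    \<open>- y c l\<close>, so that a sum with one later column avoids these pieces. There are
    countably many for countable \<open>A\<close>, and each meets finitely many columns.\<close>
  define Cs where "Cs A = (\<lambda>(c, l). {- y c l}) ` (A \<times> UNIV) \<union>
     (\<lambda>((a, i), (b, k), (c, l)). (\<lambda>h. h - y c l) ` piece (sec (y a i + y b k))) `
       ((A \<times> UNIV) \<times> (A \<times> UNIV) \<times> (A \<times> UNIV))" for A
  define Bad where "Bad A = A \<union> (\<Union>C\<in>Cs A. {p \<in> P. \<exists>j. y p j \<in> C})" for A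
  have "countable (Bad A)" if "A \<subseteq> P" "countable A" for A
  proof -
    have cnt: "countable (Cs A)" unfolding Cs_def using that(2) by simp
    have "compact C" if C: "C \<in> Cs A" for C
    proof -
      have "compact ((\<lambda>h. h - y c l) ` piece (sec (y a i + y b k)))" for a i b k c l
        by (intro compact_continuous_image compact_piece continuous_intros) simp
      then show ?thesis using C unfolding Cs_def by auto
    qed
    then have "countable {p \<in> P. \<exists>j. y p j \<in> C}" if "C \<in> Cs A" for C
      using columns_finite that countable_finite by blast
    then show ?thesis unfolding Bad_def using that(2) cnt by (intro countable_Un countable_UN) auto
  qed
  then obtain W R q where W: "uncountable (W :: 'm set)" "wf R" "trans R" "R \<subseteq> W \<times> W"
    "\<And>a b. a \<in> W \<Longrightarrow> b \<in> W \<Longrightarrow> a \<noteq> b \<Longrightarrow> (a, b) \<in> R \<or> (b, a) \<in> R"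
    "\<And>a. countable {b. (b, a) \<in> R}" and q: "\<And>a. q a \<in> P" "\<And>a. q a \<notin> Bad (q ` {b. (b, a) \<in> R})"
    using omega1_sequence_avoiding[OF unc, of Bad] by blast
  define Y where "Y a = y (q a)" for a
  have Y0: "Y a \<longlonglongrightarrow> 0" for a unfolding Y_def using y0 q(1) by blast
  have q_inj: "q a \<noteq> q b" if "(b, a) \<in> R" for a b
    using q(2)[of a] that unfolding Bad_def by blast
  have notC: "Y a j \<notin> C" if "C \<in> Cs (q ` {b. (b, a) \<in> R})" for a j C
    using q[of a] that unfolding Bad_def Y_def by blast
  have Y_nonzero: "Y a i + Y b k \<noteq> 0" if "(b, a) \<in> R" for a b i k
  proof
    assume "Y a i + Y b k = 0"
    then have "Y a i \<in> {- y (q b) k}" unfolding Y_def by (simp add: eq_neg_iff_add_eq_0)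
    moreover have "{- y (q b) k} \<in> Cs (q ` {b. (b, a) \<in> R})" using that unfolding Cs_def by blast
    ultimately show False using notC by blast
  qed
  have Y_piece: "Y a j + Y b l \<notin> piece (sec (Y c i + Y c' k))"
    if "(b, a) \<in> R" "(c, a) \<in> R" "(c', a) \<in> R" for a b c c' i j k l
  proof
    assume "Y a j + Y b l \<in> piece (sec (Y c i + Y c' k))"
    then have "Y a j \<in> (\<lambda>h. h - y (q b) l) ` piece (sec (y (q c) i + y (q c') k))"
      unfolding Y_def by (rule rev_image_eqI) simp
    moreover have "(\<lambda>h. h - y (q b) l) ` piece (sec (y (q c) i + y (q c') k)) \<in> Cs (q ` {b. (b, a) \<in> R})"
      using that unfolding Cs_def by (intro UnI2 image_eqI[of _ _ "((q c, i), (q c', k), (q b, l))"]) auto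
    ultimately show False using notC by blast
  qed
  define e where "e a = to_nat_on {b. (b, a) \<in> R}" for a
  have e_inj: "b = b'" if "e a b = e a b'" "(b, a) \<in> R" "(b', a) \<in> R" for a b b'
    using inj_on_to_nat_on[OF W(6), of a] that unfolding e_def inj_on_def by blast
  define A where "A = {Y a (e a b) + Y b (e a b) | a b. (b, a) \<in> R}"
  have "closed A"
  proof (rule seq)
    fix \<sigma> l assume \<sigma>: "range \<sigma> \<subseteq> A" "\<sigma> \<longlonglongrightarrow> l"
    have "\<forall>m. \<exists>a b. \<sigma> m = Y a (e a b) + Y b (e a b) \<and> (b, a) \<in> R" using \<sigma>(1) unfolding A_def by blast
    then obtain a b where ab: "\<And>m. \<sigma> m = Y (a m) (e (a m) (b m)) + Y (b m) (e (a m) (b m))" "\<And>m. (b m, a m) \<in> R"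
      by metis
    have "(\<lambda>m. f (sec (\<sigma> m))) \<longlonglongrightarrow> l" using \<sigma>(2) by simp
    then obtain r :: "nat \<Rightarrow> nat" and p where r: "strict_mono r"
        and lim: "limitin mtopology ((\<lambda>m. sec (\<sigma> m)) \<circ> r) p sequentially" and p: "p \<in> M" "f p = l"
      by (rule convergent_subsequence[OF sec_Z])
    obtain \<delta> where \<delta>: "\<delta> > 0" "\<And>c. c \<in> M \<Longrightarrow> d c p < \<delta> \<Longrightarrow> \<delta> \<le> rad c" using rad_near[OF p(1)] by blast
    have "\<forall>\<^sub>F m in sequentially. sec (\<sigma> (r m)) \<in> M \<and> d (sec (\<sigma> (r m))) p < \<delta> / 2"
      using lim half_gt_zero[OF \<delta>(1)] unfolding limitin_dist o_def by blast
    then obtain N where N: "\<And>m. m \<ge> N \<Longrightarrow> d (sec (\<sigma> (r m))) p < \<delta> / 2"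
      unfolding eventually_sequentially by blast
    \<comment> \<open>Let \<open>a (r m0)\<close> be minimal among the leading indices of the tail.
      The tail lies in the piece about \<open>\<sigma> (r m0)\<close>, while a sum with a later
      leading index avoids that piece; so the leading index is constant.\<close>
    have "a (r N) \<in> (\<lambda>m. a (r m)) ` {N..}" by simp
    then have "\<exists>\<alpha>\<in>(\<lambda>m. a (r m)) ` {N..}. \<forall>\<beta>. (\<beta>, \<alpha>) \<in> R \<longrightarrow> \<beta> \<notin> (\<lambda>m. a (r m)) ` {N..}"
      using W(2)[unfolded wf_eq_minimal] by blast
    then obtain m0 where m0: "m0 \<ge> N" "\<And>m. m \<ge> N \<Longrightarrow> (a (r m), a (r m0)) \<notin> R" by auto
    have const: "a (r m) = a (r m0)" if "m \<ge> N" for m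
    proof (rule ccontr)
      assume "a (r m) \<noteq> a (r m0)"
      moreover have "a (r m) \<in> W" "a (r m0) \<in> W" using ab(2) W(4) by blast+
      ultimately have less: "(a (r m0), a (r m)) \<in> R" using W(5) m0(2)[OF that] by blast
      have "d (sec (\<sigma> (r m0))) (sec (\<sigma> (r m))) < \<delta>"
        using triangle[of "sec (\<sigma> (r m0))" p "sec (\<sigma> (r m))"] N[OF that] N[OF m0(1)] p(1) by (simp add: commute)
      also have "\<delta> \<le> rad (sec (\<sigma> (r m0)))" using \<delta>(1) N[OF m0(1)] by (intro \<delta>(2)) auto
      finally have "f (sec (\<sigma> (r m))) \<in> piece (sec (\<sigma> (r m0)))" unfolding piece_def by (intro imageI) simp
      then have "\<sigma> (r m) \<in> piece (sec (\<sigma> (r m0)))" by simp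
      moreover have "(b (r m0), a (r m)) \<in> R" using transD[OF W(3) ab(2) less] .
      ultimately show False using Y_piece[OF ab(2) less] ab(1) by metis
    qed
    define \<alpha> where "\<alpha> = a (r m0)"
    define \<beta> where "\<beta> m = b (r (m + N))" for m
    define \<tau> where "\<tau> m = \<sigma> (r (m + N))" for m
    have \<beta>: "(\<beta> m, \<alpha>) \<in> R" for m using ab(2)[of "r (m + N)"] const[of "m + N"] by (simp add: \<alpha>_def \<beta>_def)
    have \<tau>: "\<tau> m = Y \<alpha> (e \<alpha> (\<beta> m)) + Y (\<beta> m) (e \<alpha> (\<beta> m))" for m
      using ab(1)[of "r (m + N)"] const[of "m + N"] by (simp add: \<alpha>_def \<beta>_def \<tau>_def)
    have \<tau>A: "\<tau> m \<in> A" for m using \<sigma>(1) unfolding \<tau>_def by auto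
    have \<tau>l: "\<tau> \<longlonglongrightarrow> l"
      unfolding \<tau>_def using LIMSEQ_ignore_initial_segment[OF LIMSEQ_subseq_LIMSEQ[OF \<sigma>(2) r], of N] by (simp add: o_def)
    show "l \<in> A"
    proof (rule nat_subseq_const_or_strict_mono[of "\<lambda>m. e \<alpha> (\<beta> m)"])
      fix s :: "nat \<Rightarrow> nat" and c assume s: "strict_mono s" "\<And>m. e \<alpha> (\<beta> (s m)) = c"
      have \<beta>s: "\<beta> (s m) = \<beta> (s 0)" for m using e_inj[OF _ \<beta> \<beta>] s(2) by simp
      have "(\<tau> \<circ> s) m = \<tau> (s 0)" for m using \<beta>s[of m] by (simp add: \<tau>)
      then have "\<tau> \<circ> s = (\<lambda>m. \<tau> (s 0))" by (rule ext)
      then have "l = \<tau> (s 0)" using LIMSEQ_subseq_LIMSEQ[OF \<tau>l s(1)] by (simp add: LIMSEQ_const_iff)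
      then show ?thesis using \<tau>A by simp
    next
      fix s :: "nat \<Rightarrow> nat" assume s: "strict_mono s" "strict_mono ((\<lambda>m. e \<alpha> (\<beta> m)) \<circ> s)"
      have "(\<lambda>m. Y \<alpha> (e \<alpha> (\<beta> (s m)))) \<longlonglongrightarrow> 0"
        using LIMSEQ_subseq_LIMSEQ[OF Y0[of \<alpha>] s(2)] by (simp add: o_def)
      moreover have "(\<lambda>m. \<tau> (s m)) \<longlonglongrightarrow> l" using LIMSEQ_subseq_LIMSEQ[OF \<tau>l s(1)] by (simp add: o_def)
      ultimately have "(\<lambda>m. - Y \<alpha> (e \<alpha> (\<beta> (s m))) + \<tau> (s m)) \<longlonglongrightarrow> - 0 + l" by (intro tendsto_intros)
      then have "(\<lambda>m. Y (\<beta> (s m)) (e \<alpha> (\<beta> (s m)))) \<longlonglongrightarrow> l" by (simp add: \<tau> add.assoc[symmetric])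
      \<comment> \<open>A convergent sequence with its limit is compact, hence meets finitely many
        columns, but the columns \<open>q (\<beta> (s m))\<close> are pairwise distinct.\<close>
      then have "finite {p \<in> P. \<exists>j. y p j \<in> insert l (range (\<lambda>m. Y (\<beta> (s m)) (e \<alpha> (\<beta> (s m)))))}"
        by (intro columns_finite compact_range_limit)
      moreover have "range (\<lambda>m. q (\<beta> (s m))) \<subseteq> {p \<in> P. \<exists>j. y p j \<in> insert l (range (\<lambda>m. Y (\<beta> (s m)) (e \<alpha> (\<beta> (s m)))))}"
        using q(1) unfolding Y_def by blast
      moreover have "inj (\<lambda>m. q (\<beta> (s m)))"
      proof (rule injI)
        fix m m' assume "q (\<beta> (s m)) = q (\<beta> (s m'))"
        then have "\<beta> (s m) = \<beta> (s m')" using q_inj W(4,5) \<beta> by (metis SigmaD1 subsetD)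
        then have "e \<alpha> (\<beta> (s m)) = e \<alpha> (\<beta> (s m'))" by simp
        then show "m = m'" using strict_mono_eq[OF s(2)] by simp
      qed
      ultimately show ?thesis using finite_subset range_inj_infinite by blast
    qed
  qed
  moreover have "0 \<in> closure A"
    unfolding closure_iff_nhds_not_empty
  proof (intro allI impI)
    fix S V :: "'g set" assume "V \<subseteq> S" "open V" "0 \<in> V"
    then obtain U where U: "open U" "0 \<in> U" "\<And>a b. a \<in> U \<Longrightarrow> b \<in> U \<Longrightarrow> a + b \<in> V"
      using zero_nbhd_add by metis
    \<comment> \<open>Uncountably many columns enter \<open>U\<close> from a common index
      \<open>n\<close> on. One of these, \<open>a\<close>, has infinitely many of the others before
      it, so the injection \<open>e a\<close> reaches a value of at least \<open>n\<close> on
      them.\<close>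
    define Wn where "Wn n = {a \<in> W. \<forall>j\<ge>n. Y a j \<in> U}" for n
    have "W = (\<Union>n. Wn n)"
      using topological_tendstoD[OF Y0 U(1,2)] unfolding Wn_def eventually_sequentially by blast
    then obtain n where n: "uncountable (Wn n)" using W(1) by (metis countable_UN countableI_type)
    obtain a where a: "a \<in> Wn n" "infinite {b \<in> Wn n. (b, a) \<in> R}"
      using omega1_infinite_segment[OF n _ W(2,3), of W] W(5) unfolding Wn_def by blast
    have "inj_on (e a) {b \<in> Wn n. (b, a) \<in> R}" using e_inj by (intro inj_onI) blast
    then have "infinite (e a ` {b \<in> Wn n. (b, a) \<in> R})" using a(2) finite_imageD by blast
    then obtain b where b: "b \<in> Wn n" "(b, a) \<in> R" "e a b \<ge> n"
      unfolding infinite_nat_iff_unbounded_le by blast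
    then have "Y a (e a b) + Y b (e a b) \<in> V" using U(3) a(1) unfolding Wn_def by blast
    then have "Y a (e a b) + Y b (e a b) \<in> A \<inter> S" using b(2) \<open>V \<subseteq> S\<close> unfolding A_def by blast
    then show "A \<inter> S \<noteq> {}" by blast
  qed
  moreover have "0 \<notin> A" unfolding A_def using Y_nonzero by force
  ultimately show False by simp
qed

end

section \<open>The open \<open>k\<^sub>\<omega>\<close>-subgroup\<close>

text \<open>A maximal \<open>\<epsilon>\<close>-separated subset is an
  \<open>\<epsilon>\<close>-net, for otherwise a point could be added; the union over
  \<open>\<epsilon> = 1 / Suc n\<close> is dense.\<close>

lemma (in Metric_space) countable_dense_if_separated_countable:
  assumes E: "E \<subseteq> M"
    and sep: "\<And>P \<epsilon>. P \<subseteq> E \<Longrightarrow> \<epsilon> > 0 \<Longrightarrow> (\<And>p p'. p \<in> P \<Longrightarrow> p' \<in> P \<Longrightarrow> p \<noteq> p' \<Longrightarrow> \<epsilon> \<le> d p p') \<Longrightarrow> countable P"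
  shows "\<exists>D. countable D \<and> D \<subseteq> E \<and> (\<forall>p e. p \<in> E \<and> e > 0 \<longrightarrow> (\<exists>c\<in>D. d c p < e))"
proof -
  have ex: "\<exists>P. countable P \<and> P \<subseteq> E \<and> (\<forall>p\<in>E. \<exists>c\<in>P. d c p < \<epsilon>)" if "\<epsilon> > 0" for \<epsilon>
  proof -
    let ?\<A> = "{P. P \<subseteq> E \<and> (\<forall>p\<in>P. \<forall>p'\<in>P. p \<noteq> p' \<longrightarrow> \<epsilon> \<le> d p p')}"
    have "\<exists>P\<in>?\<A>. \<forall>X\<in>?\<A>. P \<subseteq> X \<longrightarrow> X = P"
    proof (rule Zorn_Lemma, rule ballI)
      fix C assume C: "C \<in> chains ?\<A>"
      show "\<Union>C \<in> ?\<A>"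
      proof -
        have "\<epsilon> \<le> d p p'" if pp: "p \<in> X" "X \<in> C" "p' \<in> X'" "X' \<in> C" "p \<noteq> p'" for p p' X X'
        proof -
          have "X \<subseteq> X' \<or> X' \<subseteq> X" using C pp unfolding chains_def chain_subset_def by blast
          moreover have "X \<in> ?\<A>" "X' \<in> ?\<A>" using C pp unfolding chains_def by blast+
          ultimately show ?thesis using pp by blast
        qed
        moreover have "\<Union>C \<subseteq> E" using C unfolding chains_def by blast
        ultimately show ?thesis by blast
      qed
    qed
    then obtain P where "P \<in> ?\<A>" and max: "\<forall>X\<in>?\<A>. P \<subseteq> X \<longrightarrow> X = P" by (elim bexE)
    then have P: "P \<subseteq> E" "\<And>p p'. p \<in> P \<Longrightarrow> p' \<in> P \<Longrightarrow> p \<noteq> p' \<Longrightarrow> \<epsilon> \<le> d p p'" by blast+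
    have "\<exists>c\<in>P. d c p < \<epsilon>" if p: "p \<in> E" for p
    proof (rule ccontr)
      assume far: "\<not> ?thesis"
      have "d p p < \<epsilon>" using p E \<open>\<epsilon> > 0\<close> by (simp add: subset_iff)
      then have "p \<notin> P" using far by blast
      have far': "\<epsilon> \<le> d c p" "\<epsilon> \<le> d p c" if "c \<in> P" for c
        using far that commute[of p c] by (simp_all add: not_less)
      have "\<epsilon> \<le> d a b" if "a \<in> insert p P" "b \<in> insert p P" "a \<noteq> b" for a b
        using that P(2)[of a b] far'(1)[of a] far'(2)[of b] by auto
      moreover have "insert p P \<subseteq> E" using P(1) p by blast
      ultimately have "insert p P \<in> ?\<A>" by blast
      then have "insert p P = P" using subset_insertI[of P p] by (rule max[rule_format])
      then show False using \<open>p \<notin> P\<close> by blast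
    qed
    then show ?thesis using P sep[OF P(1) \<open>\<epsilon> > 0\<close>] by blast
  qed
  have "\<forall>n. \<exists>P. countable P \<and> P \<subseteq> E \<and> (\<forall>p\<in>E. \<exists>c\<in>P. d c p < 1 / Suc n)"
    by (intro allI ex) simp
  then obtain P where P: "\<forall>n. countable (P n) \<and> P n \<subseteq> E \<and> (\<forall>p\<in>E. \<exists>c\<in>P n. d c p < 1 / Suc n)"
    by (rule choice[THEN exE])
  show ?thesis
  proof (intro exI[of _ "\<Union>n. P n"] conjI allI impI)
    show "countable (\<Union>n. P n)" "(\<Union>n. P n) \<subseteq> E" using P by auto
    fix p and e :: real assume "p \<in> E \<and> e > 0"
    then have "p \<in> E" "e > 0" by auto
    then obtain n where "1 / real (Suc n) < e" using nat_approx_posE by blast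
    moreover obtain c where "c \<in> P n" "d c p < 1 / Suc n" using P \<open>p \<in> E\<close> by blast
    ultimately show "\<exists>c\<in>\<Union>n. P n. d c p < e" by (intro bexI[of _ c]) auto
  qed
qed

section \<open>Filtrations by compact sets and countable k-networks\<close>

lemma compact_group_sum:
  fixes S T :: "'g::topological_group_add set"
  assumes "compact S" "compact T"
  shows "compact {s + t | s t. s \<in> S \<and> t \<in> T}"
proof -
  have "{s + t | s t. s \<in> S \<and> t \<in> T} = (\<lambda>p. fst p + snd p) ` (S \<times> T)" by force
  also have "compact \<dots>"
    by (intro compact_continuous_image compact_Times assms continuous_intros)
  finally show ?thesis .
qed

text \<open>The last clause tests closedness in the whole group rather than in \<open>H\<close>; for
  \<open>A = H\<close> it says that \<open>H\<close> is closed.\<close>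

definition k_omega_filtration :: "'g::topological_group_add set \<Rightarrow> (nat \<Rightarrow> 'g set) \<Rightarrow> bool" where
  "k_omega_filtration H S \<longleftrightarrow> open H \<and> add_subgroup H \<and> (\<forall>n. compact (S n)) \<and> (\<forall>n. S n \<subseteq> S (Suc n)) \<and>
     (\<Union>n. S n) = H \<and> (\<forall>A\<subseteq>H. (\<forall>n. closed (A \<inter> S n)) \<longrightarrow> closed A)"

definition countable_k_network_on :: "'a::topological_space set \<Rightarrow> 'a set set \<Rightarrow> bool" where
  "countable_k_network_on H \<N> \<longleftrightarrow> countable \<N> \<and> (\<forall>N\<in>\<N>. N \<subseteq> H) \<and>
    (\<forall>U K. open U \<and> compact K \<and> K \<subseteq> U \<inter> H \<longrightarrow> (\<exists>\<F>. finite \<F> \<and> \<F> \<subseteq> \<N> \<and> K \<subseteq> \<Union>\<F> \<and> \<Union>\<F> \<subseteq> U))"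

lemma (in sequential_k_star_group) countable_k_network_on_filtration:
  assumes H: "k_omega_filtration (H :: 'g set) S"
  obtains \<N> where "countable_k_network_on H \<N>"
proof -
  define T where "T = Z \<inter> f -` H"
  have comp: "compact (S n)" and HS: "H = (\<Union>n. S n)" for n using H unfolding k_omega_filtration_def by auto
  have TM: "T \<subseteq> M" using Z_sub unfolding T_def by blast
  have "\<exists>D. countable D \<and> D \<subseteq> T \<and> (\<forall>p e. p \<in> T \<and> e > 0 \<longrightarrow> (\<exists>c\<in>D. d c p < e))"
  proof (rule countable_dense_if_separated_countable[OF TM])
    fix P and \<epsilon> :: real assume P: "P \<subseteq> T" "\<epsilon> > 0" "\<And>p p'. p \<in> P \<Longrightarrow> p' \<in> P \<Longrightarrow> p \<noteq> p' \<Longrightarrow> \<epsilon> \<le> d p p'"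
    \<comment> \<open>Degenerate columns \<open>z p j = p\<close>; the vacuous quantifier matches
      the form of \<open>separated_columns_finite\<close>.\<close>
    have "finite {p \<in> P. \<exists>j :: nat. f p \<in> S n}" for n
    proof (rule separated_columns_finite[OF comp P(2)])
      show "d p p < \<epsilon> / 4" if "p \<in> P" for p using that P(1,2) TM by (simp add: subset_iff)
    qed (use P TM in \<open>auto simp: T_def\<close>)
    then have "countable (\<Union>n. {p \<in> P. \<exists>j :: nat. f p \<in> S n})" by (auto intro: countable_finite)
    moreover have "P \<subseteq> (\<Union>n. {p \<in> P. \<exists>j :: nat. f p \<in> S n})" using P(1) HS unfolding T_def by auto
    ultimately show "countable P" using countable_subset by blast
  qed
  then obtain D where D': "countable D \<and> D \<subseteq> T \<and> (\<forall>p e. p \<in> T \<and> e > 0 \<longrightarrow> (\<exists>c\<in>D. d c p < e))"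
    by (rule exE)
  then have D: "countable D" "D \<subseteq> T" "\<And>p e. p \<in> T \<Longrightarrow> e > 0 \<Longrightarrow> \<exists>c\<in>D. d c p < e"
    by simp_all
  define \<N> where "\<N> = (\<lambda>(c, k). f ` (mball c (1 / Suc k) \<inter> T)) ` (D \<times> (UNIV :: nat set))"
  have "countable_k_network_on H \<N>"
    unfolding countable_k_network_on_def
  proof (intro conjI allI impI ballI)
    show "countable \<N>" unfolding \<N>_def using D(1) by simp
    show "N \<subseteq> H" if "N \<in> \<N>" for N using that unfolding \<N>_def T_def by auto
    fix U K assume UK: "open U \<and> compact K \<and> K \<subseteq> U \<inter> H"
    let ?C = "mtopology closure_of (Z \<inter> f -` K)"
    have sub: "Z \<inter> f -` K \<subseteq> M" "Z \<inter> f -` K \<subseteq> T" using Z_sub UK unfolding T_def by auto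
    have C: "compactin mtopology ?C" using UK by (intro subproper) simp
    have fU: "openin mtopology {x \<in> M. f x \<in> U}"
      using openin_continuous_map_preimage[OF cont, of U] UK by simp
    have "closedin mtopology {x \<in> M. f x \<in> K}"
      using closedin_continuous_map_preimage[OF cont, of K] UK compact_imp_closed[of K] by simp
    then have CK: "?C \<subseteq> {x \<in> M. f x \<in> K}" using sub(1) by (intro closure_of_minimal) auto
    define \<B> where "\<B> = {(c, k) \<in> D \<times> (UNIV :: nat set). mball c (1 / Suc k) \<subseteq> {x \<in> M. f x \<in> U}}"
    have "?C \<subseteq> \<Union>((\<lambda>(c, k). mball c (1 / Suc k)) ` \<B>)"
    proof
      fix p assume p: "p \<in> ?C"
      then have "p \<in> M" "p \<in> {x \<in> M. f x \<in> U}" using CK UK by auto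
      then obtain e where e: "e > 0" "mball p e \<subseteq> {x \<in> M. f x \<in> U}" using fU unfolding openin_mtopology by blast
      obtain k where k: "1 / real (Suc k) < e / 2" using nat_approx_posE[of "e / 2"] e(1) by auto
      \<comment> \<open>\<open>p\<close> need not lie in \<open>T\<close>, so \<open>D\<close> is
        reached in two steps of \<open>1 / (2 * Suc k)\<close>, from \<open>p\<close> to
        \<open>T\<close> and from there to \<open>D\<close>.\<close>
      have "\<exists>z\<in>Z \<inter> f -` K. z \<in> mball p (1 / (2 * Suc k))"
        using p unfolding metric_closure_of by simp
      then obtain z where z: "z \<in> T" "z \<in> M" "d p z < 1 / (2 * Suc k)" using sub by auto
      obtain c where c: "c \<in> D" "d c z < 1 / (2 * Suc k)" using D(3)[OF z(1), of "1 / (2 * Suc k)"] by auto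
      have cM: "c \<in> M" using c D(2) TM by blast
      have "d c p < 1 / (2 * Suc k) + 1 / (2 * Suc k)"
        using triangle[of c z p] z c cM \<open>p \<in> M\<close> commute[of p z] by simp
      also have "\<dots> = 1 / Suc k" by (simp add: field_simps)
      finally have dcp: "d c p < 1 / Suc k" .
      have "mball c (1 / Suc k) \<subseteq> mball p e"
        using dcp k \<open>p \<in> M\<close> by (intro mball_subset) auto
      then have "(c, k) \<in> \<B>" using e(2) c(1) unfolding \<B>_def by blast
      moreover have "p \<in> mball c (1 / Suc k)" using dcp cM \<open>p \<in> M\<close> by simp
      ultimately show "p \<in> \<Union>((\<lambda>(c, k). mball c (1 / Suc k)) ` \<B>)" by blast
    qed
    moreover have "openin mtopology V" if "V \<in> (\<lambda>(c, k). mball c (1 / Suc k)) ` \<B>" for V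
      using that by auto
    ultimately obtain \<F>' where \<F>': "finite \<F>'" "\<F>' \<subseteq> (\<lambda>(c, k). mball c (1 / Suc k)) ` \<B>" "?C \<subseteq> \<Union>\<F>'"
      using compactinD[OF C, of "(\<lambda>(c, k). mball c (1 / Suc k)) ` \<B>"] by meson
    then obtain I where I: "finite I" "I \<subseteq> \<B>" "\<F>' = (\<lambda>(c, k). mball c (1 / Suc k)) ` I"
      using finite_subset_image[OF \<F>'(1,2)] by metis
    show "\<exists>\<F>. finite \<F> \<and> \<F> \<subseteq> \<N> \<and> K \<subseteq> \<Union>\<F> \<and> \<Union>\<F> \<subseteq> U"
    proof (intro exI[of _ "(\<lambda>(c, k). f ` (mball c (1 / Suc k) \<inter> T)) ` I"] conjI)
      show "finite ((\<lambda>(c, k). f ` (mball c (1 / Suc k) \<inter> T)) ` I)" using I(1) by simp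
      show "(\<lambda>(c, k). f ` (mball c (1 / Suc k) \<inter> T)) ` I \<subseteq> \<N>" using I(2) unfolding \<N>_def \<B>_def by blast
      show "\<Union>((\<lambda>(c, k). f ` (mball c (1 / Suc k) \<inter> T)) ` I) \<subseteq> U" using I(2) unfolding \<B>_def by blast
      show "K \<subseteq> \<Union>((\<lambda>(c, k). f ` (mball c (1 / Suc k) \<inter> T)) ` I)"
      proof
        fix x assume "x \<in> K"
        then have "sec x \<in> Z \<inter> f -` K" by simp
        then have "sec x \<in> ?C" "sec x \<in> T" using closure_of_subset[of "Z \<inter> f -` K" mtopology] sub by auto
        then obtain c k where "(c, k) \<in> I" "sec x \<in> mball c (1 / Suc k)" using \<F>'(3) I(3) by blast
        then have "f (sec x) \<in> \<Union>((\<lambda>(c, k). f ` (mball c (1 / Suc k) \<inter> T)) ` I)" using \<open>sec x \<in> T\<close> by blast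
        then show "x \<in> \<Union>((\<lambda>(c, k). f ` (mball c (1 / Suc k) \<inter> T)) ` I)" by simp
      qed
    qed
  qed
  then show ?thesis by (rule that)
qed

section \<open>Generation of the open subgroup by compact pieces\<close>

context locally_compact_k_star_group
begin

text \<open>The centres are dense in the fibre. Lifts of a null sequence have a subsequence
  converging to some \<open>q\<close> in the fibre, and a centre close enough to \<open>q\<close>
  has a radius that still covers a neighbourhood of \<open>q\<close>.\<close>

lemma countable_pieces:
  "\<exists>c :: nat \<Rightarrow> 'm. (\<forall>i. c i \<in> M) \<and>
     (\<forall>x :: nat \<Rightarrow> 'g. x \<longlonglongrightarrow> 0 \<longrightarrow> (\<exists>i. infinite {m. x m \<in> piece (c i)}))"
proof -
  have FM: "F \<subseteq> M" unfolding F_def by blast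
  have "\<exists>D. countable D \<and> D \<subseteq> F \<and> (\<forall>p e. p \<in> F \<and> e > 0 \<longrightarrow> (\<exists>c\<in>D. d c p < e))"
  proof (rule countable_dense_if_separated_countable[OF FM])
    fix P and \<epsilon> :: real assume P: "P \<subseteq> F" "\<epsilon> > 0" "\<And>p p'. p \<in> P \<Longrightarrow> p' \<in> P \<Longrightarrow> p \<noteq> p' \<Longrightarrow> \<epsilon> \<le> d p p'"
    show "countable P" by (rule separated_fibre_countable[OF P(1,3,2)])
  qed
  then obtain D where D': "countable D \<and> D \<subseteq> F \<and> (\<forall>p e. p \<in> F \<and> e > 0 \<longrightarrow> (\<exists>c\<in>D. d c p < e))"
    by (rule exE)
  then have D: "countable D" "D \<subseteq> F" "\<And>p e. p \<in> F \<Longrightarrow> e > 0 \<Longrightarrow> \<exists>c\<in>D. d c p < e"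
    by simp_all
  have "sec 0 \<in> F" unfolding F_def by simp
  then have "D \<noteq> {}" using D(3)[of "sec 0" 1] by auto
  show ?thesis
  proof (intro exI[of _ "from_nat_into D"] conjI allI impI)
    show "from_nat_into D i \<in> M" for i using from_nat_into[OF \<open>D \<noteq> {}\<close>] D(2) FM by blast
    fix x :: "nat \<Rightarrow> 'g" assume x: "x \<longlonglongrightarrow> 0"
    then have "(\<lambda>m. f (sec (x m))) \<longlonglongrightarrow> 0" by simp
    then obtain r :: "nat \<Rightarrow> nat" and q where r: "strict_mono r"
        and lim: "limitin mtopology ((\<lambda>m. sec (x m)) \<circ> r) q sequentially" and q: "q \<in> M" "f q = 0"
      by (rule convergent_subsequence[OF sec_Z])
    obtain \<delta> where \<delta>: "\<delta> > 0" "\<And>c. c \<in> M \<Longrightarrow> d c q < \<delta> \<Longrightarrow> \<delta> \<le> rad c" using rad_near[OF q(1)] by blast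
    obtain c where c: "c \<in> D" "d c q < \<delta> / 2" using D(3)[of q "\<delta> / 2"] q \<delta>(1) unfolding F_def by auto
    have cM: "c \<in> M" using c(1) D(2) FM by blast
    have "\<forall>\<^sub>F m in sequentially. sec (x (r m)) \<in> M \<and> d (sec (x (r m))) q < \<delta> / 2"
      using lim half_gt_zero[OF \<delta>(1)] unfolding limitin_dist o_def by blast
    then obtain N where N: "\<And>m. m \<ge> N \<Longrightarrow> d (sec (x (r m))) q < \<delta> / 2" unfolding eventually_sequentially by blast
    have "x (r m) \<in> piece c" if "m \<ge> N" for m
    proof -
      have "d c (sec (x (r m))) < \<delta>"
        using triangle[of c q "sec (x (r m))"] N[OF that] c(2) cM q(1) commute[of q] by simp
      also have "\<delta> \<le> rad c" using c(2) \<delta>(1) by (intro \<delta>(2) cM) simp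
      finally have "f (sec (x (r m))) \<in> piece c" unfolding piece_def using cM by (intro imageI) simp
      then show ?thesis by simp
    qed
    then have "r ` {N..} \<subseteq> {m. x m \<in> piece c}" by auto
    moreover have "infinite (r ` {N..})"
      using finite_imageD[of r "{N..}"] strict_mono_imp_inj_on[OF r] infinite_Ici by (meson inj_on_subset subset_UNIV)
    ultimately have "infinite {m. x m \<in> piece c}" using finite_subset by blast
    moreover obtain i where "c = from_nat_into D i" using from_nat_into_surj[OF D(1) c(1)] by metis
    ultimately show "\<exists>i. infinite {m. x m \<in> piece (from_nat_into D i)}" by blast
  qed
qed

text \<open>\<open>H\<close> is generated by the pieces. A sequence converging to a point
  \<open>h\<close> of \<open>H\<close> becomes null after translation by \<open>- h\<close>, so
  infinitely many of its terms lie in one \<open>S N\<close>. By sequentiality this suffices both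
  for \<open>H\<close> to be open and for closedness to be testable on the
  \<open>S n\<close>.\<close>

lemma k_omega_filtration_exists:
  obtains H :: "'g set" and S where "k_omega_filtration H S"
proof -
  obtain c :: "nat \<Rightarrow> 'm" where c': "(\<forall>i. c i \<in> M) \<and>
      (\<forall>x :: nat \<Rightarrow> 'g. x \<longlonglongrightarrow> 0 \<longrightarrow> (\<exists>i. infinite {m. x m \<in> piece (c i)}))"
    using countable_pieces by (rule exE)
  note c = c'[THEN conjunct1, rule_format] c'[THEN conjunct2, rule_format]
  \<comment> \<open>The element 0 makes the \<open>S n\<close> increase, the negatives make their
    union a subgroup. Number of summands and number of pieces grow together, so each
    \<open>S n\<close> is compact.\<close>
  define L where "L n = {0} \<union> (\<Union>i<n. piece (c i) \<union> uminus ` piece (c i))" for n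
  define S where "S = rec_nat {0} (\<lambda>n T. {s + l | s l. s \<in> T \<and> l \<in> L n})"
  have S0: "S 0 = {0}" and S_Suc: "S (Suc n) = {s + l | s l. s \<in> S n \<and> l \<in> L n}" for n
    unfolding S_def by simp_all
  define H where "H = (\<Union>n. S n)"
  have L0: "0 \<in> L n" and L_uminus: "x \<in> L n \<Longrightarrow> - x \<in> L n" for n x unfolding L_def by auto
  have L_mono: "L m \<subseteq> L n" if "m \<le> n" for m n unfolding L_def using that by fastforce
  have L_compact: "compact (L n)" for n
    unfolding L_def using c(1) by (intro compact_Un compact_UN compact_piece compact_continuous_image continuous_intros) auto
  have S_mono1: "S n \<subseteq> S (Suc n)" for n using L0[of n] unfolding S_Suc by force
  have S_mono: "S m \<subseteq> S n" if "m \<le> n" for m n using lift_Suc_mono_le[of S, OF S_mono1 that] .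
  have S_compact: "compact (S n)" for n
    by (induction n) (simp_all add: S0 S_Suc compact_group_sum L_compact)
  have S_L: "s + l \<in> S (Suc (max n j))" if "s \<in> S n" "l \<in> L j" for s l n j
    using that S_mono[of n "max n j"] L_mono[of j "max n j"] unfolding S_Suc by auto
  have H_L: "h + l \<in> H" if "h \<in> H" "l \<in> L j" for h l j using that S_L unfolding H_def by blast
  have H_add: "h + s \<in> H" if "h \<in> H" "s \<in> S n" for h s n
    using that
  proof (induction n arbitrary: s)
    case (Suc n)
    then obtain s' l where "s = s' + l" "s' \<in> S n" "l \<in> L n" unfolding S_Suc by blast
    then show ?case using Suc.IH[OF Suc.prems(1)] H_L[of "h + s'" l n] by (simp add: add.assoc)
  qed (simp add: S0)
  have H_0: "0 \<in> H" unfolding H_def using S0 by blast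
  have H_uminus: "- s \<in> H" if "s \<in> S n" for s n
    using that
  proof (induction n arbitrary: s)
    case (Suc n)
    then obtain s' l where s: "s = s' + l" "s' \<in> S n" "l \<in> L n" unfolding S_Suc by blast
    have "0 + - l \<in> H" using H_L[OF H_0 L_uminus[OF s(3)]] .
    moreover have "- s' \<in> H" by (rule Suc.IH[OF s(2)])
    then obtain k where "- s' \<in> S k" unfolding H_def by blast
    ultimately have "0 + - l + - s' \<in> H" using H_add by blast
    then show ?case using s(1) by (simp add: minus_add)
  qed (simp add: S0 H_0)
  have H_subgroup: "add_subgroup H"
    unfolding add_subgroup_def using H_0 H_add H_uminus unfolding H_def by blast
  have key: "\<exists>N. infinite {m. x m \<in> S N}" if x: "x \<longlonglongrightarrow> h" "h \<in> H" for x :: "nat \<Rightarrow> 'g" and h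
  proof -
    have "(\<lambda>m. - h + x m) \<longlonglongrightarrow> - h + h" by (intro tendsto_intros x)
    then obtain i where i: "infinite {m. - h + x m \<in> piece (c i)}" using c(2) by auto
    obtain n where n: "h \<in> S n" using x(2) unfolding H_def by blast
    have "{m. - h + x m \<in> piece (c i)} \<subseteq> {m. x m \<in> S (Suc (max n (Suc i)))}"
    proof clarify
      fix m assume "- h + x m \<in> piece (c i)"
      then have "- h + x m \<in> L (Suc i)" unfolding L_def by blast
      from S_L[OF n this] show "x m \<in> S (Suc (max n (Suc i)))" by (simp add: add.assoc[symmetric])
    qed
    then show ?thesis using i finite_subset by blast
  qed
  have subseq: "\<exists>r. strict_mono (r :: nat \<Rightarrow> nat) \<and> (\<forall>m. x (r m) \<in> S N)" if "infinite {m. x m \<in> S N}" for x :: "nat \<Rightarrow> 'g" and N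
    using strict_mono_enumerate[OF that] enumerate_in_set[OF that] by blast
  have "closed (- H)"
  proof (rule seq)
    fix \<sigma> l assume \<sigma>: "range \<sigma> \<subseteq> - H" "\<sigma> \<longlonglongrightarrow> l"
    show "l \<in> - H"
    proof
      assume "l \<in> H"
      then obtain N where "infinite {m. \<sigma> m \<in> S N}" using key \<sigma>(2) by blast
      then obtain m where "\<sigma> m \<in> S N" using not_finite_existsD by blast
      then show False using \<sigma>(1) unfolding H_def by blast
    qed
  qed
  then have H_open: "open H" by (simp add: closed_def)
  have "closed A" if A: "A \<subseteq> H" "\<And>n. closed (A \<inter> S n)" for A
  proof (rule seq)
    fix \<sigma> l assume \<sigma>: "range \<sigma> \<subseteq> A" "\<sigma> \<longlonglongrightarrow> l"
    \<comment> \<open>An open subgroup is closed: the open coset \<open>l + H\<close> contains some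
      \<open>\<sigma> m\<close>, which lies in \<open>H\<close>.\<close>
    have "l \<in> H"
    proof -
      have "open ((+) l ` H)" "l \<in> (+) l ` H" using open_translation_group[OF H_open] H_0 by force+
      then have "\<forall>\<^sub>F m in sequentially. \<sigma> m \<in> (+) l ` H" using \<sigma>(2) by (auto dest: topological_tendstoD)
      then obtain m h where m: "\<sigma> m = l + h" "h \<in> H" by (auto simp: eventually_sequentially)
      have "\<sigma> m + - h \<in> H" using H_subgroup \<sigma>(1) A(1) m(2) unfolding add_subgroup_def by blast
      then show ?thesis unfolding m(1) by (simp add: add.assoc)
    qed
    then obtain N where "infinite {m. \<sigma> m \<in> S N}" using key \<sigma>(2) by blast
    then obtain r :: "nat \<Rightarrow> nat" where r: "strict_mono r" "\<And>m. \<sigma> (r m) \<in> S N" using subseq by blast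
    have "(\<lambda>m. \<sigma> (r m)) \<longlonglongrightarrow> l" using LIMSEQ_subseq_LIMSEQ[OF \<sigma>(2) r(1)] by (simp add: o_def)
    then have "l \<in> A \<inter> S N"
      by (rule Lim_in_closed_set[OF A(2), rotated 2])
        (use \<sigma>(1) r(2) in \<open>auto intro!: always_eventually\<close>)
    then show "l \<in> A" by blast
  qed
  then have "k_omega_filtration H S"
    unfolding k_omega_filtration_def using H_open H_subgroup S_compact S_mono1 by (auto simp: H_def)
  then show ?thesis by (rule that)
qed

end

section \<open>Consequences for the topology of the group\<close>

lemma Hausdorff_space_t2: "Hausdorff_space (euclidean :: 'a::t2_space topology)"
  unfolding Hausdorff_space_def disjnt_def using hausdorff by (metis open_openin)

lemma finite_cover_infinite_index:
  assumes "finite \<F>" "\<And>n::nat. n \<ge> N \<Longrightarrow> x n \<in> \<Union>\<F>"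
  obtains A where "A \<in> \<F>" "infinite {n. x n \<in> A}"
proof -
  have "{N..} \<subseteq> (\<Union>A\<in>\<F>. {n. x n \<in> A})" using assms(2) by auto
  then have "infinite (\<Union>A\<in>\<F>. {n. x n \<in> A})" using finite_subset infinite_Ici by blast
  then show ?thesis using that assms(1) by blast
qed

lemma countable_cs_star_character_if_base:
  fixes U :: "nat \<Rightarrow> 'g::topological_group_add set"
  assumes U: "\<And>n. open (U n)" "\<And>n. 0 \<in> U n" "\<And>V. open V \<Longrightarrow> 0 \<in> V \<Longrightarrow> \<exists>n. U n \<subseteq> V"
  shows "countable_cs_star_character (euclidean :: 'g topology)"
  unfolding countable_cs_star_character_iff
proof (intro ballI exI conjI)
  fix x :: 'g
  show "countable (range (\<lambda>n. (+) x ` U n))" by simp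
  show "cs_star_network_at euclidean x (range (\<lambda>n. (+) x ` U n))"
    unfolding cs_star_network_at_def
  proof (intro conjI allI impI)
    fix W and \<sigma> :: "nat \<Rightarrow> 'g"
    assume *: "W \<subseteq> topspace euclidean \<and> (\<exists>V. openin euclidean V \<and> x \<in> V \<and> V \<subseteq> W) \<and>
            range \<sigma> \<subseteq> W \<and> limitin euclidean \<sigma> x sequentially"
    then obtain V where V: "open V" "x \<in> V" "V \<subseteq> W" by auto
    have "open ((+) (- x) ` V)" "0 \<in> (+) (- x) ` V"
      using open_translation_group[OF V(1)] V(2) by (blast, metis image_eqI left_minus)
    then obtain n where n: "U n \<subseteq> (+) (- x) ` V" using U(3) by blast
    have sub: "(+) x ` U n \<subseteq> W" using n V(3) by (force simp: add.assoc[symmetric])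
    have "open ((+) x ` U n)" "x \<in> (+) x ` U n" using open_translation_group[OF U(1)] U(2)[of n] by force+
    moreover have "\<sigma> \<longlonglongrightarrow> x" using * by simp
    ultimately have "\<forall>\<^sub>F m in sequentially. \<sigma> m \<in> (+) x ` U n" by (auto dest: topological_tendstoD)
    then obtain N where "{N..} \<subseteq> {m. \<sigma> m \<in> (+) x ` U n}" unfolding eventually_sequentially by auto
    then have "infinite {m. \<sigma> m \<in> (+) x ` U n}" using infinite_Ici finite_subset by blast
    then show "\<exists>N\<in>range (\<lambda>n. (+) x ` U n). N \<subseteq> W \<and> infinite {n. \<sigma> n \<in> N}" using sub by blast
  qed simp
qed

lemma metrizable_group_conclusion:
  fixes U :: "nat \<Rightarrow> 'g::{topological_group_add, t2_space} set"
  assumes U: "\<And>n. open (U n)" "\<And>n. 0 \<in> U n" "\<And>V. open V \<Longrightarrow> 0 \<in> V \<Longrightarrow> \<exists>n. U n \<subseteq> V"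
  shows "stratifiable_space (euclidean :: 'g topology)" "aleph_space (euclidean :: 'g topology)"
    "metrizable_space (euclidean :: 'g topology)"
proof -
  obtain \<rho> :: "'g \<Rightarrow> 'g \<Rightarrow> real" where \<rho>': "Metric_space UNIV \<rho> \<and>
    (\<forall>S. open S \<longleftrightarrow> (\<forall>x\<in>S. \<exists>e>0. \<forall>y. \<rho> x y < e \<longrightarrow> y \<in> S))"
    using first_countable_group_metric[of U, OF U] by (rule exE)
  note \<rho> = \<rho>'[THEN conjunct1] \<rho>'[THEN conjunct2, rule_format]
  interpret Metric_space UNIV \<rho> by fact
  have top: "mtopology = (euclidean :: 'g topology)"
    unfolding topology_eq openin_mtopology using \<rho>(2) by (auto simp: subset_iff)
  show "metrizable_space (euclidean :: 'g topology)" using metrizable_space_mtopology unfolding top .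
  show "aleph_space (euclidean :: 'g topology)" using aleph_space_mtopology unfolding top .
  interpret metric_filtration \<rho> "\<lambda>n. UNIV"
  proof
    show "open S" if "\<And>n x. x \<in> S \<inter> UNIV \<Longrightarrow> \<exists>e>0. \<forall>y\<in>UNIV. \<rho> x y < e \<longrightarrow> y \<in> S" for S
      unfolding \<rho>(2)[of S] using that by simp
    show "\<exists>e>0. \<forall>y\<in>UNIV. \<rho> x y < e \<longrightarrow> y \<in> U" if "open U" "x \<in> U" for U x
      using that(1)[unfolded \<rho>(2)[of U]] that(2) by simp
  qed auto
  show "stratifiable_space (euclidean :: 'g topology)"
    by (rule stratifiable) (use Hausdorff_space_mtopology top regular_space_group in auto)
qed

text \<open>The compact collection is \<open>range S\<close>. If \<open>U\<close> is open in a
  competing topology, \<open>H - U\<close> meets every \<open>S n\<close> in a closed set, hence is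
  closed in the group, and \<open>U\<close> is open because \<open>H\<close> is.\<close>

lemma filtration_k_omega_subgroup:
  assumes "k_omega_filtration (H :: 'g::{topological_group_add, t2_space} set) S"
  shows "k_omega_subgroup H"
proof -
  have H: "add_subgroup H" "\<And>n. compact (S n)" "(\<Union>n. S n) = H" "open H"
    "\<And>A. A \<subseteq> H \<Longrightarrow> (\<And>n. closed (A \<inter> S n)) \<Longrightarrow> closed A"
    using assms unfolding k_omega_filtration_def by auto
  have "\<exists>\<C>. countable \<C> \<and> (\<forall>C\<in>\<C>. compactin (subtopology euclidean H) C) \<and>
        (\<forall>Y. topspace Y = topspace (subtopology euclidean H) \<and>
             (\<forall>C\<in>\<C>. subtopology Y C = subtopology (subtopology euclidean H) C)
           \<longrightarrow> (\<forall>U. openin Y U \<longrightarrow> openin (subtopology euclidean H) U))"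
  proof (intro exI[of _ "range S"] conjI ballI allI impI)
    show "compactin (subtopology euclidean H) C" if "C \<in> range S" for C
      using that H(2,3) by (auto simp: compactin_subtopology)
    fix Y U assume Y: "topspace Y = topspace (subtopology euclidean H) \<and>
             (\<forall>C\<in>range S. subtopology Y C = subtopology (subtopology euclidean H) C)" and U: "openin Y U"
    have UH: "U \<subseteq> H" using openin_subset[OF U] Y by simp
    have cl: "closed ((H - U) \<inter> S n)" for n
    proof -
      have SH: "S n \<subseteq> H" using H(3) by blast
      have "openin (subtopology Y (S n)) (U \<inter> S n)" using U unfolding openin_subtopology by blast
      moreover have "subtopology Y (S n) = subtopology euclidean (S n)"
        using Y SH by (simp add: subtopology_subtopology Int_absorb1)
      ultimately have "openin (top_of_set (S n)) (U \<inter> S n)" by simp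
      then obtain V where V: "open V" "U \<inter> S n = V \<inter> S n" unfolding openin_subtopology by auto
      have "(H - U) \<inter> S n = S n - V" using SH V(2) by blast
      then show ?thesis using V(1) compact_imp_closed[OF H(2)] by (simp add: closed_Diff)
    qed
    have "closed (H - U)" by (rule H(5)[OF Diff_subset cl])
    then have "open (H - (H - U))" using H(4) by (intro open_Diff)
    moreover have "H - (H - U) = U" using UH by blast
    ultimately have "open U" by (simp only:)
    then show "openin (subtopology euclidean H) U"
      using UH unfolding openin_subtopology by (intro exI[of _ U]) (simp add: Int_absorb2)
  qed simp
  moreover have "Hausdorff_space (subtopology (euclidean :: 'g topology) H)"
    by (intro Hausdorff_space_subtopology Hausdorff_space_t2)
  ultimately show ?thesis unfolding k_omega_subgroup_def k_omega_space_def using H(1) by blast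
qed

section \<open>Groups with an open \<open>k\<^sub>\<omega>\<close>-subgroup\<close>

locale k_omega_open_subgroup =
  fixes H :: "'g::{topological_group_add, t2_space} set" and S :: "nat \<Rightarrow> 'g set" and \<N> :: "'g set set"
  assumes filtration: "k_omega_filtration H S" and network: "countable_k_network_on H \<N>"
begin

lemma H_open: "open H" and H_subgroup: "add_subgroup H" and S_compact: "compact (S n)"
  and S_mono: "S n \<subseteq> S (Suc n)" and S_cover: "(\<Union>n. S n) = H"
  and closed_if: "A \<subseteq> H \<Longrightarrow> (\<And>n. closed (A \<inter> S n)) \<Longrightarrow> closed A"
  using filtration unfolding k_omega_filtration_def by auto

lemma H_zero: "0 \<in> H" and H_add: "x \<in> H \<Longrightarrow> y \<in> H \<Longrightarrow> x + y \<in> H" and H_uminus: "x \<in> H \<Longrightarrow> - x \<in> H"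
  using H_subgroup unfolding add_subgroup_def by auto

lemma S_sub: "S n \<subseteq> H" using S_cover by blast

lemma H_closed: "closed H"
proof (rule closed_if)
  fix n have "H \<inter> S n = S n" using S_sub by blast
  then show "closed (H \<inter> S n)" using compact_imp_closed[OF S_compact] by simp
qed simp

lemma network_countable: "countable \<N>" and network_sub: "N \<in> \<N> \<Longrightarrow> N \<subseteq> H"
  and network_cover: "open U \<Longrightarrow> compact K \<Longrightarrow> K \<subseteq> U \<inter> H \<Longrightarrow> \<exists>\<F>. finite \<F> \<and> \<F> \<subseteq> \<N> \<and> K \<subseteq> \<Union>\<F> \<and> \<Union>\<F> \<subseteq> U"
  using network unfolding countable_k_network_on_def by auto

text \<open>A representative of the left coset \<open>g + H\<close>. The choice depends on
  \<open>g\<close> only through the predicate, which is the same for all elements of the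
  coset.\<close>

definition rep :: "'g \<Rightarrow> 'g" where "rep g = (SOME t. - t + g \<in> H)"

lemma rep: "- rep g + g \<in> H"
  unfolding rep_def by (rule someI[of _ g]) (simp add: H_zero)

lemma rep_eq:
  assumes "- x + y \<in> H"
  shows "rep x = rep y"
proof -
  have "- t + x \<in> H \<longleftrightarrow> - t + y \<in> H" for t
  proof
    assume "- t + x \<in> H"
    then have "(- t + x) + (- x + y) \<in> H" using assms H_add by blast
    then show "- t + y \<in> H" by (simp only: add.assoc add_minus_cancel)
  next
    assume "- t + y \<in> H"
    then have "(- t + y) + - (- x + y) \<in> H" using assms H_add H_uminus by blast
    then show "- t + x \<in> H" by (simp only: add.assoc minus_add minus_minus add_minus_cancel)
  qed
  then show ?thesis unfolding rep_def by simp
qed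

lemma rep_translate:
  assumes "h \<in> H"
  shows "rep (rep x + h) = rep x"
proof -
  have "- x + (rep x + h) = - (- rep x + x) + h" by (simp only: minus_add minus_minus add.assoc)
  then have "- x + (rep x + h) \<in> H" using H_add[OF H_uminus[OF rep[of x]] assms] by simp
  from rep_eq[OF this] show ?thesis by simp
qed

lemma rep_decompose: "rep x + (- rep x + x) = x"
  by (simp only: add.assoc[symmetric] right_minus add_0)

lemma open_coset: "open ((+) x ` H)" "x \<in> (+) x ` H"
  using open_translation_group[OF H_open] H_zero by force+

lemma open_preimage:
  assumes "open (U :: 'g set)"
  shows "open {h. x + h \<in> U}"
proof -
  have "open ((\<lambda>h. x + h) -` U)" by (intro open_vimage assms continuous_intros)
  then show ?thesis by (simp add: vimage_def)
qed

text \<open>After translation to 0, a tail of the sequence with its limit is a compact subset of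
  \<open>H\<close>; finitely many network members cover it, and one of them contains infinitely many
  terms.\<close>

lemma countable_cs_star_character: "countable_cs_star_character (euclidean :: 'g topology)"
  unfolding countable_cs_star_character_iff
proof (intro ballI exI conjI)
  fix x :: 'g
  show "countable (image ((+) x) ` \<N>)" using network_countable by simp
  show "cs_star_network_at euclidean x (image ((+) x) ` \<N>)"
    unfolding cs_star_network_at_def
  proof (intro conjI allI impI)
    fix W and \<sigma> :: "nat \<Rightarrow> 'g"
    assume *: "W \<subseteq> topspace euclidean \<and> (\<exists>V. openin euclidean V \<and> x \<in> V \<and> V \<subseteq> W) \<and>
            range \<sigma> \<subseteq> W \<and> limitin euclidean \<sigma> x sequentially"
    then obtain V where V: "open V" "x \<in> V" "V \<subseteq> W" by auto
    define V' where "V' = {h. x + h \<in> V} \<inter> H"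
    have V': "open V'" "0 \<in> V'" unfolding V'_def using open_preimage[OF V(1)] V(2) H_open H_zero by auto
    have "\<sigma> \<longlonglongrightarrow> x" using * by simp
    then have lim: "(\<lambda>n. - x + \<sigma> n) \<longlonglongrightarrow> - x + x" by (intro tendsto_intros)
    then have "\<forall>\<^sub>F n in sequentially. - x + \<sigma> n \<in> V'" using V' by (auto dest: topological_tendstoD)
    then obtain N where N: "\<And>n. n \<ge> N \<Longrightarrow> - x + \<sigma> n \<in> V'" unfolding eventually_sequentially by blast
    have "(\<lambda>n. - x + \<sigma> (n + N)) \<longlonglongrightarrow> 0" using LIMSEQ_ignore_initial_segment[OF lim, of N] by simp
    then have comp: "compact (insert 0 (range (\<lambda>n. - x + \<sigma> (n + N))))" by (rule compact_range_limit)
    have sub: "insert 0 (range (\<lambda>n. - x + \<sigma> (n + N))) \<subseteq> V' \<inter> H"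
      using N V'(2) H_zero unfolding V'_def by auto
    obtain \<F> where "finite \<F> \<and> \<F> \<subseteq> \<N> \<and> insert 0 (range (\<lambda>n. - x + \<sigma> (n + N))) \<subseteq> \<Union>\<F> \<and> \<Union>\<F> \<subseteq> V'"
      using network_cover[OF V'(1) comp sub] by (rule exE)
    then have \<F>: "finite \<F>" "\<F> \<subseteq> \<N>" "insert 0 (range (\<lambda>n. - x + \<sigma> (n + N))) \<subseteq> \<Union>\<F>" "\<Union>\<F> \<subseteq> V'"
      by simp_all
    have "- x + \<sigma> n \<in> \<Union>\<F>" if "n \<ge> N" for n
    proof -
      have "- x + \<sigma> (n - N + N) \<in> \<Union>\<F>" using \<F>(3) by blast
      then show ?thesis using that by simp
    qed
    then obtain A where A: "A \<in> \<F>" "infinite {n. - x + \<sigma> n \<in> A}"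
      using finite_cover_infinite_index[OF \<F>(1), of N "\<lambda>n. - x + \<sigma> n"] by blast
    have "{n. - x + \<sigma> n \<in> A} \<subseteq> {n. \<sigma> n \<in> (+) x ` A}"
    proof clarify
      fix n assume "- x + \<sigma> n \<in> A"
      then show "\<sigma> n \<in> (+) x ` A" by (rule rev_image_eqI) (simp add: add.assoc[symmetric])
    qed
    then have "infinite {n. \<sigma> n \<in> (+) x ` A}" using A(2) finite_subset by blast
    moreover have "(+) x ` A \<subseteq> W" using A(1) \<F>(4) V(3) unfolding V'_def by blast
    ultimately show "\<exists>N\<in>image ((+) x) ` \<N>. N \<subseteq> W \<and> infinite {n. \<sigma> n \<in> N}" using A(1) \<F>(2) by blast
  qed simp
qed

text \<open>The cosets of \<open>H\<close> are open and disjoint. For a fixed network member its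
  copies in the cosets form a locally finite family, each coset meeting at most one of them; the
  countably many members give the countable union.\<close>

lemma aleph_space: "aleph_space (euclidean :: 'g topology)"
proof -
  define D where "D t N = {g. rep g = t \<and> - t + g \<in> N}" for t N
  define \<A> where "\<A> i = (\<lambda>t. D t (from_nat_into (insert {} \<N>) i)) ` range rep" for i
  \<comment> \<open>Adding the empty set makes the enumeration meaningful even for empty
    \<open>\<N>\<close> and only adds empty copies.\<close>
  have ran: "range (from_nat_into (insert {} \<N>)) = insert {} \<N>"
    using network_countable by (intro range_from_nat_into) auto
  have lf: "locally_finite_in euclidean (\<A> i)" for i
    unfolding locally_finite_in_def
  proof (intro conjI ballI)
    fix x :: 'g
    have "{U \<in> \<A> i. U \<inter> (+) x ` H \<noteq> {}} \<subseteq> {D (rep x) (from_nat_into (insert {} \<N>) i)}"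
    proof
      fix U assume "U \<in> {U \<in> \<A> i. U \<inter> (+) x ` H \<noteq> {}}"
      then obtain h where "U \<in> \<A> i" "x + h \<in> U" "h \<in> H" by blast
      then obtain t where t: "U = D t (from_nat_into (insert {} \<N>) i)" unfolding \<A>_def by blast
      have "rep (x + h) = t" using \<open>x + h \<in> U\<close> unfolding t D_def by simp
      moreover have "rep x = rep (x + h)" using \<open>h \<in> H\<close> by (intro rep_eq) (simp add: add.assoc[symmetric])
      ultimately show "U \<in> {D (rep x) (from_nat_into (insert {} \<N>) i)}" using t by simp
    qed
    then have "finite {U \<in> \<A> i. U \<inter> (+) x ` H \<noteq> {}}" using finite_subset by blast
    then show "\<exists>V. openin euclidean V \<and> x \<in> V \<and> finite {U \<in> \<A> i. U \<inter> V \<noteq> {}}"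
      using open_coset[of x] by (intro exI[of _ "(+) x ` H"]) simp
  qed simp
  have UN: "(\<Union>i. \<A> i) = {D t N | t N. t \<in> range rep \<and> N \<in> insert {} \<N>}"
  proof -
    have "(\<Union>i. \<A> i) = (\<Union>N\<in>range (from_nat_into (insert {} \<N>)). (\<lambda>t. D t N) ` range rep)"
      unfolding \<A>_def by simp
    also have "\<dots> = {D t N | t N. t \<in> range rep \<and> N \<in> insert {} \<N>}" unfolding ran by blast
    finally show ?thesis .
  qed
  have "k_network euclidean (\<Union>i. \<A> i)"
    unfolding k_network_def
  proof (intro conjI allI impI)
    fix U K :: "'g set" assume "openin euclidean U \<and> compactin euclidean K \<and> K \<subseteq> U"
    then have U: "open U" and K: "compact K" "K \<subseteq> U" by auto
    have "K \<subseteq> (\<Union>x\<in>K. (+) x ` H)" using open_coset(2) by blast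
    then obtain C where C: "C \<subseteq> K" "finite C" "K \<subseteq> (\<Union>x\<in>C. (+) x ` H)"
      by (rule compactE_image[OF K(1) open_coset(1)])
    have "\<exists>\<F>. finite \<F> \<and> \<F> \<subseteq> \<N> \<and> {h. rep x + h \<in> K} \<inter> H \<subseteq> \<Union>\<F> \<and> \<Union>\<F> \<subseteq> {h. rep x + h \<in> U}" for x
    proof (rule network_cover)
      have "{h. rep x + h \<in> K} = (+) (- rep x) ` K"
        by (force simp: image_iff add.assoc[symmetric])
      then have "compact {h. rep x + h \<in> K}"
        using K(1) by (simp add: compact_continuous_image continuous_intros)
      then show "compact ({h. rep x + h \<in> K} \<inter> H)" using H_closed by (rule compact_Int_closed)
    qed (use open_preimage[OF U] K(2) in auto)
    then obtain \<F> where \<F>: "\<And>x. finite (\<F> x)" "\<And>x. \<F> x \<subseteq> \<N>" "\<And>x. {h. rep x + h \<in> K} \<inter> H \<subseteq> \<Union>(\<F> x)"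
        "\<And>x. \<Union>(\<F> x) \<subseteq> {h. rep x + h \<in> U}" by metis
    show "\<exists>\<F>. finite \<F> \<and> \<F> \<subseteq> (\<Union>i. \<A> i) \<and> K \<subseteq> \<Union>\<F> \<and> \<Union>\<F> \<subseteq> U"
    proof (intro exI[of _ "\<Union>x\<in>C. D (rep x) ` \<F> x"] conjI)
      show "finite (\<Union>x\<in>C. D (rep x) ` \<F> x)" using C(2) \<F>(1) by blast
      show "(\<Union>x\<in>C. D (rep x) ` \<F> x) \<subseteq> (\<Union>i. \<A> i)" unfolding UN using \<F>(2) by blast
      show "K \<subseteq> \<Union>(\<Union>x\<in>C. D (rep x) ` \<F> x)"
      proof
        fix k assume k: "k \<in> K"
        then obtain x h where x: "x \<in> C" "k = x + h" "h \<in> H" using C(3) by blast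
        have r: "rep k = rep x" using x(3) unfolding x(2) by (intro rep_eq[symmetric]) (simp add: add.assoc[symmetric])
        have "- rep x + k \<in> {h. rep x + h \<in> K} \<inter> H"
          using k rep[of k] rep_decompose[of k] unfolding r by simp
        then obtain N where "N \<in> \<F> x" "- rep x + k \<in> N" using \<F>(3) by blast
        then have "k \<in> D (rep x) N" unfolding D_def using r by simp
        then show "k \<in> \<Union>(\<Union>x\<in>C. D (rep x) ` \<F> x)" using x(1) \<open>N \<in> \<F> x\<close> by blast
      qed
      show "\<Union>(\<Union>x\<in>C. D (rep x) ` \<F> x) \<subseteq> U"
      proof clarify
        fix g x N assume "x \<in> C" "N \<in> \<F> x" "g \<in> D (rep x) N"
        then have "- rep x + g \<in> {h. rep x + h \<in> U}" using \<F>(4) unfolding D_def by blast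
        then show "g \<in> U" by (simp add: add.assoc[symmetric])
      qed
    qed
  qed simp
  then show ?thesis unfolding aleph_space_def sigma_locally_finite_in_def
    using lf regular_space_group Hausdorff_space_t2 by blast
qed

text \<open>By regularity a nonzero point of \<open>H\<close> lies in a network member whose closure
  misses 0; the complements of these countably many closures, together with \<open>H\<close>, meet
  in 0. Starting with \<open>H\<close> later forces close points into one coset.\<close>

lemma zero_G_delta:
  obtains U :: "nat \<Rightarrow> 'g set" where "\<And>n. open (U n)" "\<And>n. 0 \<in> U n" "(\<Inter>n. U n) = {0}" "U 0 = H"
proof -
  define \<U> where "\<U> = insert H ((\<lambda>N. - closure N) ` {N \<in> \<N>. 0 \<notin> closure N})"
  have cnt: "countable \<U>" unfolding \<U>_def using network_countable by simp
  define U where "U n = (case n of 0 \<Rightarrow> H | Suc n \<Rightarrow> from_nat_into \<U> n)" for n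
  have "\<U> \<noteq> {}" "H \<in> \<U>" unfolding \<U>_def by auto
  then have U_in: "U n \<in> \<U>" for n unfolding U_def using from_nat_into[of \<U>] by (cases n) simp_all
  have zero: "x = 0" if x: "\<forall>n. x \<in> U n" for x
  proof (rule ccontr)
    assume "x \<noteq> 0"
    then have "open (- {0 :: 'g})" "x \<in> - {0}" by (auto intro: open_Compl)
    then have "\<exists>V W. openin euclidean V \<and> closedin euclidean W \<and> x \<in> V \<and> V \<subseteq> W \<and> W \<subseteq> - {0}"
      using regular_space_group[unfolded neighbourhood_base_of_closedin[symmetric]
        neighbourhood_base_of_def neighbourhood_base_at_def, rule_format, of x "- {0}"] by simp
    then obtain V W where V: "open V" "closed W" "x \<in> V" "V \<subseteq> W" "W \<subseteq> - {0}"
      by auto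
    have "x \<in> H" using x[rule_format, of 0] unfolding U_def by simp
    then have sub: "{x} \<subseteq> V \<inter> H" using V(3) by simp
    obtain \<F> where "finite \<F> \<and> \<F> \<subseteq> \<N> \<and> {x} \<subseteq> \<Union>\<F> \<and> \<Union>\<F> \<subseteq> V"
      using network_cover[OF V(1) compact_sing sub] by (rule exE)
    then obtain N where N: "N \<in> \<N>" "x \<in> N" "N \<subseteq> V" by blast
    have "0 \<notin> closure N" using closure_minimal[of N W] N V by blast
    then have "- closure N \<in> \<U>" unfolding \<U>_def using N(1) by blast
    then obtain n where "- closure N = from_nat_into \<U> n" using from_nat_into_surj[OF cnt] by metis
    then have "x \<notin> U (Suc n)" unfolding U_def using N(2) closure_subset by auto
    then show False using x by blast
  qed
  have nbhd: "open (U n)" "0 \<in> U n" for n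
    using U_in[of n] H_open H_zero unfolding \<U>_def by (auto simp: open_Compl[OF closed_closure])
  have "(\<Inter>n. U n) = {0}" using zero nbhd(2) by blast
  moreover have "U 0 = H" by (simp add: U_def)
  ultimately show ?thesis by (rule that[OF nbhd])
qed

text \<open>The metric obtained from \<open>zero_G_delta\<close> is continuous, so on a compact set
  it gives the original topology. Left invariance carries this from \<open>S n\<close> to all its
  translates, and the levels \<open>K n\<close> collect one translate of \<open>S n\<close> from
  each coset.\<close>

lemma stratifiable_space: "stratifiable_space (euclidean :: 'g topology)"
proof -
  obtain U :: "nat \<Rightarrow> 'g set" where U: "\<And>n. open (U n)" "\<And>n. 0 \<in> U n" "(\<Inter>n. U n) = {0}" "U 0 = H"
    using zero_G_delta by blast
  obtain \<rho> :: "'g \<Rightarrow> 'g \<Rightarrow> real" where \<rho>: "Metric_space UNIV \<rho>"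
    "\<forall>a x y. \<rho> (a + x) (a + y) = \<rho> x y"
    "\<forall>x e. open {y. \<rho> x y < e}" "\<forall>n. \<exists>e>0. \<forall>x y. \<rho> x y < e \<longrightarrow> - x + y \<in> U n"
    using group_metric_exists[of U, OF U(1-3)] by (elim exE conjE)
  interpret Metric_space UNIV \<rho> by fact
  obtain e0 where e0: "e0 > 0" "\<And>x y. \<rho> x y < e0 \<Longrightarrow> - x + y \<in> H" using \<rho>(4) U(4) by metis
  have cont: "continuous_on UNIV (\<rho> x)" for x
    unfolding continuous_on_open_vimage[OF open_UNIV]
  proof (intro allI impI)
    fix B :: "real set" assume B: "open B"
    have "open (\<rho> x -` B)"
    proof (rule topological_space_class.openI)
      fix y assume "y \<in> \<rho> x -` B"
      then obtain e where e: "e > 0" "ball (\<rho> x y) e \<subseteq> B" using B unfolding open_contains_ball by auto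
      have "{z. \<rho> y z < e} \<subseteq> \<rho> x -` B"
      proof clarify
        fix z assume "\<rho> y z < e"
        then have "\<rho> x z \<in> ball (\<rho> x y) e"
          using triangle[of x y z] triangle[of x z y] commute[of z y] by (simp add: dist_real_def)
        then show "z \<in> \<rho> x -` B" using e(2) by blast
      qed
      then show "\<exists>T. open T \<and> y \<in> T \<and> T \<subseteq> \<rho> x -` B" using \<rho>(3) e(1) by (intro exI[of _ "{z. \<rho> y z < e}"]) auto
    qed
    then show "open (\<rho> x -` B \<inter> UNIV)" by simp
  qed
  define K where "K n = {g. - rep g + g \<in> S n}" for n
  have K_translate: "rep x + s \<in> K n \<longleftrightarrow> s \<in> S n" if "s \<in> H" for x s n
    unfolding K_def using rep_translate[OF that, of x] by (simp add: add.assoc[symmetric])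
  interpret metric_filtration \<rho> K
  proof
    show "K n \<subseteq> K (Suc n)" for n unfolding K_def using S_mono by blast
    show "(\<Union>n. K n) = UNIV" using rep S_cover unfolding K_def by blast
    show "closed (K n)" for n
      unfolding closed_def
    proof (rule topological_space_class.openI)
      fix g assume g: "g \<in> - K n"
      let ?T = "(+) (rep g) ` (H - S n)"
      have "open ?T"
        by (intro open_translation_group open_Diff H_open compact_imp_closed S_compact)
      moreover have "g \<in> ?T"
      proof -
        have "- rep g + g \<in> H - S n" using g rep unfolding K_def by blast
        then have "rep g + (- rep g + g) \<in> ?T" by (rule imageI)
        then show ?thesis unfolding rep_decompose .
      qed
      moreover have "?T \<subseteq> - K n" using K_translate by blast
      ultimately show "\<exists>T. open T \<and> g \<in> T \<and> T \<subseteq> - K n" by blast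
    qed
    fix T :: "'g set" and n and x :: 'g
    show "\<exists>e>0. \<forall>y\<in>K n. \<rho> x y < e \<longrightarrow> y \<in> T" if T: "open T" "x \<in> T" "x \<in> K n"
    proof -
      \<comment> \<open>The distance from \<open>x\<close> is continuous and positive on the compact
        set \<open>rep x + C\<close>, so it has a positive minimum. The bound \<open>e0\<close>
        keeps other cosets out.\<close>
      define C where "C = S n \<inter> - {s. rep x + s \<in> T}"
      have C: "compact C" unfolding C_def
        using open_preimage[OF T(1)] by (intro compact_Int_closed S_compact) (simp add: closed_def)
      have "\<exists>e>0. \<forall>s\<in>C. e \<le> \<rho> x (rep x + s)"
      proof (cases "C = {}")
        case False
        have "continuous_on C (\<lambda>s. \<rho> x (rep x + s))"
          by (rule continuous_on_compose2[OF cont[of x]]) (intro continuous_intros, simp)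
        then obtain s where s: "s \<in> C" "\<And>s'. s' \<in> C \<Longrightarrow> \<rho> x (rep x + s) \<le> \<rho> x (rep x + s')"
          using continuous_attains_inf[OF C False] by blast
        have "\<rho> x (rep x + s) > 0" using s(1) T(2) mdist_pos_less[of x "rep x + s"] unfolding C_def by auto
        then show ?thesis using s(2) by blast
      qed (auto intro: exI[of _ 1])
      then obtain e where e: "e > 0" "\<And>s. s \<in> C \<Longrightarrow> e \<le> \<rho> x (rep x + s)" by blast
      have "y \<in> T" if y: "y \<in> K n" "\<rho> x y < min e e0" for y
      proof (rule ccontr)
        assume "y \<notin> T"
        have r: "rep x = rep y" using e0(2)[of x y] y(2) by (intro rep_eq) simp
        then have "- rep x + y \<in> C" using y(1) \<open>y \<notin> T\<close> rep_decompose[of y] unfolding C_def K_def by simp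
        then have "e \<le> \<rho> x y" using e(2)[of "- rep x + y"] rep_decompose[of y] unfolding r by simp
        then show False using y(2) by simp
      qed
      then show ?thesis using e(1) e0(1) by (intro exI[of _ "min e e0"]) auto
    qed
  next
    fix T :: "'g set"
    assume T: "\<And>n x. x \<in> T \<inter> K n \<Longrightarrow> \<exists>e>0. \<forall>y\<in>K n. \<rho> x y < e \<longrightarrow> y \<in> T"
    show "open T"
    proof (rule topological_space_class.openI)
      fix x assume x: "x \<in> T"
      define V where "V = {h \<in> H. rep x + h \<in> T}"
      have cl: "closed ((H - V) \<inter> S n)" for n
      proof -
        have "\<exists>e>0. \<forall>h'\<in>S n. \<rho> h h' < e \<longrightarrow> h' \<in> V" if h: "h \<in> V" "h \<in> S n" for h
        proof -
          have "rep x + h \<in> T \<inter> K n" using h S_sub K_translate unfolding V_def by blast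
          then obtain e where e: "e > 0" "\<forall>y\<in>K n. \<rho> (rep x + h) y < e \<longrightarrow> y \<in> T" using T by blast
          have "h' \<in> V" if "h' \<in> S n" "\<rho> h h' < e" for h'
          proof -
            have "h' \<in> H" "rep x + h' \<in> K n" using that(1) S_sub K_translate by blast+
            moreover have "\<rho> (rep x + h) (rep x + h') < e" using that(2) \<rho>(2) by simp
            ultimately show ?thesis using e(2) unfolding V_def by blast
          qed
          then show ?thesis using e(1) by blast
        qed
        then have "\<exists>e. \<forall>h\<in>V \<inter> S n. e h > 0 \<and> (\<forall>h'\<in>S n. \<rho> h h' < e h \<longrightarrow> h' \<in> V)"
          by (intro bchoice ballI) simp
        then obtain e where e: "\<forall>h\<in>V \<inter> S n. e h > 0 \<and> (\<forall>h'\<in>S n. \<rho> h h' < e h \<longrightarrow> h' \<in> V)"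
          by (rule exE)
        \<comment> \<open>Balls are open in the group, so \<open>V\<close> has an open trace on
          \<open>S n\<close>.\<close>
        have "(H - V) \<inter> S n = S n - (\<Union>h\<in>V \<inter> S n. {h'. \<rho> h h' < e h})"
        proof (intro equalityI subsetI)
          fix h assume h: "h \<in> S n - (\<Union>h\<in>V \<inter> S n. {h'. \<rho> h h' < e h})"
          have "h \<notin> V"
          proof
            assume "h \<in> V"
            then have "\<rho> h h < e h" using h e by simp
            then show False using h \<open>h \<in> V\<close> by blast
          qed
          then show "h \<in> (H - V) \<inter> S n" using h S_sub by blast
        next
          fix h assume h: "h \<in> (H - V) \<inter> S n"
          have "h \<notin> {h'. \<rho> k h' < e k}" if k: "k \<in> V \<inter> S n" for k
          proof -
            have "\<forall>h'\<in>S n. \<rho> k h' < e k \<longrightarrow> h' \<in> V" using e k by blast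
            then show ?thesis using h by blast
          qed
          then show "h \<in> S n - (\<Union>h\<in>V \<inter> S n. {h'. \<rho> h h' < e h})" using h by simp
        qed
        also have "closed \<dots>"
          by (intro closed_Diff compact_imp_closed S_compact open_UN ballI \<rho>(3)[rule_format])
        finally show ?thesis .
      qed
      have "closed (H - V)" by (rule closed_if[OF Diff_subset cl])
      then have "open (H - (H - V))" using H_open by (intro open_Diff)
      moreover have "H - (H - V) = V" unfolding V_def by blast
      ultimately have "open ((+) (rep x) ` V)" using open_translation_group by simp
      moreover have "x \<in> (+) (rep x) ` V"
      proof -
        have "- rep x + x \<in> V" unfolding V_def mem_Collect_eq rep_decompose using x rep by blast
        then have "rep x + (- rep x + x) \<in> (+) (rep x) ` V" by (rule imageI)
        then show ?thesis unfolding rep_decompose .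
      qed
      moreover have "(+) (rep x) ` V \<subseteq> T" unfolding V_def by blast
      ultimately show "\<exists>W. open W \<and> x \<in> W \<and> W \<subseteq> T" by blast
    qed
  qed
  show ?thesis by (rule stratifiable) (rule Hausdorff_space_t2 regular_space_group)+
qed

end

text \<open>The metrizable space is cut down to the closure of \<open>Z\<close>, so that
  \<open>Z\<close> becomes dense. Subsets of \<open>Z\<close> have the same closure in both spaces,
  so subproperness survives.\<close>

lemma sequential_k_star_group_exists:
  assumes seq: "sequential_space (euclidean :: 'g::{topological_group_add, t2_space} topology)"
    and k: "k_star_metrizable TYPE('m) (euclidean :: 'g::{topological_group_add, t2_space} topology)"
  obtains M d and f :: "'m \<Rightarrow> 'g::{topological_group_add, t2_space}" and Z where "sequential_k_star_group M d f Z"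
proof -
  obtain X :: "'m topology" and f :: "'m \<Rightarrow> 'g" where X: "metrizable_space X" and f: "subproper_map X euclidean f"
    using k unfolding k_star_metrizable_def by blast
  obtain Z where cont: "continuous_map X euclidean f" and Z: "Z \<subseteq> topspace X" "f ` Z = UNIV"
     "\<And>K. precompactin euclidean K \<Longrightarrow> precompactin X (Z \<inter> f -` K)"
    using f unfolding subproper_map_def by auto
  obtain M d where "Metric_space M d" and XM: "X = Metric_space.mtopology M d"
    using X unfolding metrizable_space_def by blast
  interpret Metric_space M d by fact
  have ZM: "Z \<subseteq> M" using Z(1) unfolding XM by simp
  define A where "A = mtopology closure_of Z"
  have AM: "A \<subseteq> M" unfolding A_def using closure_of_subset_topspace[of mtopology Z] by simp
  have ZA: "Z \<subseteq> A" unfolding A_def using ZM by (intro closure_of_subset) simp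
  interpret sub: Submetric M d A by unfold_locales (rule AM)
  have top: "sub.sub.mtopology = subtopology mtopology A" by (rule sub.mtopology_submetric)
  have cl: "sub.sub.mtopology closure_of B = mtopology closure_of B" if "B \<subseteq> Z" for B
  proof -
    have "mtopology closure_of B \<subseteq> A" unfolding A_def using that by (rule closure_of_mono)
    moreover have "A \<inter> B = B" using that ZA by blast
    ultimately show ?thesis unfolding top closure_of_subtopology by (simp add: Int_absorb1)
  qed
  have "sequential_k_star_group A d f Z"
  proof
    have "\<forall>T :: 'g set. (\<forall>\<sigma> l. range \<sigma> \<subseteq> T \<and> \<sigma> \<longlonglongrightarrow> l \<longrightarrow> l \<in> T) \<longrightarrow> closed T"
      using seq unfolding sequential_space_def sequentially_closedin_def by simp
    then show "closed S" if "\<And>\<sigma> l. range \<sigma> \<subseteq> S \<Longrightarrow> \<sigma> \<longlonglongrightarrow> l \<Longrightarrow> l \<in> S" for S :: "'g set"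
      using that by blast
    show "Z \<subseteq> A" by (rule ZA)
    show "sub.sub.mtopology closure_of Z = A" using cl[of Z] unfolding A_def by simp
    show "f ` Z = UNIV" by (rule Z(2))
    show "continuous_map sub.sub.mtopology euclidean f"
      using cont unfolding top XM by (rule continuous_map_from_subtopology)
    fix K :: "'g set" assume "compact K"
    then have "precompactin euclidean K" unfolding precompactin_def
      by (simp add: compact_imp_closed closure_of_closedin)
    then have "compactin mtopology (mtopology closure_of (Z \<inter> f -` K))"
      using Z(3) unfolding precompactin_def XM by blast
    moreover have "mtopology closure_of (Z \<inter> f -` K) \<subseteq> A" unfolding A_def by (rule closure_of_mono) blast
    ultimately show "compactin sub.sub.mtopology (sub.sub.mtopology closure_of (Z \<inter> f -` K))"
      unfolding cl[OF Int_lower1] unfolding top by (simp add: compactin_subtopology)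
  qed
  then show ?thesis by (rule that)
qed

theorem theorem13p3:
  assumes "sequential_space (euclidean :: 'g::{topological_group_add, t2_space} topology)"
    and "k_star_metrizable TYPE('m) (euclidean :: 'g topology)"
  shows "countable_cs_star_character (euclidean :: 'g topology) \<and>
         stratifiable_space (euclidean :: 'g topology) \<and>
         aleph_space (euclidean :: 'g topology) \<and>
         (metrizable_space (euclidean :: 'g topology) \<or>
          (\<exists>H :: 'g set. open H \<and> k_omega_subgroup H))"
proof -
  obtain M d and f :: "'m \<Rightarrow> 'g" and Z where "sequential_k_star_group M d f Z"
    by (rule sequential_k_star_group_exists[OF assms])
  then interpret sequential_k_star_group M d f Z .
  from countable_base_or_locally_compact show ?thesis
  proof
    assume "\<exists>U :: nat \<Rightarrow> 'g set. (\<forall>n. open (U n) \<and> 0 \<in> U n) \<and> (\<forall>V. open V \<and> 0 \<in> V \<longrightarrow> (\<exists>n. U n \<subseteq> V))"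
    then obtain U :: "nat \<Rightarrow> 'g set" where "\<And>n. open (U n)" "\<And>n. 0 \<in> U n"
      "\<And>V. open V \<Longrightarrow> 0 \<in> V \<Longrightarrow> \<exists>n. U n \<subseteq> V" by blast
    then show ?thesis
      using countable_cs_star_character_if_base[of U] metrizable_group_conclusion[of U] by blast
  next
    assume "\<forall>p\<in>M. \<exists>e>0. compactin mtopology (mcball p e)"
    then interpret locally_compact_k_star_group M d f Z by unfold_locales blast
    obtain H :: "'g set" and S where HS: "k_omega_filtration H S" by (rule k_omega_filtration_exists)
    obtain \<N> where "countable_k_network_on H \<N>" by (rule countable_k_network_on_filtration[OF HS])
    then interpret k_omega_open_subgroup H S \<N> using HS by unfold_locales
    show ?thesis
      using countable_cs_star_character stratifiable_space aleph_space filtration_k_omega_subgroup[OF HS] H_open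
      by blast
  qed
qed

end
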